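(* Let $0<\alpha<1$, $T>0$, and let $A=A(x,D_x)=A_0(x,D_x)+A_1(x,D_x)$ be a differential operator of order $2b$ on $\mathbb R^n$ with $N\times N$ matrix coefficients that are bounded, globally Hölder continuous, and satisfy the uniform strong parabolicity condition (see context). Let $u(t,x)$, $0\le t\le T$, $x\in\mathbb R^n$, be a uniform classical solution of the problem $$(\mathbb D_t^{(\alpha)}u)(t,x)-A(x,D_x)u(t,x)=0,\qquad u(0,x)=0.$$ Suppose that the function $u(t,x)$ and all its derivatives in $x$ of orders $\le2b$ are bounded and globally Hölder continuous. Then $u(t,x)$ equals zero identically.
   Context: Notation: $D_{x_j}=\frac1{\sqrt{-1}}\frac{\partial}{\partial x_j}$, $D_x^\beta=D_{x_1}^{\beta_1}\cdots D_{x_n}^{\beta_n}$, $|\beta|=\beta_1+\dots+\beta_n$. $n,N,b$ are positive integers, $u=(u_1,\dots,u_N)$ is $\mathbb C^N$-valued. The Caputo–Dzhrbashyan derivative of order $\alpha\in(0,1)$ is $$(\mathbb D_t^{(\alpha)}u)(t,x)=\frac1{\Gamma(1-\alpha)}\left[\frac{\partial}{\partial t}\int_0^t(t-\tau)^{-\alpha}u(\tau,x)\,d\tau-t^{-\alpha}u(0,x)\right].$$ Operator: $(A_0(x,D_x)u)_i=\sum_{j=1}^N\sum_{|\beta|=2b}a_\beta^{ij}(x)D_x^\beta u_j$, $(A_1(x,D_x)u)_i=\sum_{j=1}^N\sum_{|\beta|<2b}a_\beta^{ij}(x)D_x^\beta u_j$, $i=1,\dots,N$, with complex-valued coefficients.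 Assumptions: all $a_\beta^{ij}$ are bounded and satisfy the global Hölder condition $|a_\beta^{ij}(x)-a_\beta^{ij}(y)|\le C|x-y|^\gamma$ with some $\gamma>0$; uniform strong parabolicity: there is $\delta>0$ such that $\operatorname{Re}\langle A_0(x,\eta)z,z\rangle\le-\delta|\eta|^{2b}|z|^2$ for all $x,\eta\in\mathbb R^n$, $z\in\mathbb C^N$, where $A_0(x,\eta)$ is the matrix with entries $\sum_{|\beta|=2b}a_\beta^{ij}(x)\eta^\beta$. For the problem $\mathbb D_t^{(\alpha)}u-Au=f$, $u(0,x)=u_0(x)$, a vector-function $u(t,x)$, $0\le t\le T$, $x\in\mathbb R^n$, is a classical solution if: (1) $u$ is continuously differentiable in $x$ up to order $2b$ for each $t>0$; (2) for each $x$, $u(t,x)$ is continuous in $t$ on $[0,T]$, and its fractional integral $(I_{0+}^{1-\alpha}u)(t,x)=\frac1{\Gamma(1-\alpha)}\int_0^t(t-\tau)^{-\alpha}u(\tau,x)\,d\tau$ is continuously differentiable in $t$ for $0\le t\le T$; (3) $u$ satisfies the equation and the initial condition. A classical solution is a uniform classical solution if it is continuous in $t$ uniformly with respect to $x\in\mathbb R^n$, and the first $t$-derivative of the fractional integral $I_{0+}^{1-\alpha}u$ exists uniformly with respect to $x\in\mathbb R^n$. *)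

theory Defs
  imports "HOL-Analysis.Analysis"
begin

text \<open>
  The dimensions are \<open>n = CARD('n)\<close> and \<open>N = CARD('m)\<close>. The coordinates are indexed by a linearly
  ordered finite type only so that \<open>D_{x_1}^{\<beta>_1} \<dots> D_{x_n}^{\<beta>_n}\<close> is a well-defined
  composition of operators; for functions of class \<open>C^{|\<beta>|}\<close> the order is immaterial.
\<close>

definition mi_order :: "('n::finite \<Rightarrow> nat) \<Rightarrow> nat" where
  "mi_order \<beta> = (\<Sum>j\<in>UNIV. \<beta> j)"

definition mi_power :: "real ^ 'n \<Rightarrow> ('n::finite \<Rightarrow> nat) \<Rightarrow> real" where
  "mi_power \<eta> \<beta> = (\<Prod>j\<in>UNIV. (\<eta> $ j) ^ \<beta> j)"

text \<open>Needed because a sum over an infinite set would silently be \<open>0\<close>.\<close>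

lemma finite_mi_order_le: "finite {\<beta> :: 'n::finite \<Rightarrow> nat. mi_order \<beta> \<le> k}"
proof -
  have "\<beta> j \<le> k" if "mi_order \<beta> \<le> k" for \<beta> :: "'n \<Rightarrow> nat" and j
    using that member_le_sum[of j UNIV \<beta>] unfolding mi_order_def by simp
  then have "{\<beta> :: 'n \<Rightarrow> nat. mi_order \<beta> \<le> k} \<subseteq> Pi\<^sub>E UNIV (\<lambda>_. {..k})"
    by auto
  then show ?thesis
    using finite_PiE[of "UNIV :: 'n set" "\<lambda>_. {..k}"] finite_subset by auto
qed

definition partial_deriv ::
    "'n::finite \<Rightarrow> (real ^ 'n \<Rightarrow> 'a::real_normed_vector) \<Rightarrow> real ^ 'n \<Rightarrow> 'a" where
  "partial_deriv j f x = vector_derivative (\<lambda>s. f (x + s *\<^sub>R axis j 1)) (at 0)"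

primrec cont_diff :: "nat \<Rightarrow> (real ^ 'n::finite \<Rightarrow> 'a::real_normed_vector) \<Rightarrow> bool" where
  "cont_diff 0 f \<longleftrightarrow> continuous_on UNIV f"
| "cont_diff (Suc k) f \<longleftrightarrow> continuous_on UNIV f \<and>
     (\<forall>j. (\<forall>x. (\<lambda>s::real. f (x + s *\<^sub>R axis j 1)) differentiable (at 0)) \<and>
          cont_diff k (partial_deriv j f))"

definition Dx ::
    "'n::finite \<Rightarrow> (real ^ 'n \<Rightarrow> complex ^ 'm::finite) \<Rightarrow> real ^ 'n \<Rightarrow> complex ^ 'm" where
  "Dx j v = (\<lambda>x. (1 / \<i>) *s partial_deriv j v x)"

definition Dx_mi ::
    "('n::{finite,linorder} \<Rightarrow> nat) \<Rightarrow>
     (real ^ 'n::{finite,linorder} \<Rightarrow> complex ^ 'm::finite) \<Rightarrow> real ^ 'n::{finite,linorder} \<Rightarrow> complex ^ 'm" where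
  "Dx_mi \<beta> v = foldr (\<lambda>j. Dx j ^^ \<beta> j) (sorted_list_of_set UNIV) v"

text \<open>\<open>a \<beta> x $ i $ j\<close> is the coefficient \<open>a_\<beta>^{ij}(x)\<close>.\<close>

type_synonym ('n, 'm) coeffs = "('n \<Rightarrow> nat) \<Rightarrow> real ^ 'n \<Rightarrow> complex ^ 'm ^ 'm"

definition op_A0 ::
    "nat \<Rightarrow> ('n::{finite,linorder}, 'm::finite) coeffs \<Rightarrow>
     (real ^ 'n::{finite,linorder} \<Rightarrow> complex ^ 'm) \<Rightarrow> real ^ 'n::{finite,linorder} \<Rightarrow> complex ^ 'm" where
  "op_A0 b a v x =
     (\<chi> i. \<Sum>j\<in>UNIV. \<Sum>\<beta> | mi_order \<beta> = 2 * b. a \<beta> x $ i $ j * Dx_mi \<beta> v x $ j)"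

definition op_A1 ::
    "nat \<Rightarrow> ('n::{finite,linorder}, 'm::finite) coeffs \<Rightarrow>
     (real ^ 'n::{finite,linorder} \<Rightarrow> complex ^ 'm) \<Rightarrow> real ^ 'n::{finite,linorder} \<Rightarrow> complex ^ 'm" where
  "op_A1 b a v x =
     (\<chi> i. \<Sum>j\<in>UNIV. \<Sum>\<beta> | mi_order \<beta> < 2 * b. a \<beta> x $ i $ j * Dx_mi \<beta> v x $ j)"

definition op_A ::
    "nat \<Rightarrow> ('n::{finite,linorder}, 'm::finite) coeffs \<Rightarrow>
     (real ^ 'n::{finite,linorder} \<Rightarrow> complex ^ 'm) \<Rightarrow> real ^ 'n::{finite,linorder} \<Rightarrow> complex ^ 'm" where
  "op_A b a v x = op_A0 b a v x + op_A1 b a v x"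

definition symbol_A0 ::
    "nat \<Rightarrow> ('n::finite, 'm::finite) coeffs \<Rightarrow> real ^ 'n \<Rightarrow> real ^ 'n \<Rightarrow> complex ^ 'm ^ 'm" where
  "symbol_A0 b a x \<eta> =
     (\<chi> i j. \<Sum>\<beta> | mi_order \<beta> = 2 * b. a \<beta> x $ i $ j * complex_of_real (mi_power \<eta> \<beta>))"

definition cinner :: "complex ^ 'm::finite \<Rightarrow> complex ^ 'm \<Rightarrow> complex" where
  "cinner v w = (\<Sum>i\<in>UNIV. v $ i * cnj (w $ i))"

definition uniformly_strongly_parabolic ::
    "nat \<Rightarrow> ('n::finite, 'm::finite) coeffs \<Rightarrow> bool" where
  "uniformly_strongly_parabolic b a \<longleftrightarrow>
     (\<exists>\<delta>>0. \<forall>x \<eta> z. Re (cinner (symbol_A0 b a x \<eta> *v z) z) \<le> - \<delta> * norm \<eta> ^ (2 * b) * (norm z)\<^sup>2)"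

definition bounded_coeffs :: "nat \<Rightarrow> ('n::finite, 'm::finite) coeffs \<Rightarrow> bool" where
  "bounded_coeffs b a \<longleftrightarrow>
     (\<forall>\<beta> i j. mi_order \<beta> \<le> 2 * b \<longrightarrow> bounded (range (\<lambda>x. a \<beta> x $ i $ j)))"

definition globally_Hoelder_coeffs :: "nat \<Rightarrow> ('n::finite, 'm::finite) coeffs \<Rightarrow> bool" where
  "globally_Hoelder_coeffs b a \<longleftrightarrow>
     (\<exists>C. \<exists>\<gamma>>0. \<forall>\<beta> i j x y. mi_order \<beta> \<le> 2 * b \<longrightarrow>
        cmod (a \<beta> x $ i $ j - a \<beta> y $ i $ j) \<le> C * norm (x - y) powr \<gamma>)"

definition frac_integral ::
    "real \<Rightarrow> (real \<Rightarrow> 'a::euclidean_space) \<Rightarrow> real \<Rightarrow> 'a" where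
  "frac_integral \<mu> g t = (1 / Gamma \<mu>) *\<^sub>R integral {0..t} (\<lambda>\<tau>. (t - \<tau>) powr (\<mu> - 1) *\<^sub>R g \<tau>)"

text \<open>The time derivative is one-sided at the endpoints of \<open>[0, T]\<close>, where alone \<open>g\<close> is meaningful.\<close>

definition caputo ::
    "real \<Rightarrow> real \<Rightarrow> (real \<Rightarrow> 'a::euclidean_space) \<Rightarrow> real \<Rightarrow> 'a" where
  "caputo T \<alpha> g t = (1 / Gamma (1 - \<alpha>)) *\<^sub>R
     (vector_derivative (\<lambda>s. integral {0..s} (\<lambda>\<tau>. (s - \<tau>) powr (- \<alpha>) *\<^sub>R g \<tau>)) (at t within {0..T})
      - t powr (- \<alpha>) *\<^sub>R g 0)"

text \<open>
  The equation is imposed for \<open>0 < t \<le> T\<close>: spatial derivatives are assumed only for \<open>t > 0\<close>, and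
  \<open>t\<^sup>-\<^sup>\<alpha>\<close> is singular at \<open>0\<close>.
\<close>

definition classical_solution ::
    "real \<Rightarrow> real \<Rightarrow> nat \<Rightarrow> ('n::{finite,linorder}, 'm::finite) coeffs \<Rightarrow>
     (real \<Rightarrow> real ^ 'n::{finite,linorder} \<Rightarrow> complex ^ 'm) \<Rightarrow> (real ^ 'n::{finite,linorder} \<Rightarrow> complex ^ 'm) \<Rightarrow>
     (real \<Rightarrow> real ^ 'n::{finite,linorder} \<Rightarrow> complex ^ 'm) \<Rightarrow> bool" where
  "classical_solution \<alpha> T b a f u\<^sub>0 u \<longleftrightarrow>
     (\<forall>t\<in>{0<..T}. cont_diff (2 * b) (u t)) \<and>
     (\<forall>x. continuous_on {0..T} (\<lambda>t. u t x) \<and>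
        (\<exists>w. continuous_on {0..T} w \<and>
          (\<forall>t\<in>{0..T}. (frac_integral (1 - \<alpha>) (\<lambda>\<tau>. u \<tau> x) has_vector_derivative w t)
             (at t within {0..T})))) \<and>
     (\<forall>t\<in>{0<..T}. \<forall>x. caputo T \<alpha> (\<lambda>\<tau>. u \<tau> x) t - op_A b a (u t) x = f t x) \<and>
     (\<forall>x. u 0 x = u\<^sub>0 x)"

definition uniform_classical_solution ::
    "real \<Rightarrow> real \<Rightarrow> nat \<Rightarrow> ('n::{finite,linorder}, 'm::finite) coeffs \<Rightarrow>
     (real \<Rightarrow> real ^ 'n::{finite,linorder} \<Rightarrow> complex ^ 'm) \<Rightarrow> (real ^ 'n::{finite,linorder} \<Rightarrow> complex ^ 'm) \<Rightarrow>
     (real \<Rightarrow> real ^ 'n::{finite,linorder} \<Rightarrow> complex ^ 'm) \<Rightarrow> bool" where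
  "uniform_classical_solution \<alpha> T b a f u\<^sub>0 u \<longleftrightarrow>
     classical_solution \<alpha> T b a f u\<^sub>0 u \<and>
     (\<forall>t\<in>{0..T}. uniform_limit UNIV u (u t) (at t within {0..T})) \<and>
     (\<forall>t\<in>{0..T}. \<exists>w. uniform_limit UNIV
        (\<lambda>s x. (1 / (s - t)) *\<^sub>R
           (frac_integral (1 - \<alpha>) (\<lambda>\<tau>. u \<tau> x) s - frac_integral (1 - \<alpha>) (\<lambda>\<tau>. u \<tau> x) t))
        w (at t within {0..T}))"

text \<open>
  Boundedness is on all of \<open>[0, T] \<times> \<real>\<^sup>n\<close>; the Hoelder condition is in \<open>x\<close>, as for the
  coefficients, with constants independent of \<open>t\<close>.
\<close>

definition bounded_in_space_time ::
    "real \<Rightarrow> (real \<Rightarrow> real ^ 'n::finite \<Rightarrow> complex ^ 'm::finite) \<Rightarrow> bool" where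
  "bounded_in_space_time T v \<longleftrightarrow> bounded {v t x | t x. t \<in> {0..T}}"

definition globally_Hoelder_in_space ::
    "real \<Rightarrow> (real \<Rightarrow> real ^ 'n::finite \<Rightarrow> complex ^ 'm::finite) \<Rightarrow> bool" where
  "globally_Hoelder_in_space T v \<longleftrightarrow>
     (\<exists>C. \<exists>\<gamma>>0. \<forall>t\<in>{0..T}. \<forall>x y. norm (v t x - v t y) \<le> C * norm (x - y) powr \<gamma>)"

end

theory Submission
  imports Defs
begin

text \<open>
  Fix \<open>p > 0\<close> and put \<open>V(x) = \<integral>\<^sub>0\<^sup>T exp(-pt) u(t,x) dt\<close>. The Caputo derivative turns into multiplication by
  \<open>p\<^sup>\<alpha>\<close>, up to what is lost by stopping the integral at \<open>T\<close>; since \<open>u(0,x) = 0\<close>, this gives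
  \<open>p\<^sup>\<alpha> V - A V = O(p exp(-pT))\<close> uniformly in \<open>x\<close> (\<open>laplace_equation\<close>). For large real \<open>\<lambda>\<close> the operator
  \<open>\<lambda> - A\<close> satisfies an a priori estimate (\<open>stationary_estimate\<close>), so \<open>V\<close> itself is exponentially small.
  The estimate bounds \<open>V\<close> in a local mean square sense. If \<open>u\<close> is already known to vanish on \<open>[0,s]\<close>,
  then the Hoelder constant of \<open>V\<close> is \<open>O(exp(-ps))\<close>, and interpolation gives the pointwise bound
  \<open>V = O(exp(-pS))\<close> with \<open>S\<close> strictly between \<open>s\<close> and \<open>T\<close>. Bounded exponential moments
  \<open>\<integral>\<^sub>0\<^sup>S exp(p(S-t)) u(t,x) dt\<close> for all large \<open>p\<close> force \<open>u = 0\<close> on \<open>[0,S]\<close>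
  (\<open>bounded_exponential_moments_imp_zero\<close>). So the vanishing interval can always be enlarged
  (\<open>vanishing_extends\<close>), and it is all of \<open>[0,T]\<close>.

  The a priori estimate is the Agmon--Douglis--Nirenberg scheme in \<open>L\<^sup>2\<close>: constant coefficients by
  Fourier analysis, variable coefficients by freezing on small cubes, lower order terms by taking
  \<open>\<lambda> = \<mu>^(2b)\<close> large. It is carried out on the lattice \<open>h \<int>\<^sup>n\<close>. Partial derivatives are replaced by central
  differences, whose symbol \<open>\<i> sin \<theta> / h\<close> is \<open>\<i>\<close> times a real number; the difference operator obtained
  from \<open>A\<^sub>0(y, D)\<close> therefore has the symbol \<open>A\<^sub>0(y, \<eta>)\<close> at a real \<open>\<eta>\<close>, and the parabolicity condition
  applies to it as it stands. Parseval for the finite discrete Fourier transform then gives the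
  constant coefficient estimate \<open>discrete_estimate\<close> with a constant independent of \<open>h\<close>, and everything
  in space reduces to finite sums. The Hoelder conditions make the differences of a localized function
  converge uniformly to its derivatives as \<open>h \<rightarrow> 0\<close> (\<open>central_diffs_approx\<close>), so on a fine lattice the
  discretization error is absorbed into the right hand side.

  Derivatives are indexed by sorted lists of directions instead of multi-indices. Removing entries keeps
  a list sorted, so the Leibniz rule stays among the derivatives \<open>D\<^sup>\<beta>\<close> that are controlled, taken in the
  order in which \<open>D\<^sup>\<beta>\<close> takes them.
\<close>

section \<open>Finite Fourier analysis of lattice functions\<close>

lemma norm_vec_power2: "(norm (v :: 'a::real_normed_vector ^ 'm::finite))\<^sup>2 = (\<Sum>i\<in>UNIV. (norm (v $ i))\<^sup>2)"
  by (simp add: norm_vec_def L2_set_def sum_nonneg)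

lemma norm_vector_scalar_mult: "norm (c *s (v :: complex ^ 'm::finite)) = cmod c * norm v"
proof -
  have "(norm (c *s v))\<^sup>2 = (cmod c * norm v)\<^sup>2"
    by (simp add: norm_vec_power2 norm_mult power_mult_distrib sum_distrib_left)
  then show ?thesis
    by (simp add: power2_eq_iff_nonneg)
qed

definition lattice_pt :: "real \<Rightarrow> ('n::finite \<Rightarrow> int) \<Rightarrow> real ^ 'n" where
  "lattice_pt h k = (\<chi> j. h * of_int (k j))"

lemma lattice_pt_component [simp]: "lattice_pt h k $ j = h * of_int (k j)"
  by (simp add: lattice_pt_def)

text \<open>
  The character of \<open>(\<int>/M\<int>)\<^sup>n\<close> with frequency \<open>t\<close>.
\<close>

definition dft_char :: "nat \<Rightarrow> ('n::finite \<Rightarrow> nat) \<Rightarrow> ('n \<Rightarrow> int) \<Rightarrow> complex" where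
  "dft_char M t k = cis (- (2 * pi / M) * (\<Sum>j\<in>UNIV. real (t j) * of_int (k j)))"

definition freqs :: "nat \<Rightarrow> ('n::finite \<Rightarrow> nat) set" where
  "freqs M = (UNIV \<rightarrow>\<^sub>E {..<M})"

lemma sum_cis_roots:
  assumes "\<bar>k\<bar> < int M"
  shows "(\<Sum>t<M. cis (- (2 * pi / M) * (real t * of_int k))) = (if k = 0 then of_nat M else 0)"
proof (cases "k = 0")
  case False
  have M: "M > 0" using assms by auto
  define z where "z = cis (- (2 * pi / M) * of_int k)"
  have pow: "cis (- (2 * pi / M) * (real t * of_int k)) = z ^ t" for t
    by (simp add: z_def Complex.DeMoivre algebra_simps)
  have "z ^ M = cis (2 * pi * of_int (- k))"
    using M by (simp add: z_def Complex.DeMoivre)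
  then have z1: "z ^ M = 1"
    by (simp only: cis_multiple_2pi[OF Ints_of_int])
  have "z \<noteq> 1"
  proof
    assume "z = 1"
    then have "cos (- (2 * pi / M) * of_int k) = 1"
      by (simp add: z_def complex_eq_iff)
    then obtain m :: int where "- (2 * pi / M) * of_int k = of_int m * 2 * pi"
      unfolding cos_one_2pi_int by blast
    then have "pi * of_int (- k) = pi * real_of_int (m * int M)"
      using M by (simp add: field_simps)
    then have "of_int (- k) = real_of_int (m * int M)"
      unfolding mult_left_cancel[OF pi_neq_zero] .
    then have "- k = m * int M" by (simp only: of_int_eq_iff)
    then have "int M dvd \<bar>k\<bar>" by (metis dvd_abs_iff dvd_minus_iff dvd_triv_right)
    then show False using assms False zdvd_imp_le[of "int M" "\<bar>k\<bar>"] by auto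
  qed
  then show ?thesis
    using False z1 by (simp only: pow) (simp add: geometric_sum)
qed simp

text \<open>
  Orthogonality, by factoring the sum over frequencies into one geometric sum per coordinate. The
  points need only be closer than \<open>M\<close> in each coordinate: they are then distinct modulo \<open>M\<close> if they
  are distinct, so a finitely supported function on \<open>\<int>\<^sup>n\<close> can be treated as periodic.
\<close>

lemma sum_dft_char:
  fixes k k' :: "'n::finite \<Rightarrow> int"
  assumes "\<And>j. \<bar>k j - k' j\<bar> < int M"
  shows "(\<Sum>t\<in>freqs M. dft_char M t k * cnj (dft_char M t k')) = (if k = k' then of_nat M ^ CARD('n) else 0)"
proof -
  have cis_sum: "cis (\<Sum>j\<in>A. x j) = (\<Prod>j\<in>A. cis (x j))" if "finite A" for x and A :: "'n set"
    using that by (induction A rule: finite_induct) (auto simp flip: cis_mult)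
  have e: "dft_char M t k * cnj (dft_char M t k') = (\<Prod>j\<in>UNIV. cis (- (2 * pi / M) * (real (t j) * of_int (k j - k' j))))" for t
    unfolding dft_char_def cis_cnj cis_mult cis_sum[OF finite, symmetric]
    by (rule arg_cong[of _ _ cis]) (simp add: algebra_simps sum_distrib_left sum_subtractf sum_divide_distrib sum_negf)
  have "(\<Sum>t\<in>freqs M. dft_char M t k * cnj (dft_char M t k'))
      = (\<Prod>j\<in>UNIV. \<Sum>s<M. cis (- (2 * pi / M) * (real s * of_int (k j - k' j))))"
    unfolding e freqs_def by (rule prod_sum_PiE[symmetric]) auto
  also have "\<dots> = (\<Prod>j\<in>UNIV. if k j = k' j then of_nat M else 0)"
    by (rule prod.cong[OF refl], subst sum_cis_roots) (use assms in auto)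
  also have "\<dots> = (if k = k' then of_nat M ^ CARD('n) else 0)"
    by (auto simp: fun_eq_iff prod_zero_iff)
  finally show ?thesis .
qed

text \<open>
  Values are vectors, and the transform acts on components; a matrix with constant entries
  commutes with it.
\<close>

definition dft :: "('n::finite \<Rightarrow> int) set \<Rightarrow> nat \<Rightarrow> (('n \<Rightarrow> int) \<Rightarrow> complex ^ 'm::finite) \<Rightarrow> ('n \<Rightarrow> nat) \<Rightarrow> complex ^ 'm" where
  "dft K M F t = (\<Sum>k\<in>K. dft_char M t k *s F k)"

lemma parseval_scalar:
  fixes f :: "('n::finite \<Rightarrow> int) \<Rightarrow> complex"
  assumes "finite K" and "\<And>k k' j. k \<in> K \<Longrightarrow> k' \<in> K \<Longrightarrow> \<bar>k j - k' j\<bar> < int M"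
  shows "(\<Sum>t\<in>freqs M. (cmod (\<Sum>k\<in>K. dft_char M t k * f k))\<^sup>2) = real M ^ CARD('n) * (\<Sum>k\<in>K. (cmod (f k))\<^sup>2)"
proof -
  have M_power: "complex_of_real (real M ^ CARD('n)) = of_nat M ^ CARD('n)" by simp
  have "complex_of_real (\<Sum>t\<in>freqs M. (cmod (\<Sum>k\<in>K. dft_char M t k * f k))\<^sup>2)
     = (\<Sum>t\<in>freqs M. (\<Sum>k\<in>K. dft_char M t k * f k) * (\<Sum>k'\<in>K. cnj (dft_char M t k' * f k')))"
    by (simp only: of_real_sum complex_norm_square cnj_sum)
  also have "\<dots> = (\<Sum>t\<in>freqs M. \<Sum>k\<in>K. \<Sum>k'\<in>K. f k * cnj (f k') * (dft_char M t k * cnj (dft_char M t k')))"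
    by (simp add: sum_product algebra_simps)
  also have "\<dots> = (\<Sum>k\<in>K. \<Sum>t\<in>freqs M. \<Sum>k'\<in>K. f k * cnj (f k') * (dft_char M t k * cnj (dft_char M t k')))"
    by (rule sum.swap)
  also have "\<dots> = (\<Sum>k\<in>K. \<Sum>k'\<in>K. \<Sum>t\<in>freqs M. f k * cnj (f k') * (dft_char M t k * cnj (dft_char M t k')))"
    by (intro sum.cong refl sum.swap)
  also have "\<dots> = (\<Sum>k\<in>K. \<Sum>k'\<in>K. f k * cnj (f k') * (if k = k' then of_nat M ^ CARD('n) else 0))"
    using assms(2) by (intro sum.cong refl, subst sum_distrib_left[symmetric], subst sum_dft_char) auto
  also have "\<dots> = (\<Sum>k\<in>K. \<Sum>k'\<in>K. if k = k' then f k * cnj (f k) * of_nat M ^ CARD('n) else 0)"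
    by (intro sum.cong refl) auto
  also have "\<dots> = (\<Sum>k\<in>K. f k * cnj (f k) * of_nat M ^ CARD('n))"
    using assms(1) by simp
  also have "\<dots> = complex_of_real (real M ^ CARD('n) * (\<Sum>k\<in>K. (cmod (f k))\<^sup>2))"
    by (simp only: of_real_mult of_real_sum complex_norm_square M_power sum_distrib_left mult_ac)
  finally show ?thesis by (simp only: of_real_eq_iff)
qed

lemma parseval:
  fixes F :: "('n::finite \<Rightarrow> int) \<Rightarrow> complex ^ 'm::finite"
  assumes "finite K" and "\<And>k k' j. k \<in> K \<Longrightarrow> k' \<in> K \<Longrightarrow> \<bar>k j - k' j\<bar> < int M"
  shows "(\<Sum>t\<in>freqs M. (norm (dft K M F t))\<^sup>2) = real M ^ CARD('n) * (\<Sum>k\<in>K. (norm (F k))\<^sup>2)"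
proof -
  have "(\<Sum>t\<in>freqs M. (norm (dft K M F t))\<^sup>2)
      = (\<Sum>i\<in>UNIV. \<Sum>t\<in>freqs M. (cmod (\<Sum>k\<in>K. dft_char M t k * F k $ i))\<^sup>2)"
    by (subst sum.swap) (simp add: norm_vec_power2 dft_def)
  also have "\<dots> = (\<Sum>i\<in>UNIV. real M ^ CARD('n) * (\<Sum>k\<in>K. (cmod (F k $ i))\<^sup>2))"
    by (intro sum.cong refl parseval_scalar assms)
  also have "\<dots> = real M ^ CARD('n) * (\<Sum>k\<in>K. (norm (F k))\<^sup>2)"
    by (simp add: norm_vec_power2 sum_distrib_left) (rule sum.swap)
  finally show ?thesis .
qed

text \<open>
  The symmetric quotient is used because its symbol is purely imaginary; a one-sided quotient would
  have a symbol with a real part, about which the parabolicity condition says nothing.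
\<close>

definition central_diff :: "real \<Rightarrow> 'n::finite \<Rightarrow> (real ^ 'n \<Rightarrow> 'a::real_normed_vector) \<Rightarrow> real ^ 'n \<Rightarrow> 'a" where
  "central_diff h j f x = (f (x + h *\<^sub>R axis j 1) - f (x - h *\<^sub>R axis j 1)) /\<^sub>R (2 * h)"

definition central_diffs :: "real \<Rightarrow> 'n::finite list \<Rightarrow> (real ^ 'n \<Rightarrow> 'a::real_normed_vector) \<Rightarrow> real ^ 'n \<Rightarrow> 'a" where
  "central_diffs h l f = foldr (central_diff h) l f"

lemma central_diffs_Nil [simp]: "central_diffs h [] f = f" and central_diffs_Cons [simp]: "central_diffs h (j # l) f = central_diff h j (central_diffs h l f)"
  and central_diffs_snoc: "central_diffs h (l @ [j]) f = central_diffs h l (central_diff h j f)"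
  by (simp_all add: central_diffs_def)

text \<open>
  Sums over the lattice run over a box large enough to contain the support of the function and
  of all its differences of the orders that occur; shifts then need no boundary terms.
\<close>

definition lattice_box :: "nat \<Rightarrow> ('n::finite \<Rightarrow> int) set" where
  "lattice_box N = {k. \<forall>j. \<bar>k j\<bar> \<le> int N}"

lemma finite_lattice_box [simp]: "finite (lattice_box N :: ('n::finite \<Rightarrow> int) set)"
proof -
  have "lattice_box N = (UNIV :: 'n set) \<rightarrow>\<^sub>E {- int N..int N}"
    by (simp add: lattice_box_def PiE_def Pi_def extensional_def abs_le_iff set_eq_iff) (metis neg_le_iff_le minus_minus)
  then show ?thesis by (simp add: finite_PiE)
qed

lemma lattice_pt_shift: "lattice_pt h k + h *\<^sub>R axis j 1 = lattice_pt h (k(j := k j + 1))" "lattice_pt h k - h *\<^sub>R axis j 1 = lattice_pt h (k(j := k j - 1))"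
  by (auto simp: vec_eq_iff axis_def algebra_simps)

lemma central_diff_support:
  assumes "\<And>k. k \<notin> lattice_box N \<Longrightarrow> f (lattice_pt h k) = 0" and "k \<notin> lattice_box (Suc N)"
  shows "central_diff h j f (lattice_pt h k) = 0"
proof -
  obtain i where "\<not> \<bar>k i\<bar> \<le> int (Suc N)" using assms(2) unfolding lattice_box_def by blast
  then have i: "\<bar>k i\<bar> > int N + 1" by simp
  have "k(j := k j + 1) \<notin> lattice_box N" "k(j := k j - 1) \<notin> lattice_box N"
    using i by (auto simp: lattice_box_def intro!: exI[of _ i])
  then show ?thesis by (simp add: central_diff_def lattice_pt_shift assms(1))
qed

lemma central_diffs_support:
  assumes "\<And>k. k \<notin> lattice_box N \<Longrightarrow> f (lattice_pt h k) = 0" and "k \<notin> lattice_box (N + length l)"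
  shows "central_diffs h l f (lattice_pt h k) = 0"
  using assms(2) by (induction l arbitrary: k) (auto simp: assms(1) intro!: central_diff_support)

lemma dft_char_shift: "dft_char M t (k(j := k j + d)) = cis (- (2 * pi / M) * (t j * of_int d)) * dft_char M t k"
proof -
  have "(\<Sum>i\<in>UNIV. real (t i) * of_int ((k(j := k j + d)) i))
      = (\<Sum>i\<in>UNIV. real (t i) * of_int (k i) + (if i = j then real (t j) * of_int d else 0))"
    by (intro sum.cong refl) (auto simp: algebra_simps)
  then show ?thesis
    by (simp add: dft_char_def cis_mult sum.distrib algebra_simps)
qed

text \<open>
  Reindexing by the shift; the terms pushed over the boundary of the box vanish by the support condition.
\<close>

lemma dft_shift:
  fixes F :: "('n::finite \<Rightarrow> int) \<Rightarrow> complex ^ 'm::finite" and j :: 'n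
  assumes supp: "\<And>k. k \<notin> lattice_box N \<Longrightarrow> F k = 0" and N: "Suc N \<le> N'" and d: "\<bar>d\<bar> = 1"
  shows "dft (lattice_box N') M (\<lambda>k. F (k(j := k j + d))) t = cis (2 * pi / M * (t j * of_int d)) *s dft (lattice_box N') M F t"
proof -
  define c where "c = cis (2 * pi / M * (t j * of_int d))"
  have mono: "k \<in> lattice_box N'" if "k \<in> lattice_box N" for k :: "'n \<Rightarrow> int"
    unfolding lattice_box_def
  proof safe
    fix i
    have "\<bar>k i\<bar> \<le> int N" using that by (simp add: lattice_box_def)
    then show "\<bar>k i\<bar> \<le> int N'" using N by linarith
  qed
  have shift: "k(j := k j - d) \<in> lattice_box N'" if "k \<in> lattice_box N" for k :: "'n \<Rightarrow> int"
    unfolding lattice_box_def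
  proof safe
    fix i
    have "\<bar>k i\<bar> \<le> int N" using that by (simp add: lattice_box_def)
    then show "\<bar>(k(j := k j - d)) i\<bar> \<le> int N'" using N d by (cases "i = j") auto
  qed
  have c: "c * dft_char M t (k(j := k j + d)) = dft_char M t k" for k
    unfolding dft_char_shift mult.assoc[symmetric] cis_mult c_def by simp
  have "dft (lattice_box N') M (\<lambda>k. F (k(j := k j + d))) t = (\<Sum>k\<in>lattice_box N'. c *s (dft_char M t k *s F k))"
    unfolding dft_def
  proof (rule sum.reindex_bij_witness_not_neutral[where S' = "{k \<in> lattice_box N'. k(j := k j + d) \<notin> lattice_box N}"
      and T' = "{k \<in> lattice_box N'. k \<notin> lattice_box N}" and i = "\<lambda>k. k(j := k j - d)" and j = "\<lambda>k. k(j := k j + d)"])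
    fix a :: "'n \<Rightarrow> int" assume "a \<in> lattice_box N' - {k \<in> lattice_box N'. k(j := k j + d) \<notin> lattice_box N}"
    then show "a(j := a j + d) \<in> lattice_box N' - {k \<in> lattice_box N'. k \<notin> lattice_box N}"
      using mono by auto
  next
    fix b :: "'n \<Rightarrow> int" assume "b \<in> lattice_box N' - {k \<in> lattice_box N'. k \<notin> lattice_box N}"
    then show "b(j := b j - d) \<in> lattice_box N' - {k \<in> lattice_box N'. k(j := k j + d) \<notin> lattice_box N}"
      using shift by auto
  next
    fix a
    show "c *s (dft_char M t (a(j := a j + d)) *s F (a(j := a j + d))) = dft_char M t a *s F (a(j := a j + d))"
      unfolding vector_smult_assoc c ..
  next
    fix b :: "'n \<Rightarrow> int" assume "b \<in> {k \<in> lattice_box N'. k \<notin> lattice_box N}"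
    then show "c *s (dft_char M t b *s F b) = 0" using supp by auto
  next
    fix a :: "'n \<Rightarrow> int" assume "a \<in> {k \<in> lattice_box N'. k(j := k j + d) \<notin> lattice_box N}"
    then show "dft_char M t a *s F (a(j := a j + d)) = 0" using supp by auto
  qed auto
  then show ?thesis by (simp add: dft_def vec.scale_sum_right c_def)
qed

lemma dft_central_diff:
  fixes f :: "real ^ 'n::finite \<Rightarrow> complex ^ 'm::finite"
  assumes supp: "\<And>k. k \<notin> lattice_box N \<Longrightarrow> f (lattice_pt h k) = 0" and N: "Suc N \<le> N'"
  shows "dft (lattice_box N') M (\<lambda>k. central_diff h j f (lattice_pt h k)) t
       = (\<i> * of_real (sin (2 * pi * t j / M) / h)) *s dft (lattice_box N') M (\<lambda>k. f (lattice_pt h k)) t"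
proof -
  define \<theta> where "\<theta> = 2 * pi / M * t j"
  define D where "D = dft (lattice_box N') M (\<lambda>k. f (lattice_pt h k)) t"
  define c :: complex where "c = 1 / (2 * of_real h)"
  have central_diff: "central_diff h j f (lattice_pt h k) = c *s (f (lattice_pt h (k(j := k j + 1))) - f (lattice_pt h (k(j := k j + (- 1)))))" for k
  proof -
    have "z /\<^sub>R (2 * h) = c * z" for z :: complex
      by (simp add: c_def scaleR_conv_of_real inverse_eq_divide)
    then show ?thesis by (simp add: central_diff_def lattice_pt_shift vec_eq_iff right_diff_distrib)
  qed
  have "dft (lattice_box N') M (\<lambda>k. central_diff h j f (lattice_pt h k)) t
     = c *s (dft (lattice_box N') M (\<lambda>k. f (lattice_pt h (k(j := k j + 1)))) t
                       - dft (lattice_box N') M (\<lambda>k. f (lattice_pt h (k(j := k j + (- 1))))) t)"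
    unfolding dft_def central_diff sum_subtractf[symmetric] vec.scale_sum_right
    by (rule sum.cong[OF refl]) (simp only: vec.scale_right_diff_distrib vector_smult_assoc mult.commute)
  also have "\<dots> = c *s (cis \<theta> *s D - cis (- \<theta>) *s D)"
  proof -
    have "dft (lattice_box N') M (\<lambda>k. f (lattice_pt h (k(j := k j + d)))) t = cis (2 * pi / M * (real (t j) * of_int d)) *s D"
      if "\<bar>d\<bar> = 1" for d :: int
      unfolding D_def by (rule dft_shift[where F = "\<lambda>k. f (lattice_pt h k)", OF supp N that])
    from this[of 1] this[of "-1"] show ?thesis by (simp add: \<theta>_def)
  qed
  also have "\<dots> = (c * (cis \<theta> - cis (- \<theta>))) *s D"
    by (simp only: vector_smult_assoc[symmetric] vec.scale_left_diff_distrib)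
  also have "c * (cis \<theta> - cis (- \<theta>)) = \<i> * of_real (sin \<theta> / h)"
    by (simp add: complex_eq_iff c_def)
  also have "sin \<theta> = sin (2 * pi * t j / M)" by (simp add: \<theta>_def)
  finally show ?thesis unfolding D_def .
qed

text \<open>
  Central differences act on the frequency side as derivatives do: the real numbers \<open>sin \<theta>\<^sub>j / h\<close> take
  the place of the frequency variables.
\<close>

lemma dft_central_diffs:
  assumes supp: "\<And>k. k \<notin> lattice_box N \<Longrightarrow> f (lattice_pt h k) = 0" and N: "N + length l \<le> N'"
  shows "dft (lattice_box N') M (\<lambda>k. central_diffs h l f (lattice_pt h k)) t
       = (\<i> ^ length l * of_real (\<Prod>j\<leftarrow>l. sin (2 * pi * t j / M) / h)) *s dft (lattice_box N') M (\<lambda>k. f (lattice_pt h k)) t"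
  using N
proof (induction l)
  case (Cons j l)
  have "dft (lattice_box N') M (\<lambda>k. central_diff h j (central_diffs h l f) (lattice_pt h k)) t
       = (\<i> * of_real (sin (2 * pi * t j / M) / h)) *s dft (lattice_box N') M (\<lambda>k. central_diffs h l f (lattice_pt h k)) t"
    using Cons.prems by (intro dft_central_diff[where N = "N + length l"] central_diffs_support supp) auto
  then show ?case using Cons by (simp add: vector_smult_assoc mult_ac)
qed simp

section \<open>Central differences and directional derivatives\<close>

text \<open>
  \<open>dir_deriv j f f'\<close> says that \<open>f'\<close> is the partial derivative of \<open>f\<close> in direction \<open>j\<close>. A relation is
  more convenient than an operator, as families of derivatives are given in advance.
\<close>

definition dir_deriv :: "'n::finite \<Rightarrow> (real ^ 'n \<Rightarrow> 'a::real_normed_vector) \<Rightarrow> (real ^ 'n \<Rightarrow> 'a) \<Rightarrow> bool" where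
  "dir_deriv j f f' \<longleftrightarrow> (\<forall>x. ((\<lambda>s. f (x + s *\<^sub>R axis j 1)) has_vector_derivative f' x) (at 0))"

lemma dir_deriv_at:
  assumes "dir_deriv j f f'"
  shows "((\<lambda>s. f (x + s *\<^sub>R axis j 1)) has_vector_derivative f' (x + s\<^sub>0 *\<^sub>R axis j 1)) (at s\<^sub>0)"
proof -
  have "((\<lambda>s. f (x + s\<^sub>0 *\<^sub>R axis j 1 + s *\<^sub>R axis j 1)) has_vector_derivative f' (x + s\<^sub>0 *\<^sub>R axis j 1)) (at 0)"
    using assms by (simp add: dir_deriv_def)
  then have "((\<lambda>s. f (x + s\<^sub>0 *\<^sub>R axis j 1 + (s - s\<^sub>0) *\<^sub>R axis j 1)) has_vector_derivative f' (x + s\<^sub>0 *\<^sub>R axis j 1)) (at s\<^sub>0)"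
    using vector_diff_chain_at[of "\<lambda>s. s - s\<^sub>0" 1 s\<^sub>0 "\<lambda>s. f (x + s\<^sub>0 *\<^sub>R axis j 1 + s *\<^sub>R axis j 1)"]
    by (simp add: o_def has_vector_derivative_diff_const)
  then show ?thesis by (simp add: algebra_simps)
qed

lemma line_bound:
  fixes g :: "real \<Rightarrow> 'a::real_normed_vector"
  assumes g: "\<And>s. (g has_vector_derivative g' s) (at s)"
    and b: "\<And>s. s \<in> closed_segment s\<^sub>1 s\<^sub>2 \<Longrightarrow> norm (g' s - c) \<le> e"
  shows "norm (g s\<^sub>2 - g s\<^sub>1 - (s\<^sub>2 - s\<^sub>1) *\<^sub>R c) \<le> e * \<bar>s\<^sub>2 - s\<^sub>1\<bar>"
proof -
  have "norm ((g s\<^sub>2 - s\<^sub>2 *\<^sub>R c) - (g s\<^sub>1 - s\<^sub>1 *\<^sub>R c)) \<le> e * norm (s\<^sub>2 - s\<^sub>1)"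
  proof (rule differentiable_bound[where S = "closed_segment s\<^sub>1 s\<^sub>2" and f = "\<lambda>s. g s - s *\<^sub>R c"
      and f' = "\<lambda>s h. h *\<^sub>R (g' s - c)"])
    fix s assume s: "s \<in> closed_segment s\<^sub>1 s\<^sub>2"
    have "((\<lambda>s. g s - s *\<^sub>R c) has_vector_derivative g' s - 1 *\<^sub>R c) (at s)"
      by (intro has_vector_derivative_diff g) (auto intro!: derivative_eq_intros simp: has_vector_derivative_def)
    then show "((\<lambda>s. g s - s *\<^sub>R c) has_derivative (\<lambda>h. h *\<^sub>R (g' s - c))) (at s within closed_segment s\<^sub>1 s\<^sub>2)"
      by (simp add: has_vector_derivative_def has_derivative_at_withinI)
    show "onorm (\<lambda>h. h *\<^sub>R (g' s - c)) \<le> e"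
      by (rule onorm_le) (simp add: mult.commute[of e] mult_left_mono b[OF s])
  qed auto
  then show ?thesis by (simp add: algebra_simps)
qed

text \<open>
  The form in which moduli of continuity of derivatives are exploited: the error of the
  difference quotient is the oscillation of the derivative. It gives the approximation of derivatives by
  differences, the continuity of derivatives in time, and differentiation under the integral sign.
\<close>

lemma dir_deriv_quotient:
  assumes "dir_deriv j f f'" and "\<And>z. norm (z - x) \<le> \<bar>s\<bar> \<Longrightarrow> norm (f' z - c) \<le> e"
  shows "norm (f (x + s *\<^sub>R axis j 1) - f x - s *\<^sub>R c) \<le> e * \<bar>s\<bar>"
proof -
  have "norm (f (x + s *\<^sub>R axis j 1) - f (x + 0 *\<^sub>R axis j 1) - (s - 0) *\<^sub>R c) \<le> e * \<bar>s - 0\<bar>"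
  proof (rule line_bound[where g = "\<lambda>s. f (x + s *\<^sub>R axis j 1)" and g' = "\<lambda>s. f' (x + s *\<^sub>R axis j 1)"])
    fix \<sigma> assume "\<sigma> \<in> closed_segment 0 s"
    then have "\<bar>\<sigma>\<bar> \<le> \<bar>s\<bar>" by (auto simp: closed_segment_eq_real_ivl split: if_splits)
    then show "norm (f' (x + \<sigma> *\<^sub>R axis j 1) - c) \<le> e" by (intro assms(2)) (simp add: norm_axis_1)
  qed (rule dir_deriv_at[OF assms(1)])
  then show ?thesis by simp
qed

lemma central_diff_dir_deriv_bound:
  assumes "dir_deriv j f f'" and "h > 0" and b: "\<And>z. norm (z - x) \<le> h \<Longrightarrow> norm (f' z - c) \<le> e"
  shows "norm (central_diff h j f x - c) \<le> e"
proof -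
  have "norm (f (x + h *\<^sub>R axis j 1) - f (x + (- h) *\<^sub>R axis j 1) - (h - (- h)) *\<^sub>R c) \<le> e * \<bar>h - (- h)\<bar>"
  proof (rule line_bound[where g = "\<lambda>s. f (x + s *\<^sub>R axis j 1)" and g' = "\<lambda>s. f' (x + s *\<^sub>R axis j 1)"])
    fix \<sigma> assume "\<sigma> \<in> closed_segment (- h) h"
    then have "\<bar>\<sigma>\<bar> \<le> h" using assms(2) by (auto simp: closed_segment_eq_real_ivl split: if_splits)
    then show "norm (f' (x + \<sigma> *\<^sub>R axis j 1) - c) \<le> e" by (intro b) (simp add: norm_axis_1)
  qed (rule dir_deriv_at[OF assms(1)])
  then have le: "norm (f (x + h *\<^sub>R axis j 1) - f (x - h *\<^sub>R axis j 1) - (2 * h) *\<^sub>R c) \<le> e * (2 * h)"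
    using assms(2) by simp
  have "(2 * h) *\<^sub>R (central_diff h j f x - c) = f (x + h *\<^sub>R axis j 1) - f (x - h *\<^sub>R axis j 1) - (2 * h) *\<^sub>R c"
    using assms(2) by (simp add: central_diff_def scaleR_diff_right)
  then have "2 * h * norm (central_diff h j f x - c) = norm (f (x + h *\<^sub>R axis j 1) - f (x - h *\<^sub>R axis j 1) - (2 * h) *\<^sub>R c)"
    using assms(2) by (metis abs_of_pos mult_pos_pos norm_scaleR zero_less_numeral)
  also have "\<dots> \<le> 2 * h * e" using le by (simp only: mult.commute)
  finally show ?thesis using assms(2) by simp
qed

lemma dir_deriv_central_diff:
  assumes "dir_deriv i f f'"
  shows "dir_deriv i (central_diff h j f) (central_diff h j f')"
proof -
  have "((\<lambda>s. central_diff h j f (x + s *\<^sub>R axis i 1)) has_vector_derivative central_diff h j f' x) (at 0)" for x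
  proof -
    have eq: "central_diff h j f (x + s *\<^sub>R axis i 1)
         = inverse (2 * h) *\<^sub>R (f (x + h *\<^sub>R axis j 1 + s *\<^sub>R axis i 1) - f (x - h *\<^sub>R axis j 1 + s *\<^sub>R axis i 1))" for s
      by (simp add: central_diff_def algebra_simps)
    show ?thesis
      unfolding eq
      using has_vector_derivative_scaleR[OF DERIV_const[of "inverse (2 * h)"]
          has_vector_derivative_diff[OF assms[unfolded dir_deriv_def, rule_format, of "x + h *\<^sub>R axis j 1"]
          assms[unfolded dir_deriv_def, rule_format, of "x - h *\<^sub>R axis j 1"]]]
      by (simp add: central_diff_def)
  qed
  then show ?thesis by (simp add: dir_deriv_def)
qed

lemma dir_deriv_central_diffs: "dir_deriv i f f' \<Longrightarrow> dir_deriv i (central_diffs h l f) (central_diffs h l f')"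
  by (induction l) (auto intro: dir_deriv_central_diff)

lemma central_diff_commute: "central_diff h i (central_diff h j f) = central_diff h j (central_diff h i f)"
  by (rule ext) (simp add: central_diff_def algebra_simps)

lemma central_diffs_central_diff: "central_diffs h l (central_diff h i f) = central_diff h i (central_diffs h l f)"
  by (induction l) (auto simp: central_diff_commute)

text \<open>
  The error of an iterated difference is the oscillation of the one derivative that it approximates,
  on the scale of its stencil. The induction peels off the innermost derivative: the remaining differences of \<open>V []\<close> have
  the differences of \<open>V [i]\<close> as their derivative in direction \<open>i\<close>, so the mean value inequality moves the
  bound through one difference without losing a power of \<open>h\<close>.
\<close>

lemma central_diffs_approx:
  fixes V :: "'n::finite list \<Rightarrow> real ^ 'n \<Rightarrow> 'a::real_normed_vector"
  assumes "\<And>p j m. l = p @ j # m \<Longrightarrow> dir_deriv j (V m) (V (j # m))" and "h > 0"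
    and "\<And>z. norm (z - x) \<le> real (length l) * h \<Longrightarrow> norm (V l z - c) \<le> e"
  shows "norm (central_diffs h l (V []) x - c) \<le> e"
  using assms
proof (induction l arbitrary: V x rule: rev_induct)
  case Nil
  then show ?case by simp
next
  case (snoc i l)
  have "dir_deriv i (central_diffs h l (V [])) (central_diffs h l (V [i]))"
    by (rule dir_deriv_central_diffs, rule snoc.prems(1)[of l]) simp
  moreover have "norm (central_diffs h l (V [i]) z - c) \<le> e" if "norm (z - x) \<le> h" for z
  proof (rule snoc.IH[where V = "\<lambda>m. V (m @ [i])", simplified])
    fix p j m assume "l = p @ j # m"
    then show "dir_deriv j (V (m @ [i])) (V (j # m @ [i]))"
      using snoc.prems(1)[of p j "m @ [i]"] by simp
  next
    fix y assume "norm (y - z) \<le> real (length l) * h"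
    then have "norm (y - x) \<le> real (length l) * h + h"
      using that norm_triangle_ineq[of "y - z" "z - x"] by simp
    then show "norm (V (l @ [i]) y - c) \<le> e"
      by (intro snoc.prems(3)) (simp add: algebra_simps)
  qed (use snoc.prems in auto)
  ultimately have "norm (central_diff h i (central_diffs h l (V [])) x - c) \<le> e"
    by (rule central_diff_dir_deriv_bound[OF _ \<open>h > 0\<close>])
  then show ?case by (simp add: central_diffs_snoc central_diffs_central_diff)
qed

lemma at_right_0_witness:
  assumes "\<forall>\<^sub>F d in at_right (0 :: real). P d"
  shows "\<exists>d>0. P d"
  using eventually_happens'[OF trivial_limit_at_right_real eventually_conj[OF eventually_at_right_less[of "0 :: real"] assms]] .

text \<open>
  All ways to distribute a list of derivatives over the two factors of a product. Both parts are
  sublists, so sorted lists split into sorted lists.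
\<close>

fun splits :: "'a list \<Rightarrow> ('a list \<times> 'a list) list" where
  "splits [] = [([], [])]"
| "splits (j # l) = map (\<lambda>(p, q). (j # p, q)) (splits l) @ map (\<lambda>(p, q). (p, j # q)) (splits l)"

definition leibniz_sum :: "('n list \<Rightarrow> real ^ 'n \<Rightarrow> real) \<Rightarrow> ('n list \<Rightarrow> real ^ 'n \<Rightarrow> 'a::real_normed_vector) \<Rightarrow>
    'n::finite list \<Rightarrow> real ^ 'n \<Rightarrow> 'a" where
  "leibniz_sum \<Phi> V l x = (\<Sum>(p, q)\<leftarrow>splits l. \<Phi> p x *\<^sub>R V q x)"

lemma splits_length: "(p, q) \<in> set (splits l) \<Longrightarrow> length p + length q = length l"
  by (induction l arbitrary: p q) auto

lemma splits_set: "(p, q) \<in> set (splits l) \<Longrightarrow> set p \<subseteq> set l \<and> set q \<subseteq> set l"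
  by (induction l arbitrary: p q) fastforce+

lemma splits_sorted: "(p, q) \<in> set (splits l) \<Longrightarrow> sorted l \<Longrightarrow> sorted p \<and> sorted q"
proof (induction l arbitrary: p q)
  case (Cons j l)
  then show ?case using splits_set[of _ _ l] by auto (metis subsetD)+
qed auto

text \<open>
  The split that puts every derivative on the second factor is unique; it yields the leading term of the
  Leibniz rule, and all others are of lower order in the second factor.
\<close>

lemma splits_last: "\<exists>xs. splits l = xs @ [([], l)] \<and> (\<forall>(p, q)\<in>set xs. length q < length l)"
proof (induction l)
  case (Cons j l)
  then obtain xs where xs: "splits l = xs @ [([], l)]" "\<forall>(p, q)\<in>set xs. length q < length l" by blast
  show ?case
    by (rule exI[of _ "map (\<lambda>(p, q). (j # p, q)) (splits l) @ map (\<lambda>(p, q). (p, j # q)) xs"])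
       (use xs in \<open>auto dest: splits_length\<close>)
qed simp

lemma dir_deriv_sum_list:
  assumes "\<And>a. a \<in> set as \<Longrightarrow> dir_deriv j (f a) (f' a)"
  shows "dir_deriv j (\<lambda>x. \<Sum>a\<leftarrow>as. f a x) (\<lambda>x. \<Sum>a\<leftarrow>as. f' a x)"
  using assms unfolding dir_deriv_def
  by (induction as) (auto intro!: derivative_intros has_vector_derivative_add)

lemma dir_deriv_scaleR:
  assumes "dir_deriv j (f :: _ \<Rightarrow> real) f'" and "dir_deriv j g g'"
  shows "dir_deriv j (\<lambda>x. f x *\<^sub>R g x) (\<lambda>x. f' x *\<^sub>R g x + f x *\<^sub>R g' x)"
proof -
  have "((\<lambda>s. f (x + s *\<^sub>R axis j 1) *\<^sub>R g (x + s *\<^sub>R axis j 1)) has_vector_derivative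
      f (x + 0 *\<^sub>R axis j 1) *\<^sub>R g' x + f' x *\<^sub>R g (x + 0 *\<^sub>R axis j 1)) (at 0)" for x
    using assms unfolding dir_deriv_def
    by (intro has_vector_derivative_scaleR) (auto simp: has_real_derivative_iff_has_vector_derivative)
  then show ?thesis by (simp add: dir_deriv_def add.commute)
qed

lemma dir_deriv_leibniz_sum:
  assumes \<Phi>: "\<And>p. length p \<le> length l \<Longrightarrow> dir_deriv j (\<Phi> p) (\<Phi> (j # p))"
    and V: "\<And>p q. (p, q) \<in> set (splits l) \<Longrightarrow> dir_deriv j (V q) (V (j # q))"
  shows "dir_deriv j (leibniz_sum \<Phi> V l) (leibniz_sum \<Phi> V (j # l))"
proof -
  have "dir_deriv j (\<lambda>x. \<Sum>a\<leftarrow>splits l. (case a of (p, q) \<Rightarrow> \<lambda>x. \<Phi> p x *\<^sub>R V q x) x)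
     (\<lambda>x. \<Sum>a\<leftarrow>splits l. (case a of (p, q) \<Rightarrow> \<lambda>x. \<Phi> (j # p) x *\<^sub>R V q x + \<Phi> p x *\<^sub>R V (j # q) x) x)"
  proof (rule dir_deriv_sum_list)
    fix a assume "a \<in> set (splits l)"
    moreover obtain p q where "a = (p, q)" by (cases a)
    ultimately show "dir_deriv j (case a of (p, q) \<Rightarrow> \<lambda>x. \<Phi> p x *\<^sub>R V q x)
      (case a of (p, q) \<Rightarrow> \<lambda>x. \<Phi> (j # p) x *\<^sub>R V q x + \<Phi> p x *\<^sub>R V (j # q) x)"
      using splits_length[of p q l] by (auto intro!: dir_deriv_scaleR \<Phi> V)
  qed
  moreover have "(\<lambda>x. \<Sum>a\<leftarrow>splits l. (case a of (p, q) \<Rightarrow> \<lambda>x. \<Phi> p x *\<^sub>R V q x) x) = leibniz_sum \<Phi> V l"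
    by (auto simp: leibniz_sum_def fun_eq_iff case_prod_unfold)
  moreover have "(\<Sum>a\<leftarrow>as. (case a of (p, q) \<Rightarrow> \<lambda>x. \<Phi> (j # p) x *\<^sub>R V q x + \<Phi> p x *\<^sub>R V (j # q) x) x)
      = (\<Sum>(p, q)\<leftarrow>map (\<lambda>(p, q). (j # p, q)) as @ map (\<lambda>(p, q). (p, j # q)) as. \<Phi> p x *\<^sub>R V q x)" for x as
    by (induction as) (auto simp: algebra_simps)
  ultimately show ?thesis by (simp add: leibniz_sum_def [abs_def])
qed

section \<open>The frozen operator on the frequency side\<close>

text \<open>
  The list of directions in which \<open>D\<^sup>\<beta>\<close> differentiates, outermost first. Together with
  \<open>count_list\<close> it identifies multi-indices with sorted lists.
\<close>

definition index_list :: "('n::{finite,linorder} \<Rightarrow> nat) \<Rightarrow> 'n list" where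
  "index_list \<beta> = concat (map (\<lambda>j. replicate (\<beta> j) j) (sorted_list_of_set UNIV))"

lemma length_index_list [simp]: "length (index_list \<beta>) = mi_order \<beta>"
  by (simp add: index_list_def length_concat mi_order_def o_def sum_list_distinct_conv_sum_set)

lemma prod_list_index_list: "(\<Prod>j\<leftarrow>index_list \<beta>. (s j :: real)) = (\<Prod>j\<in>UNIV. s j ^ \<beta> j)"
proof -
  have r: "prod_list (map s (replicate n j)) = s j ^ n" for n j
    by (induction n) auto
  have "prod_list (map s (concat (map (\<lambda>j. replicate (\<beta> j) j) xs))) = prod_list (map (\<lambda>j. s j ^ \<beta> j) xs)" for xs
    by (induction xs) (auto simp: r)
  then show ?thesis
    by (simp add: index_list_def prod.distinct_set_conv_list[symmetric])
qed

lemma count_concat_replicate: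
  "distinct xs \<Longrightarrow> count_list (concat (map (\<lambda>i. replicate (\<beta> i) i) xs)) j = (if j \<in> set xs then \<beta> j else 0)"
proof (induction xs)
  case (Cons x xs)
  have "count_list (replicate n x) j = (if x = j then n else 0)" for n
    by (induction n) auto
  then show ?case using Cons by auto
qed simp

lemma count_index_list: "count_list (index_list \<beta>) j = \<beta> j"
  unfolding index_list_def by (subst count_concat_replicate) auto

lemma sorted_index_list: "sorted (index_list \<beta>)"
proof -
  have "sorted (concat (map (\<lambda>j. replicate (\<beta> j) j) xs))" if "sorted xs" for xs :: "'a list"
    using that by (induction xs) (auto simp: sorted_append)
  then show ?thesis by (simp add: index_list_def)
qed

lemma index_list_count: "sorted l \<Longrightarrow> index_list (count_list l) = l"
proof -
  assume l: "sorted l"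
  have "mset (index_list (count_list l)) = mset l"
    by (rule multiset_eqI) (simp add: count_index_list add: count_mset)
  then show ?thesis
    using l sorted_index_list by (metis properties_for_sort)
qed

lemma scaleR_eq_smult: "r *\<^sub>R (v :: complex ^ 'm::finite) = of_real r *s v"
  unfolding vec_eq_iff vector_scaleR_component by (simp add: scaleR_conv_of_real)

lemma norm_cinner_le: "cmod (cinner v w) \<le> norm v * norm w"
proof -
  have "cmod (cinner v w) \<le> (\<Sum>i\<in>UNIV. \<bar>norm (v $ i)\<bar> * \<bar>norm (w $ i)\<bar>)"
    unfolding cinner_def by (rule order_trans[OF norm_sum]) (simp add: norm_mult)
  also have "\<dots> \<le> norm v * norm w"
    unfolding norm_vec_def by (rule L2_set_mult_ineq)
  finally show ?thesis .
qed

lemma cinner_self: "cinner z z = of_real ((norm z)\<^sup>2)"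
  unfolding cinner_def norm_vec_power2 of_real_sum by (intro sum.cong refl complex_norm_square[symmetric])

text \<open>
  Lax--Milgram at a single frequency: test \<open>(L - S) z\<close> with \<open>z\<close>.
\<close>

lemma symbol_lower_bound:
  assumes "Re (cinner (S *v z) z) \<le> - \<delta> * norm \<eta> ^ (2 * b) * (norm z)\<^sup>2"
  shows "(L + \<delta> * norm \<eta> ^ (2 * b)) * norm z \<le> norm (L *\<^sub>R z - S *v z)"
proof (cases "z = 0")
  case False
  have "cinner (L *\<^sub>R z - S *v z) z = of_real L * cinner z z - cinner (S *v z) z"
    unfolding scaleR_eq_smult
    by (simp add: cinner_def sum_distrib_left sum_subtractf[symmetric] algebra_simps)
  then have "Re (cinner (L *\<^sub>R z - S *v z) z) = L * (norm z)\<^sup>2 - Re (cinner (S *v z) z)"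
    by (simp add: cinner_self)
  then have "(L + \<delta> * norm \<eta> ^ (2 * b)) * (norm z)\<^sup>2 \<le> Re (cinner (L *\<^sub>R z - S *v z) z)"
    using assms by (simp add: algebra_simps)
  also have "\<dots> \<le> cmod (cinner (L *\<^sub>R z - S *v z) z)" by (rule complex_Re_le_cmod)
  also have "\<dots> \<le> norm (L *\<^sub>R z - S *v z) * norm z" by (rule norm_cinner_le)
  finally have "((L + \<delta> * norm \<eta> ^ (2 * b)) * norm z) * norm z \<le> norm (L *\<^sub>R z - S *v z) * norm z"
    by (simp add: power2_eq_square mult.assoc)
  then show ?thesis using False by simp
qed simp

text \<open>
  Since \<open>\<mu>^(n-k) e^k \<le> max(\<mu>, e)^n\<close>, one lower bound for the symbol controls derivatives of every order
  \<open>k \<le> 2b\<close>, with the weight that is natural for \<open>\<lambda> = \<mu>^(2b)\<close>. It takes the place of interpolation inequalities.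
\<close>

lemma weighted_power_bound:
  fixes \<mu> e \<delta> :: real
  assumes "0 \<le> \<mu>" "0 \<le> e" "0 < \<delta>" "k \<le> n"
  shows "\<mu> ^ (n - k) * e ^ k \<le> max 1 (1 / \<delta>) * (\<mu> ^ n + \<delta> * e ^ n)"
proof -
  have "\<mu> ^ (n - k) * e ^ k \<le> max \<mu> e ^ (n - k) * max \<mu> e ^ k"
    using assms by (intro mult_mono power_mono) auto
  also have "\<dots> = max \<mu> e ^ n" using assms by (simp flip: power_add)
  also have "\<dots> \<le> \<mu> ^ n + e ^ n" using assms by (auto simp: max_def)
  also have "\<dots> \<le> max 1 (1 / \<delta>) * \<mu> ^ n + max 1 (1 / \<delta>) * \<delta> * e ^ n"
  proof (rule add_mono)
    show "\<mu> ^ n \<le> max 1 (1 / \<delta>) * \<mu> ^ n"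
      using assms mult_right_mono[of 1 "max 1 (1 / \<delta>)" "\<mu> ^ n"] by simp
    have "1 \<le> max 1 (1 / \<delta>) * \<delta>" using assms mult_right_mono[of "1 / \<delta>" "max 1 (1 / \<delta>)" \<delta>] by simp
    then show "e ^ n \<le> max 1 (1 / \<delta>) * \<delta> * e ^ n"
      using assms mult_right_mono[of 1 _ "e ^ n"] by simp
  qed
  finally show ?thesis by (simp add: algebra_simps)
qed

lemma prod_list_abs_le:
  assumes "\<And>j. \<bar>s j\<bar> \<le> (e :: real)"
  shows "\<bar>\<Prod>j\<leftarrow>l. s j\<bar> \<le> e ^ length l"
proof -
  have "0 \<le> e" using assms[of undefined] by linarith
  then show ?thesis
    by (induction l) (auto simp: abs_mult intro!: mult_mono assms)
qed

lemma matrix_vector_mult_sum_right: "(A :: complex ^ 'm ^ 'm::finite) *v (\<Sum>k\<in>K. v k) = (\<Sum>k\<in>K. A *v v k)"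
  by (induction K rule: infinite_finite_induct) (auto simp: matrix_vector_right_distrib)

text \<open>
  \<open>L - A\<^sub>0(y, D)\<close>, with coefficients frozen at \<open>y\<close>, as a function of the family \<open>D\<close> of derivatives at one
  point. \<open>D\<close> can consist of derivatives or of central differences.
\<close>

definition frozen_op :: "nat \<Rightarrow> ('n::{finite,linorder}, 'm::finite) coeffs \<Rightarrow> real ^ 'n::{finite,linorder} \<Rightarrow> real \<Rightarrow>
    ('n list \<Rightarrow> complex ^ 'm) \<Rightarrow> complex ^ 'm" where
  "frozen_op b a y L D = L *\<^sub>R D [] - (\<Sum>\<beta> | mi_order \<beta> = 2 * b. a \<beta> y *v ((1 / \<i>) ^ (2 * b) *s D (index_list \<beta>)))"

lemma dft_frozen_op:
  fixes f :: "real ^ 'n::{finite,linorder} \<Rightarrow> complex ^ 'm::finite" and M :: nat and h :: real and N' :: nat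
  assumes supp: "\<And>k. k \<notin> lattice_box N \<Longrightarrow> f (lattice_pt h k) = 0" and N': "N + 2 * b \<le> N'"
  defines "z \<equiv> \<lambda>t. dft (lattice_box N') M (\<lambda>k. f (lattice_pt h k)) t"
  shows "dft (lattice_box N') M (\<lambda>k. frozen_op b a y L (\<lambda>l. central_diffs h l f (lattice_pt h k))) t
    = L *\<^sub>R z t - symbol_A0 b a y (\<chi> j. sin (2 * pi * t j / M) / h) *v z t"
proof -
  define \<eta> where "\<eta> = (\<chi> j. sin (2 * pi * t j / M) / h)"
  have fin: "finite {\<beta> :: 'n \<Rightarrow> nat. mi_order \<beta> = 2 * b}"
    by (rule finite_subset[OF _ finite_mi_order_le[of "2 * b"]]) auto
  have z: "dft (lattice_box N') M (\<lambda>k. central_diffs h (index_list \<beta>) f (lattice_pt h k)) t = (\<i> ^ (2 * b) * of_real (mi_power \<eta> \<beta>)) *s z t"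
    if "mi_order \<beta> = 2 * b" for \<beta>
    using that dft_central_diffs[of N f h "index_list \<beta>" N' M t] supp N'
    by (simp add: z_def prod_list_index_list mi_power_def \<eta>_def)
  have i: "(1 / \<i>) ^ (2 * b) * \<i> ^ (2 * b) = 1"
    by (simp flip: power_mult_distrib)
  have "dft (lattice_box N') M (\<lambda>k. frozen_op b a y L (\<lambda>l. central_diffs h l f (lattice_pt h k))) t
     = L *\<^sub>R z t - (\<Sum>k\<in>lattice_box N'. \<Sum>\<beta> | mi_order \<beta> = 2 * b. dft_char M t k *s (a \<beta> y *v ((1 / \<i>) ^ (2 * b) *s central_diffs h (index_list \<beta>) f (lattice_pt h k))))"
    unfolding dft_def z_def frozen_op_def scaleR_eq_smult
    by (simp add: vec.scale_right_diff_distrib sum_subtractf vec.scale_sum_right vector_smult_assoc mult.commute)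
  also have "(\<Sum>k\<in>lattice_box N'. \<Sum>\<beta> | mi_order \<beta> = 2 * b. dft_char M t k *s (a \<beta> y *v ((1 / \<i>) ^ (2 * b) *s central_diffs h (index_list \<beta>) f (lattice_pt h k))))
     = (\<Sum>\<beta> | mi_order \<beta> = 2 * b. \<Sum>k\<in>lattice_box N'. a \<beta> y *v ((1 / \<i>) ^ (2 * b) *s (dft_char M t k *s central_diffs h (index_list \<beta>) f (lattice_pt h k))))"
    by (subst sum.swap) (simp only: vector_scalar_commute vector_smult_assoc mult.commute)
  also have "\<dots> = (\<Sum>\<beta> | mi_order \<beta> = 2 * b. a \<beta> y *v ((1 / \<i>) ^ (2 * b) *s dft (lattice_box N') M (\<lambda>k. central_diffs h (index_list \<beta>) f (lattice_pt h k)) t))"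
    by (simp only: dft_def vec.scale_sum_right matrix_vector_mult_sum_right)
  also have "\<dots> = (\<Sum>\<beta> | mi_order \<beta> = 2 * b. a \<beta> y *v (of_real (mi_power \<eta> \<beta>) *s z t))"
    by (rule sum.cong[OF refl]) (simp only: mem_Collect_eq z vector_smult_assoc mult.assoc[symmetric] i mult_1_left)
  also have "\<dots> = symbol_A0 b a y \<eta> *v z t"
    unfolding vec_eq_iff
  proof
    fix i
    have "(\<Sum>\<beta> | mi_order \<beta> = 2 * b. a \<beta> y *v (of_real (mi_power \<eta> \<beta>) *s z t)) $ i
       = (\<Sum>\<beta> | mi_order \<beta> = 2 * b. \<Sum>j\<in>UNIV. a \<beta> y $ i $ j * of_real (mi_power \<eta> \<beta>) * z t $ j)"
      by (simp add: matrix_vector_mult_def mult.assoc)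
    also have "\<dots> = (symbol_A0 b a y \<eta> *v z t) $ i"
      by (subst sum.swap) (simp add: matrix_vector_mult_def symbol_A0_def sum_distrib_right)
    finally show "(\<Sum>\<beta> | mi_order \<beta> = 2 * b. a \<beta> y *v (of_real (mi_power \<eta> \<beta>) *s z t)) $ i = (symbol_A0 b a y \<eta> *v z t) $ i" .
  qed
  finally show ?thesis unfolding \<eta>_def .
qed

text \<open>
  The constant coefficient estimate. At each frequency it combines \<open>symbol_lower_bound\<close> with
  \<open>weighted_power_bound\<close>; Parseval, applied on both sides, transfers it to lattice sums. The constant
  depends on neither \<open>h\<close> nor the size \<open>N'\<close> of the box.
\<close>

lemma discrete_estimate:
  fixes f :: "real ^ 'n::{finite,linorder} \<Rightarrow> complex ^ 'm::finite"
    and a :: "('n::{finite,linorder}, 'm) coeffs"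
  assumes par: "\<And>\<eta> z. Re (cinner (symbol_A0 b a y \<eta> *v z) z) \<le> - \<delta> * norm \<eta> ^ (2 * b) * (norm z)\<^sup>2"
    and "0 < \<delta>" "0 \<le> \<mu>"
    and supp: "\<And>k. k \<notin> lattice_box N \<Longrightarrow> f (lattice_pt h k) = 0" and N': "N + 2 * b \<le> N'" and l: "length l \<le> 2 * b"
  shows "(\<mu> ^ (2 * b - length l))\<^sup>2 * (\<Sum>k\<in>lattice_box N'. (norm (central_diffs h l f (lattice_pt h k)))\<^sup>2)
    \<le> (max 1 (1 / \<delta>))\<^sup>2 * (\<Sum>k\<in>lattice_box N'. (norm (frozen_op b a y (\<mu> ^ (2 * b)) (\<lambda>l. central_diffs h l f (lattice_pt h k))))\<^sup>2)"
proof -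
  \<comment> \<open>The period exceeds the diameter of the box.\<close>
  define M where "M = 2 * N' + 1"
  define K where "K = (lattice_box N' :: ('n \<Rightarrow> int) set)"
  define \<eta> where "\<eta> = (\<lambda>t. (\<chi> j. sin (2 * pi * t j / M) / h) :: real ^ 'n::{finite,linorder})"
  define z where "z = (\<lambda>t. dft K M (\<lambda>k. f (lattice_pt h k)) t)"
  have diam: "\<bar>k j - k' j\<bar> < int M" if "k \<in> K" "k' \<in> K" for k k' j
  proof -
    have "\<bar>k j\<bar> \<le> int N'" "\<bar>k' j\<bar> \<le> int N'" using that by (auto simp: K_def lattice_box_def)
    then show ?thesis by (simp add: M_def)
  qed
  have freq: "\<mu> ^ (2 * b - length l) * norm (dft K M (\<lambda>k. central_diffs h l f (lattice_pt h k)) t)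
      \<le> max 1 (1 / \<delta>) * norm (dft K M (\<lambda>k. frozen_op b a y (\<mu> ^ (2 * b)) (\<lambda>l. central_diffs h l f (lattice_pt h k))) t)" for t
  proof -
    have "cmod (\<i> ^ length l * of_real (\<Prod>j\<leftarrow>l. sin (2 * pi * t j / M) / h)) = \<bar>\<Prod>j\<leftarrow>l. \<eta> t $ j\<bar>"
      by (simp add: norm_mult norm_power \<eta>_def)
    also have "\<dots> \<le> norm (\<eta> t) ^ length l"
      by (rule prod_list_abs_le) (metis component_le_norm_cart)
    finally have sym: "cmod (\<i> ^ length l * of_real (\<Prod>j\<leftarrow>l. sin (2 * pi * t j / M) / h)) \<le> norm (\<eta> t) ^ length l" .
    have "norm (dft K M (\<lambda>k. central_diffs h l f (lattice_pt h k)) t)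
        = cmod (\<i> ^ length l * of_real (\<Prod>j\<leftarrow>l. sin (2 * pi * t j / M) / h)) * norm (z t)"
      unfolding K_def z_def norm_vector_scalar_mult[symmetric]
      by (rule arg_cong[of _ _ norm], rule dft_central_diffs[where N = N]) (use supp N' l in auto)
    also have "\<dots> \<le> norm (\<eta> t) ^ length l * norm (z t)"
      by (rule mult_right_mono[OF sym]) simp
    finally have "\<mu> ^ (2 * b - length l) * norm (dft K M (\<lambda>k. central_diffs h l f (lattice_pt h k)) t)
       \<le> \<mu> ^ (2 * b - length l) * (norm (\<eta> t) ^ length l * norm (z t))"
      using \<open>0 \<le> \<mu>\<close> by (intro mult_left_mono) auto
    also have "\<dots> \<le> max 1 (1 / \<delta>) * (\<mu> ^ (2 * b) + \<delta> * norm (\<eta> t) ^ (2 * b)) * norm (z t)"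
      unfolding mult.assoc[symmetric]
      using weighted_power_bound[of \<mu> "norm (\<eta> t)" \<delta> "length l" "2 * b"] assms by (intro mult_right_mono) (auto simp: mult.assoc)
    also have "\<dots> \<le> max 1 (1 / \<delta>) * norm (\<mu> ^ (2 * b) *\<^sub>R z t - symbol_A0 b a y (\<eta> t) *v z t)"
      unfolding mult.assoc by (intro mult_left_mono symbol_lower_bound par) auto
    also have "\<mu> ^ (2 * b) *\<^sub>R z t - symbol_A0 b a y (\<eta> t) *v z t
       = dft K M (\<lambda>k. frozen_op b a y (\<mu> ^ (2 * b)) (\<lambda>l. central_diffs h l f (lattice_pt h k))) t"
      unfolding K_def z_def \<eta>_def by (rule dft_frozen_op[where N = N, symmetric]) (use supp N' in auto)
    finally show ?thesis .
  qed
  have "real M ^ CARD('n) * ((\<mu> ^ (2 * b - length l))\<^sup>2 * (\<Sum>k\<in>K. (norm (central_diffs h l f (lattice_pt h k)))\<^sup>2))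
      = (\<mu> ^ (2 * b - length l))\<^sup>2 * (\<Sum>t\<in>freqs M. (norm (dft K M (\<lambda>k. central_diffs h l f (lattice_pt h k)) t))\<^sup>2)"
    by (subst parseval) (use diam in \<open>auto simp: K_def\<close>)
  also have "\<dots> = (\<Sum>t\<in>freqs M. (\<mu> ^ (2 * b - length l) * norm (dft K M (\<lambda>k. central_diffs h l f (lattice_pt h k)) t))\<^sup>2)"
    by (simp add: sum_distrib_left power_mult_distrib)
  also have "\<dots> \<le> (\<Sum>t\<in>freqs M. (max 1 (1 / \<delta>) * norm (dft K M (\<lambda>k. frozen_op b a y (\<mu> ^ (2 * b)) (\<lambda>l. central_diffs h l f (lattice_pt h k))) t))\<^sup>2)"
    using \<open>0 \<le> \<mu>\<close> by (intro sum_mono power_mono freq) auto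
  also have "\<dots> = (max 1 (1 / \<delta>))\<^sup>2 * (\<Sum>t\<in>freqs M. (norm (dft K M (\<lambda>k. frozen_op b a y (\<mu> ^ (2 * b)) (\<lambda>l. central_diffs h l f (lattice_pt h k))) t))\<^sup>2)"
    by (simp only: sum_distrib_left power_mult_distrib)
  also have "\<dots> = real M ^ CARD('n) * ((max 1 (1 / \<delta>))\<^sup>2 * (\<Sum>k\<in>K. (norm (frozen_op b a y (\<mu> ^ (2 * b)) (\<lambda>l. central_diffs h l f (lattice_pt h k))))\<^sup>2))"
    by (subst parseval) (use diam in \<open>auto simp: K_def\<close>)
  finally show ?thesis
    unfolding K_def by (rule mult_left_le_imp_le) (simp add: M_def)
qed

section \<open>Cut-off functions\<close>

lemma DERIV_pos_part_power:
  assumes "2 \<le> n"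
  shows "((\<lambda>x. (max 0 x) ^ n) has_real_derivative of_nat n * (max 0 x) ^ (n - 1)) (at x)"
proof -
  consider "x > 0" | "x < 0" | "x = 0" by linarith
  then show ?thesis
  proof cases
    case 1
    have "((\<lambda>x. x ^ n) has_real_derivative of_nat n * x ^ (n - 1)) (at x)"
      by (auto intro!: derivative_eq_intros)
    moreover have ev: "\<forall>\<^sub>F y in nhds x. (max 0 y) ^ n = y ^ n"
      using eventually_nhds_in_open[of "{0<..}" x] 1 by (auto elim!: eventually_mono)
    ultimately have "((\<lambda>x. (max 0 x) ^ n) has_real_derivative of_nat n * x ^ (n - 1)) (at x)"
      by (intro DERIV_cong_ev[OF refl ev refl, THEN iffD2])
    then show ?thesis using 1 by simp
  next
    case 2
    have ev: "\<forall>\<^sub>F y in nhds x. (max 0 y) ^ n = 0"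
      using eventually_nhds_in_open[of "{..<0}" x] 2 assms by (auto elim!: eventually_mono)
    have "((\<lambda>x. (max 0 x) ^ n) has_real_derivative 0) (at x)"
      by (rule DERIV_cong_ev[OF refl ev refl, THEN iffD2]) simp
    moreover have "n - 1 \<noteq> 0" using assms by simp
    ultimately show ?thesis using 2 by (simp add: power_0_left)
  next
    case 3
    have "((\<lambda>h. (max 0 h) ^ n / h) \<longlongrightarrow> 0) (at (0 :: real))"
    proof (rule Lim_null_comparison)
      show "\<forall>\<^sub>F h in at (0 :: real). norm ((max 0 h) ^ n / h) \<le> \<bar>h\<bar> ^ (n - 1)"
      proof (rule eventually_at_topological[THEN iffD2], intro exI[of _ UNIV] conjI ballI impI)
        fix h :: real assume "h \<noteq> 0"
        have "\<bar>max 0 h\<bar> ^ n \<le> \<bar>h\<bar> ^ n" by (intro power_mono) auto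
        also have "\<dots> = \<bar>h\<bar> ^ (n - 1) * \<bar>h\<bar>" using assms by (cases n) auto
        finally show "norm ((max 0 h) ^ n / h) \<le> \<bar>h\<bar> ^ (n - 1)"
          using \<open>h \<noteq> 0\<close> by (simp add: norm_divide norm_power field_simps)
      qed auto
      show "((\<lambda>h :: real. \<bar>h\<bar> ^ (n - 1)) \<longlongrightarrow> 0) (at 0)"
        using assms by (intro tendsto_eq_intros | simp)+
    qed
    moreover have "n \<noteq> 0" "n - 1 \<noteq> 0" using assms by simp_all
    ultimately show ?thesis using 3 by (simp add: DERIV_def power_0_left)
  qed
qed

text \<open>
  The bump is the \<open>m\<close>-th power of the positive part of \<open>2 - (s/r)\<^sup>2\<close>. It is at least \<open>1\<close> for
  \<open>|s| \<le> r\<close>, it vanishes for \<open>|s| \<ge> 3r/2\<close>, and its maximum \<open>2\<^sup>m\<close> does not depend on \<open>r\<close>; the last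
  point is what lets the error of freezing be absorbed by choosing \<open>r\<close> small.
\<close>

definition bump_poly :: "real \<Rightarrow> real poly" where
  "bump_poly r = [:2, 0, - 1 / r\<^sup>2:]"

text \<open>
  The \<open>i\<close>-th derivative of the bump is a polynomial times the \<open>(m - i)\<close>-th power of the positive part;
  this is the recursion for the polynomial.
\<close>

primrec bump_factor :: "real \<Rightarrow> nat \<Rightarrow> nat \<Rightarrow> real poly" where
  "bump_factor r m 0 = 1"
| "bump_factor r m (Suc i) = pderiv (bump_factor r m i) * bump_poly r
     + smult (real (m - i)) (bump_factor r m i * pderiv (bump_poly r))"

definition bump :: "real \<Rightarrow> nat \<Rightarrow> nat \<Rightarrow> real \<Rightarrow> real" where
  "bump r m i s = poly (bump_factor r m i) s * (max 0 (poly (bump_poly r) s)) ^ (m - i)"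

lemma DERIV_bump:
  assumes "i + 2 \<le> m"
  shows "(bump r m i has_real_derivative bump r m (Suc i) s) (at s)"
proof -
  let ?q = "poly (bump_poly r)"
  have "((\<lambda>s. (max 0 (?q s)) ^ (m - i)) has_real_derivative
      (real (m - i) * (max 0 (?q s)) ^ (m - i - 1)) * poly (pderiv (bump_poly r)) s) (at s)"
    by (rule DERIV_chain2[OF DERIV_pos_part_power]) (use assms in \<open>auto intro: poly_DERIV\<close>)
  then have "((\<lambda>s. poly (bump_factor r m i) s * (max 0 (?q s)) ^ (m - i)) has_real_derivative
      poly (pderiv (bump_factor r m i)) s * (max 0 (?q s)) ^ (m - i)
      + ((real (m - i) * (max 0 (?q s)) ^ (m - i - 1)) * poly (pderiv (bump_poly r)) s) * poly (bump_factor r m i) s) (at s)"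
    by (intro DERIV_mult poly_DERIV)
  moreover have "(max 0 (?q s)) ^ (m - i) = ?q s * (max 0 (?q s)) ^ (m - i - 1)"
  proof -
    have "m - i = Suc (m - i - 1)" using assms by simp
    moreover have "max 0 (?q s) * (max 0 (?q s)) ^ (m - i - 1) = ?q s * (max 0 (?q s)) ^ (m - i - 1)"
      using assms by (auto simp: max_def)
    ultimately show ?thesis by (metis power_Suc)
  qed
  ultimately show ?thesis
    unfolding bump_def[abs_def] by (simp add: algebra_simps)
qed

lemma continuous_bump: "continuous_on UNIV (bump r m i)"
  unfolding bump_def[abs_def] by (intro continuous_intros)

lemma bump_support:
  assumes "i < m" "0 < r" "3 / 2 * r \<le> \<bar>s\<bar>"
  shows "bump r m i s = 0"
proof -
  have "(3 / 2 * r)\<^sup>2 \<le> s\<^sup>2" using assms power_mono[of "3 / 2 * r" "\<bar>s\<bar>" 2] by simp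
  then have "9 * r\<^sup>2 \<le> s\<^sup>2 * 4" by (simp add: power_mult_distrib power_divide)
  then have "2 * r\<^sup>2 \<le> s\<^sup>2" using zero_le_power2[of r] by linarith
  then have "2 \<le> s\<^sup>2 / r\<^sup>2" using assms by (simp add: le_divide_eq)
  then have "poly (bump_poly r) s \<le> 0" by (simp add: bump_poly_def power2_eq_square)
  then show ?thesis using assms by (simp add: bump_def max_def)
qed

lemma bump_range: "0 \<le> bump r m 0 s" "bump r m 0 s \<le> 2 ^ m"
proof -
  have "poly (bump_poly r) s \<le> 2" by (simp add: bump_poly_def mult_nonneg_nonneg flip: power2_eq_square)
  then show "bump r m 0 s \<le> 2 ^ m" by (simp add: bump_def power_mono)
qed (simp add: bump_def)

lemma bump_ge_1:
  assumes "0 < r" "\<bar>s\<bar> \<le> r"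
  shows "1 \<le> bump r m 0 s"
proof -
  have "s\<^sup>2 \<le> r\<^sup>2" using assms power_mono[of "\<bar>s\<bar>" r 2] by simp
  then have "s\<^sup>2 / r\<^sup>2 \<le> 1" using assms by simp
  then have "1 \<le> poly (bump_poly r) s" by (simp add: bump_poly_def power2_eq_square)
  then show ?thesis by (simp add: bump_def one_le_power)
qed

text \<open>
  The derivative along the list \<open>p\<close> of the product of bumps: each coordinate is differentiated as often
  as it occurs in \<open>p\<close>.
\<close>

definition cutoff :: "real \<Rightarrow> nat \<Rightarrow> 'n::finite list \<Rightarrow> real ^ 'n \<Rightarrow> real" where
  "cutoff r m p x = (\<Prod>j\<in>UNIV. bump r m (count_list p j) (x $ j))"

lemma dir_deriv_cutoff:
  assumes "length p + 2 \<le> m"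
  shows "dir_deriv j (cutoff r m p) (cutoff r m (j # p))"
proof -
  have "((\<lambda>s. cutoff r m p (x + s *\<^sub>R axis j 1)) has_real_derivative cutoff r m (j # p) x) (at 0)" for x
  proof -
    define c where "c = (\<Prod>i\<in>UNIV - {j}. bump r m (count_list p i) (x $ i))"
    have split: "cutoff r m p' y = bump r m (count_list p' j) (y $ j) * (\<Prod>i\<in>UNIV - {j}. bump r m (count_list p' i) (y $ i))" for p' y
      unfolding cutoff_def by (rule prod.remove) auto
    have "(\<Prod>i\<in>UNIV - {j}. bump r m (count_list p i) ((x + s *\<^sub>R axis j 1) $ i)) = c" for s
      unfolding c_def by (rule prod.cong) (auto simp: axis_def)
    then have 1: "cutoff r m p (x + s *\<^sub>R axis j 1) = bump r m (count_list p j) (x $ j + s) * c" for s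
      by (simp add: split axis_def)
    have 2: "cutoff r m (j # p) x = bump r m (Suc (count_list p j)) (x $ j) * c"
      unfolding split c_def by (intro arg_cong2[of _ _ _ _ "(*)"] prod.cong) auto
    have "count_list p j + 2 \<le> m" using assms count_le_length[of p j] by linarith
    then have "((\<lambda>s. bump r m (count_list p j) (x $ j + s)) has_real_derivative bump r m (Suc (count_list p j)) (x $ j)) (at 0)"
      using DERIV_bump[of "count_list p j" m r "x $ j"] DERIV_shift[of "bump r m (count_list p j)" _ 0 "x $ j"]
      by (simp add: add.commute)
    then show ?thesis unfolding 1 2 by (rule DERIV_cmult_right)
  qed
  then show ?thesis by (simp add: dir_deriv_def has_real_derivative_iff_has_vector_derivative)
qed

lemma cutoff_support:
  assumes "length p < m" "0 < r" "3 / 2 * r \<le> \<bar>x $ j\<bar>"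
  shows "cutoff r m p x = 0"
proof -
  have "bump r m (count_list p j) (x $ j) = 0"
    using assms count_le_length[of p j] by (intro bump_support) auto
  then show ?thesis by (auto simp: cutoff_def)
qed

lemma cutoff_range: "0 \<le> cutoff r m [] (x :: real ^ 'n::finite)" "cutoff r m [] (x :: real ^ 'n::finite) \<le> (2 ^ m) ^ CARD('n)"
proof -
  show "0 \<le> cutoff r m [] x" by (auto simp: cutoff_def bump_range intro!: prod_nonneg)
  have "(\<Prod>j\<in>(UNIV :: 'n set). bump r m 0 (x $ j)) \<le> (\<Prod>j\<in>(UNIV :: 'n set). 2 ^ m)"
    by (intro prod_mono) (auto simp: bump_range)
  then show "cutoff r m [] x \<le> (2 ^ m) ^ CARD('n)" by (simp add: cutoff_def)
qed

lemma cutoff_ge_1: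
  assumes "0 < r" "\<And>j. \<bar>x $ j\<bar> \<le> r"
  shows "1 \<le> cutoff r m [] x"
  unfolding cutoff_def by (rule prod_ge_1) (simp add: bump_ge_1 assms)

lemma continuous_cutoff: "continuous_on UNIV (cutoff r m p)"
  unfolding cutoff_def[abs_def]
  by (intro continuous_intros continuous_on_compose2[OF continuous_bump]) auto

lemma compact_support_modulus:
  fixes f :: "real ^ 'n::finite \<Rightarrow> real"
  assumes f: "continuous_on UNIV f" and supp: "\<And>x j. R \<le> \<bar>x $ j\<bar> \<Longrightarrow> f x = 0" and "0 < e"
  shows "\<forall>\<^sub>F B in at_top. \<forall>x. \<bar>f x\<bar> \<le> B" (is ?bdd)
    and "\<forall>\<^sub>F d in at_right 0. \<forall>x x'. norm (x - x') \<le> d \<longrightarrow> \<bar>f x - f x'\<bar> \<le> e" (is ?ucont)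
proof -
  define S :: "(real ^ 'n) set" where "S = cbox (\<chi> j. - (R + 1)) (\<chi> j. R + 1)"
  have out: "f x = 0" if "x \<notin> S" for x
  proof -
    obtain j where "\<not> (- (R + 1) \<le> x $ j \<and> x $ j \<le> R + 1)"
      using \<open>x \<notin> S\<close> by (auto simp: S_def mem_box_cart)
    then show ?thesis by (intro supp[of x j]) auto
  qed
  have compact: "compact S" by (simp add: S_def)
  have cont: "continuous_on S f" using f continuous_on_subset by blast
  obtain B where B: "\<And>x. x \<in> S \<Longrightarrow> \<bar>f x\<bar> \<le> B"
    using compact_imp_bounded[OF compact_continuous_image[OF cont compact]] by (auto simp: bounded_iff)
  show ?bdd
    using eventually_ge_at_top[of "max B 0"]
  proof eventually_elim
    case (elim B')
    show ?case
    proof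
      fix x show "\<bar>f x\<bar> \<le> B'" using B[of x] out[of x] elim by (cases "x \<in> S") auto
    qed
  qed
  obtain d where d: "d > 0" "\<And>x x'. x \<in> S \<Longrightarrow> x' \<in> S \<Longrightarrow> dist x' x < d \<Longrightarrow> dist (f x') (f x) < e"
    using compact_uniformly_continuous[OF cont compact] \<open>0 < e\<close> unfolding uniformly_continuous_on_def by metis
  have "\<bar>f x - f x'\<bar> \<le> e" if "norm (x - x') < min d 1" for x x'
  proof (cases "x \<in> S \<and> x' \<in> S")
    case True
    then show ?thesis using d(2)[of x' x] that by (simp add: dist_norm)
  next
    case False
    have zero: "f z = 0 \<and> f z' = 0" if "z \<notin> S" "norm (z - z') < 1" for z z'
    proof -
      obtain j where j: "\<not> (- (R + 1) \<le> z $ j \<and> z $ j \<le> R + 1)"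
        using \<open>z \<notin> S\<close> by (auto simp: S_def mem_box_cart)
      have "\<bar>(z - z') $ j\<bar> < 1" using component_le_norm_cart[of "z - z'" j] that(2) by linarith
      then have "R \<le> \<bar>z' $ j\<bar>" using j by auto
      then show ?thesis using out[OF that(1)] supp by blast
    qed
    have "norm (x' - x) < 1" using that by (simp add: norm_minus_commute)
    then have "f x = 0 \<and> f x' = 0" using False zero[of x x'] zero[of x' x] that by auto
    then show ?thesis using \<open>0 < e\<close> by simp
  qed
  then show ?ucont
    using eventually_at_right_less[of 0] d(1) eventually_at_right_real[of 0 "min d 1"]
    by (auto elim!: eventually_mono)
qed

definition short_lists :: "nat \<Rightarrow> 'n::finite list set" where
  "short_lists k = {l. length l \<le> k}"

lemma finite_short_lists: "finite (short_lists k :: 'n::finite list set)"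
  using finite_lists_length_le[of "UNIV :: 'n set" k] by (simp add: short_lists_def)

lemma cutoff_bounds:
  assumes "0 < r" "k < m"
  obtains B where "B \<ge> 0" "\<And>p x. length p \<le> k \<Longrightarrow> \<bar>cutoff r m p (x :: real ^ 'n::finite)\<bar> \<le> B"
proof -
  have "\<forall>\<^sub>F B in at_top. \<forall>p\<in>short_lists k. \<forall>x. \<bar>cutoff r m p (x :: real ^ 'n)\<bar> \<le> B"
  proof (rule eventually_ball_finite[OF finite_short_lists], rule ballI)
    fix p :: "'n list" assume "p \<in> short_lists k"
    then show "\<forall>\<^sub>F B in at_top. \<forall>x. \<bar>cutoff r m p x\<bar> \<le> B"
      using assms
      by (intro compact_support_modulus(1)[OF continuous_cutoff, of "3 / 2 * r" _ _ _ 1] cutoff_support) (auto simp: short_lists_def)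
  qed
  then have "\<forall>\<^sub>F B in at_top. B \<ge> 0 \<and> (\<forall>p\<in>short_lists k. \<forall>x. \<bar>cutoff r m p (x :: real ^ 'n)\<bar> \<le> B)"
    using eventually_ge_at_top[of 0] by eventually_elim auto
  then obtain B where "B \<ge> 0 \<and> (\<forall>p\<in>short_lists k. \<forall>x. \<bar>cutoff r m p (x :: real ^ 'n)\<bar> \<le> B)"
    using eventually_happens trivial_limit_at_top_linorder by blast
  then show ?thesis using that by (auto simp: short_lists_def)
qed

text \<open>
  Stated for all short lists at once, because one radius has to serve all derivatives that occur in the
  Leibniz rule.
\<close>

lemma cutoff_modulus:
  assumes "0 < r" "k < m" "0 < e"
  shows "\<forall>\<^sub>F d in at_right 0. \<forall>p\<in>short_lists k. \<forall>x x' :: real ^ 'n::finite.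
    norm (x - x') \<le> d \<longrightarrow> \<bar>cutoff r m p x - cutoff r m p x'\<bar> \<le> e"
proof (rule eventually_ball_finite[OF finite_short_lists], rule ballI)
  fix p :: "'n list" assume "p \<in> short_lists k"
  then show "\<forall>\<^sub>F d in at_right 0. \<forall>x x'. norm (x - x') \<le> d \<longrightarrow> \<bar>cutoff r m p x - cutoff r m p x'\<bar> \<le> e"
    using assms
    by (intro compact_support_modulus(2)[OF continuous_cutoff, of "3 / 2 * r"] cutoff_support) (auto simp: short_lists_def)
qed

section \<open>Lattice cubes\<close>

lemma norm_matrix_vector_le:
  fixes A :: "complex ^ 'm::finite ^ 'm"
  assumes "\<And>i j. cmod (A $ i $ j) \<le> c"
  shows "norm (A *v z) \<le> (real CARD('m))\<^sup>2 * c * norm z"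
proof -
  have c: "0 \<le> c" using assms[of undefined undefined] norm_ge_zero order_trans by blast
  have comp: "norm ((A *v z) $ i) \<le> real (CARD('m)) * c * norm z" for i
  proof -
    have "norm ((A *v z) $ i) \<le> (\<Sum>j\<in>UNIV. cmod (A $ i $ j) * cmod (z $ j))"
      by (simp add: matrix_vector_mult_def) (rule order_trans[OF norm_sum], simp add: norm_mult)
    also have "\<dots> \<le> (\<Sum>j\<in>(UNIV :: 'm set). c * norm z)"
      by (intro sum_mono mult_mono assms Finite_Cartesian_Product.norm_nth_le c) auto
    finally show ?thesis by (simp add: mult.assoc)
  qed
  have "norm (A *v z) \<le> (\<Sum>i\<in>UNIV. norm ((A *v z) $ i))"
    unfolding norm_vec_def by (rule L2_set_le_sum) simp
  also have "\<dots> \<le> (\<Sum>i\<in>(UNIV :: 'm set). real (CARD('m)) * c * norm z)"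
    by (intro sum_mono comp)
  finally show ?thesis by (simp add: power2_eq_square mult.assoc)
qed

lemma square_sum3_le: "((u :: real) + v + w)\<^sup>2 \<le> 3 * (u\<^sup>2 + v\<^sup>2 + w\<^sup>2)"
proof -
  have "0 \<le> (u - v)\<^sup>2 + (u - w)\<^sup>2 + (v - w)\<^sup>2" by simp
  then show ?thesis by (simp add: power2_eq_square algebra_simps)
qed

definition lattice_cube :: "real \<Rightarrow> real \<Rightarrow> real ^ 'n::finite \<Rightarrow> ('n \<Rightarrow> int) set" where
  "lattice_cube h r y = {k. \<forall>j. \<bar>h * of_int (k j) - y $ j\<bar> \<le> r}"

lemma lattice_cube_PiE: "lattice_cube h r y = (\<Pi>\<^sub>E j\<in>UNIV. {k. \<bar>h * of_int k - y $ j\<bar> \<le> r})"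
  by (auto simp: lattice_cube_def PiE_def Pi_def)

lemma lattice_interval:
  assumes "0 < h"
  shows "{k :: int. \<bar>h * of_int k - c\<bar> \<le> r} = {\<lceil>(c - r) / h\<rceil>..\<lfloor>(c + r) / h\<rfloor>}"
  using assms by (auto simp: abs_le_iff ceiling_le_iff le_floor_iff divide_le_eq le_divide_eq mult.commute algebra_simps)

lemma card_lattice_interval:
  assumes "0 < h" "h \<le> r"
  shows "real (card {k :: int. \<bar>h * of_int k - c\<bar> \<le> r}) \<le> 3 * r / h"
    and "r / h \<le> real (card {k :: int. \<bar>h * of_int k - c\<bar> \<le> r})"
proof -
  have w: "(c + r) / h - (c - r) / h = 2 * (r / h)" using assms by (simp add: field_simps)
  have "1 \<le> r / h" using assms by simp
  then show "real (card {k :: int. \<bar>h * of_int k - c\<bar> \<le> r}) \<le> 3 * r / h"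
    and "r / h \<le> real (card {k :: int. \<bar>h * of_int k - c\<bar> \<le> r})"
    using w unfolding lattice_interval[OF assms(1)] by (simp_all, linarith+)
qed

lemma finite_lattice_cube: "0 < h \<Longrightarrow> finite (lattice_cube h r y)"
  unfolding lattice_cube_PiE by (intro finite_PiE) (auto simp: lattice_interval)

lemma card_lattice_cube:
  fixes y :: "real ^ 'n::finite"
  assumes "0 < h" "h \<le> r"
  shows "real (card (lattice_cube h r y)) \<le> (3 * r / h) ^ CARD('n)"
    and "(r / h) ^ CARD('n) \<le> real (card (lattice_cube h r y))"
proof -
  have c: "real (card (lattice_cube h r y)) = (\<Prod>j\<in>UNIV. real (card {k :: int. \<bar>h * of_int k - y $ j\<bar> \<le> r}))"
    unfolding lattice_cube_PiE by (simp add: card_PiE)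
  have "(\<Prod>j\<in>(UNIV :: 'n set). real (card {k :: int. \<bar>h * of_int k - y $ j\<bar> \<le> r})) \<le> (\<Prod>j\<in>(UNIV :: 'n set). 3 * r / h)"
    using assms by (intro prod_mono conjI card_lattice_interval) auto
  then show "real (card (lattice_cube h r y)) \<le> (3 * r / h) ^ CARD('n)" using c by simp
  have "(\<Prod>j\<in>(UNIV :: 'n set). r / h) \<le> (\<Prod>j\<in>(UNIV :: 'n set). real (card {k :: int. \<bar>h * of_int k - y $ j\<bar> \<le> r}))"
    using assms by (intro prod_mono conjI card_lattice_interval) auto
  then show "(r / h) ^ CARD('n) \<le> real (card (lattice_cube h r y))" using c by simp
qed

definition signs :: "(real ^ 'n::finite) set" where
  "signs = {\<sigma>. \<forall>j. \<sigma> $ j \<in> {- 1, 1}}"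

lemma signs: "finite (signs :: (real ^ 'n::finite) set)" "card (signs :: (real ^ 'n) set) \<le> 2 ^ CARD('n)"
proof -
  have eq: "signs = (\<lambda>f. \<chi> j. f j) ` ((UNIV :: 'n set) \<rightarrow>\<^sub>E {- 1, 1})"
  proof (intro equalityI subsetI)
    fix \<sigma> :: "real ^ 'n" assume "\<sigma> \<in> signs"
    then show "\<sigma> \<in> (\<lambda>f. \<chi> j. f j) ` (UNIV \<rightarrow>\<^sub>E {- 1, 1})"
      by (intro image_eqI[of _ _ "\<lambda>j. \<sigma> $ j"]) (auto simp: signs_def)
  qed (auto simp: signs_def PiE_def Pi_def)
  have fin: "finite ((UNIV :: 'n set) \<rightarrow>\<^sub>E {- 1, 1 :: real})" by (intro finite_PiE) auto
  then show "finite (signs :: (real ^ 'n) set)" unfolding eq by (rule finite_imageI)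
  have "card (signs :: (real ^ 'n) set) \<le> card ((UNIV :: 'n set) \<rightarrow>\<^sub>E {- 1, 1 :: real})"
    unfolding eq by (rule card_image_le[OF fin])
  then show "card (signs :: (real ^ 'n) set) \<le> 2 ^ CARD('n)" by (simp add: card_PiE numeral_2_eq_2)
qed

text \<open>
  A cube of twice the size is covered by \<open>2\<^sup>n\<close> cubes of the original size. This is how an estimate that
  loses a neighbourhood of the cube is closed.
\<close>

lemma lattice_cube_double: "lattice_cube h (2 * r) y \<subseteq> (\<Union>\<sigma>\<in>signs. lattice_cube h r (y + r *\<^sub>R \<sigma>))"
proof
  fix k assume k: "k \<in> lattice_cube h (2 * r) y"
  define \<sigma> :: "real ^ 'a" where "\<sigma> = (\<chi> j. if y $ j \<le> h * of_int (k j) then 1 else - 1)"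
  have "\<bar>h * of_int (k j) - (y + r *\<^sub>R \<sigma>) $ j\<bar> \<le> r" for j
  proof -
    have "\<bar>h * of_int (k j) - y $ j\<bar> \<le> 2 * r" using k by (simp add: lattice_cube_def)
    then show ?thesis by (auto simp: \<sigma>_def)
  qed
  then have "k \<in> lattice_cube h r (y + r *\<^sub>R \<sigma>)" by (simp add: lattice_cube_def)
  moreover have "\<sigma> \<in> signs" by (simp add: signs_def \<sigma>_def)
  ultimately show "k \<in> (\<Union>\<sigma>\<in>signs. lattice_cube h r (y + r *\<^sub>R \<sigma>))" by blast
qed

lemma sum_UN_le:
  fixes f :: "'a \<Rightarrow> real"
  assumes "finite I" "\<And>i. i \<in> I \<Longrightarrow> finite (A i)" "\<And>k. 0 \<le> f k"
  shows "(\<Sum>k\<in>(\<Union>i\<in>I. A i). f k) \<le> (\<Sum>i\<in>I. \<Sum>k\<in>A i. f k)"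
  using assms(1,2)
proof (induction I rule: finite_induct)
  case (insert i I)
  have "(\<Sum>k\<in>A i \<union> (\<Union>i\<in>I. A i). f k) + (\<Sum>k\<in>A i \<inter> (\<Union>i\<in>I. A i). f k)
      = (\<Sum>k\<in>A i. f k) + (\<Sum>k\<in>(\<Union>i\<in>I. A i). f k)"
    using insert by (intro sum.union_inter) auto
  moreover have "0 \<le> (\<Sum>k\<in>A i \<inter> (\<Union>i\<in>I. A i). f k)" using assms(3) by (rule sum_nonneg)
  ultimately show ?case using insert by simp
qed simp

lemma sum_lattice_cube_double:
  assumes "0 < h" "\<And>k. 0 \<le> (f k :: real)"
  shows "(\<Sum>k\<in>lattice_cube h (2 * r) y. f k) \<le> (\<Sum>\<sigma>\<in>signs. \<Sum>k\<in>lattice_cube h r (y + r *\<^sub>R \<sigma>). f k)"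
proof -
  have "(\<Sum>k\<in>lattice_cube h (2 * r) y. f k) \<le> (\<Sum>k\<in>(\<Union>\<sigma>\<in>signs. lattice_cube h r (y + r *\<^sub>R \<sigma>)). f k)"
    using assms by (intro sum_mono2 lattice_cube_double finite_UN_I signs finite_lattice_cube) auto
  also have "\<dots> \<le> (\<Sum>\<sigma>\<in>signs. \<Sum>k\<in>lattice_cube h r (y + r *\<^sub>R \<sigma>). f k)"
    using assms by (intro sum_UN_le signs finite_lattice_cube)
  finally show ?thesis .
qed

text \<open>
  If \<open>E\<close> is controlled at each centre by a small multiple of its values at \<open>2\<^sup>n\<close> neighbouring centres,
  then taking the supremum over all centres absorbs them. The a priori bound \<open>M\<close> only guarantees
  that the supremum is finite.
\<close>

lemma absorb_translates:
  fixes E :: "real ^ 'n::finite \<Rightarrow> real"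
  assumes bdd: "\<And>y. E y \<le> M" and nonneg: "\<And>y. 0 \<le> E y" and "0 \<le> \<theta>" "\<theta> * 2 ^ CARD('n) \<le> 1 / 2"
    and step: "\<And>y. E y \<le> B + \<theta> * (\<Sum>\<sigma>\<in>signs. E (y + r *\<^sub>R \<sigma>))"
  shows "E y \<le> 2 * B"
proof -
  define S where "S = (SUP y. E y)"
  have bdd': "bdd_above (range E)" using bdd by (rule bdd_aboveI2)
  have E_le: "E y \<le> S" for y unfolding S_def by (rule cSUP_upper[OF _ bdd']) auto
  have "0 \<le> S" using nonneg[of 0] E_le[of 0] by linarith
  have "E y \<le> B + S / 2" for y
  proof -
    have "(\<Sum>\<sigma>\<in>signs. E (y + r *\<^sub>R \<sigma>)) \<le> (\<Sum>\<sigma>\<in>(signs :: (real ^ 'n) set). S)"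
      by (intro sum_mono E_le)
    also have "\<dots> = real (card (signs :: (real ^ 'n) set)) * S" by simp
    also have "\<dots> \<le> 2 ^ CARD('n) * S"
    proof (rule mult_right_mono[OF _ \<open>0 \<le> S\<close>])
      have "real (card (signs :: (real ^ 'n) set)) \<le> real (2 ^ CARD('n))"
        using signs(2)[where 'n = 'n] by (simp only: of_nat_le_iff)
      then show "real (card (signs :: (real ^ 'n) set)) \<le> 2 ^ CARD('n)" by simp
    qed
    finally have "\<theta> * (\<Sum>\<sigma>\<in>signs. E (y + r *\<^sub>R \<sigma>)) \<le> \<theta> * 2 ^ CARD('n) * S"
      using \<open>0 \<le> \<theta>\<close> by (simp add: mult_left_mono mult.assoc)
    also have "\<dots> \<le> 1 / 2 * S" using assms(4) \<open>0 \<le> S\<close> by (rule mult_right_mono)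
    finally show ?thesis using step[of y] by simp
  qed
  then have "S \<le> B + S / 2" unfolding S_def by (intro cSUP_least) auto
  then show ?thesis using E_le[of y] by simp
qed

section \<open>Localization of a jet\<close>

text \<open>
  These are the multi-indices of order at most \<open>2b\<close>, each one as its list of directions.
\<close>

definition idx :: "nat \<Rightarrow> 'n::{finite,linorder} list set" where
  "idx b = {l. sorted l \<and> length l \<le> 2 * b}"

lemma finite_idx: "finite (idx b :: 'n::{finite,linorder} list set)"
  by (rule finite_subset[OF _ finite_short_lists[of "2 * b"]]) (auto simp: idx_def short_lists_def)

lemma Nil_idx [simp]: "[] \<in> idx b"
  by (simp add: idx_def)

lemma index_list_idx: "mi_order \<beta> \<le> 2 * b \<Longrightarrow> index_list \<beta> \<in> idx b"
  by (simp add: idx_def sorted_index_list)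

lemma idx_tail: "p @ l \<in> idx b \<Longrightarrow> l \<in> idx b"
  by (auto simp: idx_def sorted_append)

lemma splits_idx: "(p, q) \<in> set (splits l) \<Longrightarrow> l \<in> idx b \<Longrightarrow> p \<in> idx b \<and> q \<in> idx b"
  using splits_length[of p q l] splits_sorted[of p q l] by (auto simp: idx_def)

lemma splits_Cons_idx: "(p, q) \<in> set (splits l) \<Longrightarrow> j # l \<in> idx b \<Longrightarrow> j # q \<in> idx b"
  using splits_length[of p q l] splits_sorted[of p q l] splits_set[of p q l] by (auto simp: idx_def)

lemma length_splits: "length (splits l) = 2 ^ length l"
  by (induction l) auto

text \<open>
  A family of functions that behaves like the derivatives of order at most \<open>2b\<close> of one function
  \<open>V []\<close>, bounded by \<open>B\<close> and uniformly continuous.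
\<close>

definition jet :: "nat \<Rightarrow> ('n::{finite,linorder} list \<Rightarrow> real ^ 'n::{finite,linorder} \<Rightarrow> complex ^ 'm::finite) \<Rightarrow> real \<Rightarrow> bool" where
  "jet b V B \<longleftrightarrow> (\<forall>j l. j # l \<in> idx b \<longrightarrow> dir_deriv j (V l) (V (j # l))) \<and>
     (\<forall>l\<in>idx b. \<forall>x. norm (V l x) \<le> B) \<and>
     (\<forall>e>0. \<forall>\<^sub>F d in at_right 0. \<forall>l\<in>idx b. \<forall>x x'. norm (x - x') \<le> d \<longrightarrow> norm (V l x - V l x') \<le> e)"

text \<open>
  The operator \<open>A\<close> at the point \<open>x\<close>, as a function of the family \<open>D\<close> of derivatives at \<open>x\<close>.
\<close>

definition full_op :: "nat \<Rightarrow> ('n::{finite,linorder}, 'm::finite) coeffs \<Rightarrow> real ^ 'n::{finite,linorder} \<Rightarrow>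
    ('n list \<Rightarrow> complex ^ 'm) \<Rightarrow> complex ^ 'm" where
  "full_op b a x D = (\<Sum>\<beta> | mi_order \<beta> \<le> 2 * b. a \<beta> x *v ((1 / \<i>) ^ mi_order \<beta> *s D (index_list \<beta>)))"

text \<open>
  The weights make all terms comparable to \<open>\<lambda> V []\<close> with \<open>\<lambda> = \<mu>^(2b)\<close>; the highest order terms have
  weight \<open>1\<close>.
\<close>

definition energy :: "nat \<Rightarrow> real \<Rightarrow> ('n::{finite,linorder} list \<Rightarrow> real ^ 'n::{finite,linorder} \<Rightarrow> complex ^ 'm::finite) \<Rightarrow> real ^ 'n::{finite,linorder} \<Rightarrow> real" where
  "energy b \<mu> V x = (\<Sum>l\<in>idx b. (\<mu> ^ (2 * b - length l) * norm (V l x))\<^sup>2)"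

lemma energy_nonneg: "0 \<le> energy b \<mu> V x"
  by (simp add: energy_def sum_nonneg)

lemma term_le_energy:
  fixes V :: "'n::{finite,linorder} list \<Rightarrow> real ^ 'n::{finite,linorder} \<Rightarrow> complex ^ 'm::finite"
  assumes "l \<in> idx b" "0 \<le> \<mu>"
  shows "\<mu> ^ (2 * b - length l) * norm (V l x) \<le> sqrt (energy b \<mu> V x)"
proof (rule real_le_rsqrt)
  show "(\<mu> ^ (2 * b - length l) * norm (V l x))\<^sup>2 \<le> energy b \<mu> V x"
    unfolding energy_def using assms by (intro member_le_sum finite_idx) auto
qed

text \<open>
  A derivative of order below \<open>k\<close> that appears with the weight of order \<open>k\<close> gains a factor \<open>1/\<mu>\<close>. All lower
  order terms and all commutators with the cut-off are made small in this way.
\<close>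

lemma lower_term_le_energy:
  fixes V :: "'n::{finite,linorder} list \<Rightarrow> real ^ 'n::{finite,linorder} \<Rightarrow> complex ^ 'm::finite"
  assumes "q \<in> idx b" "length q < k" "k \<le> 2 * b" "1 \<le> \<mu>"
  shows "\<mu> ^ (2 * b - k) * norm (V q x) \<le> sqrt (energy b \<mu> V x) / \<mu>"
proof -
  have "\<mu> * (\<mu> ^ (2 * b - k) * norm (V q x)) = \<mu> ^ Suc (2 * b - k) * norm (V q x)"
    by simp
  also have "\<dots> \<le> \<mu> ^ (2 * b - length q) * norm (V q x)"
    using assms by (intro mult_right_mono power_increasing) auto
  also have "\<dots> \<le> sqrt (energy b \<mu> V x)"
    using assms by (intro term_le_energy) auto
  finally show ?thesis using assms by (simp add: field_simps)
qed

text \<open>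
  The derivatives of the product of the cut-off centred at \<open>y\<close> with \<open>V []\<close>, as given by the Leibniz rule.
\<close>

definition localized :: "real \<Rightarrow> nat \<Rightarrow> real ^ 'n::{finite,linorder} \<Rightarrow> ('n list \<Rightarrow> real ^ 'n::{finite,linorder} \<Rightarrow> complex ^ 'm::finite) \<Rightarrow> 'n list \<Rightarrow> real ^ 'n::{finite,linorder} \<Rightarrow> complex ^ 'm" where
  "localized r m y V = leibniz_sum (\<lambda>p x. cutoff r m p (x - y)) V"

lemma localized_Nil: "localized r m y V [] x = cutoff r m [] (x - y) *\<^sub>R V [] x"
  by (simp add: localized_def leibniz_sum_def)

lemma dir_deriv_translate: "dir_deriv j f f' \<Longrightarrow> dir_deriv j (\<lambda>x. f (x - y)) (\<lambda>x. f' (x - y))"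
  unfolding dir_deriv_def
proof
  fix x assume "\<forall>x. ((\<lambda>s. f (x + s *\<^sub>R axis j 1)) has_vector_derivative f' x) (at 0)"
  then have "((\<lambda>s. f ((x - y) + s *\<^sub>R axis j 1)) has_vector_derivative f' (x - y)) (at 0)" by blast
  then show "((\<lambda>s. f (x + s *\<^sub>R axis j 1 - y)) has_vector_derivative f' (x - y)) (at 0)"
    by (simp add: algebra_simps)
qed

lemma dir_deriv_localized:
  assumes "jet b V B" "j # l \<in> idx b" "2 * b + 2 \<le> m"
  shows "dir_deriv j (localized r m y V l) (localized r m y V (j # l))"
  unfolding localized_def
proof (rule dir_deriv_leibniz_sum)
  fix p :: "'a list" assume "length p \<le> length l"
  then show "dir_deriv j (\<lambda>x. cutoff r m p (x - y)) (\<lambda>x. cutoff r m (j # p) (x - y))"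
    using assms by (intro dir_deriv_translate dir_deriv_cutoff) (auto simp: idx_def)
next
  fix p q assume "(p, q) \<in> set (splits l)"
  then have "j # q \<in> idx b" using assms(2) by (rule splits_Cons_idx)
  then show "dir_deriv j (V q) (V (j # q))" using assms(1) unfolding jet_def by blast
qed

lemma localized_support:
  assumes "l \<in> idx b" "2 * b + 2 \<le> m" "0 < r" "3 / 2 * r \<le> \<bar>x $ j - y $ j\<bar>"
  shows "localized r m y V l x = 0"
proof -
  have "cutoff r m p (x - y) = 0" if "(p, q) \<in> set (splits l)" for p q
    using splits_length[OF that] assms by (intro cutoff_support[of _ _ _ _ j]) (auto simp: idx_def)
  then have "(\<lambda>(p, q). cutoff r m p (x - y) *\<^sub>R V q x) a = 0" if "a \<in> set (splits l)" for a
    using that by (cases a) auto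
  then show ?thesis unfolding localized_def leibniz_sum_def
    by (simp add: sum_list_0 cong: map_cong)
qed

lemma norm_sum_list_le:
  assumes "\<And>a. a \<in> set as \<Longrightarrow> norm (f a) \<le> c"
  shows "norm (\<Sum>a\<leftarrow>as. f a) \<le> real (length as) * c"
  using assms
proof (induction as)
  case (Cons a as)
  have "norm (f a + (\<Sum>a\<leftarrow>as. f a)) \<le> c + real (length as) * c"
    using Cons by (intro norm_triangle_le add_mono) auto
  then show ?case by (simp add: algebra_simps)
qed simp

text \<open>
  The commutator of the derivative with the cut-off. The factor \<open>4\<^sup>b\<close> bounds the number of splits, and
  \<open>C\<close>, which depends on \<open>r\<close>, the derivatives of the cut-off; both are compensated by \<open>1/\<mu>\<close>.
\<close>

lemma localized_leading:
  fixes V :: "'n::{finite,linorder} list \<Rightarrow> real ^ 'n::{finite,linorder} \<Rightarrow> complex ^ 'm::finite"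
  assumes l: "l \<in> idx b" and "1 \<le> \<mu>" and C: "\<And>p x. length p \<le> 2 * b \<Longrightarrow> \<bar>cutoff r m p (x :: real ^ 'n::{finite,linorder})\<bar> \<le> C" "0 \<le> C"
  shows "\<mu> ^ (2 * b - length l) * norm (localized r m y V l x - cutoff r m [] (x - y) *\<^sub>R V l x)
    \<le> 4 ^ b * C * (sqrt (energy b \<mu> V x) / \<mu>)"
proof -
  obtain xs where xs: "splits l = xs @ [([], l)]" "\<forall>(p, q)\<in>set xs. length q < length l"
    using splits_last by blast
  have len: "length l \<le> 2 * b" using l by (simp add: idx_def)
  have "norm ((\<lambda>(p, q). \<mu> ^ (2 * b - length l) *\<^sub>R (cutoff r m p (x - y) *\<^sub>R V q x)) a) \<le> C * (sqrt (energy b \<mu> V x) / \<mu>)"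
    if "a \<in> set xs" for a
  proof -
    obtain p q where a: "a = (p, q)" by (cases a)
    then have pq: "(p, q) \<in> set (splits l)" using that xs by simp
    have "length q < length l" using xs(2) that a by auto
    then have q: "\<mu> ^ (2 * b - length l) * norm (V q x) \<le> sqrt (energy b \<mu> V x) / \<mu>"
      using splits_idx[OF pq l] len assms by (intro lower_term_le_energy) auto
    have "length p \<le> 2 * b" using splits_length[OF pq] len by simp
    then have "\<bar>cutoff r m p (x - y)\<bar> * (\<mu> ^ (2 * b - length l) * norm (V q x)) \<le> C * (sqrt (energy b \<mu> V x) / \<mu>)"
      using \<open>1 \<le> \<mu>\<close> C(2) by (intro mult_mono C q) auto
    then show ?thesis using a \<open>1 \<le> \<mu>\<close> by (simp add: mult_ac abs_mult)
  qed
  then have "norm (\<Sum>(p, q)\<leftarrow>xs. \<mu> ^ (2 * b - length l) *\<^sub>R (cutoff r m p (x - y) *\<^sub>R V q x))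
      \<le> real (length xs) * (C * (sqrt (energy b \<mu> V x) / \<mu>))"
    by (rule norm_sum_list_le)
  also have "\<dots> \<le> 4 ^ b * (C * (sqrt (energy b \<mu> V x) / \<mu>))"
  proof (rule mult_right_mono)
    have "length xs + 1 = 2 ^ length l" using length_splits[of l] xs by simp
    moreover have "(2 :: nat) ^ length l \<le> 2 ^ (2 * b)" using len by (intro power_increasing) auto
    ultimately have "length xs \<le> 4 ^ b" by (simp add: power_mult)
    then have "real (length xs) \<le> real (4 ^ b)" by (simp only: of_nat_le_iff)
    then show "real (length xs) \<le> 4 ^ b" by simp
    show "0 \<le> C * (sqrt (energy b \<mu> V x) / \<mu>)"
      using C(2) \<open>1 \<le> \<mu>\<close> energy_nonneg[of b \<mu> V x] by simp
  qed
  also have "(\<Sum>(p, q)\<leftarrow>xs. \<mu> ^ (2 * b - length l) *\<^sub>R (cutoff r m p (x - y) *\<^sub>R V q x))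
      = \<mu> ^ (2 * b - length l) *\<^sub>R (localized r m y V l x - cutoff r m [] (x - y) *\<^sub>R V l x)"
  proof -
    have "(\<Sum>(p, q)\<leftarrow>as. c *\<^sub>R (cutoff r m p (x - y) *\<^sub>R V q x)) = c *\<^sub>R (\<Sum>(p, q)\<leftarrow>as. cutoff r m p (x - y) *\<^sub>R V q x)" for as c
      by (induction as) (auto simp: scaleR_add_right)
    then show ?thesis by (simp add: localized_def leibniz_sum_def xs(1))
  qed
  finally show ?thesis using \<open>1 \<le> \<mu>\<close> by (simp add: mult_ac)
qed

text \<open>
  The modulus is uniform in the centre \<open>y\<close>, because the cut-offs are translates of one function.
  Therefore one mesh width \<open>h\<close> serves for all cubes.
\<close>

lemma localized_modulus:
  fixes V :: "'n::{finite,linorder} list \<Rightarrow> real ^ 'n::{finite,linorder} \<Rightarrow> complex ^ 'm::finite"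
  assumes jet: "jet b V B" and m: "2 * b + 2 \<le> m" and "0 < r" "0 < e"
  shows "\<exists>d>0. \<forall>l\<in>idx b. \<forall>y x x'. norm (x - x') \<le> d \<longrightarrow> norm (localized r m y V l x - localized r m y V l x') \<le> e"
proof -
  obtain C where C: "0 \<le> C" "\<And>p x. length p \<le> 2 * b \<Longrightarrow> \<bar>cutoff r m p (x :: real ^ 'n::{finite,linorder})\<bar> \<le> C"
    using cutoff_bounds[of r "2 * b" m] assms by auto
  have B: "0 \<le> B" "\<And>l x. l \<in> idx b \<Longrightarrow> norm (V l x) \<le> B"
    using jet Nil_idx norm_ge_zero order_trans unfolding jet_def by blast+
  \<comment> \<open>There are at most \<open>4\<^sup>b\<close> splits, and each product varies by at most \<open>e' (B + C)\<close>.\<close>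
  define e' where "e' = e / (4 ^ b * (B + C + 1))"
  have e': "0 < e'" "4 ^ b * (e' * B + C * e') \<le> e"
  proof -
    show "0 < e'" using B C \<open>0 < e\<close> by (simp add: e'_def add_nonneg_pos)
    have "e' * B + C * e' \<le> e' * (B + C + 1)" using \<open>0 < e'\<close> by (simp add: algebra_simps)
    then have "4 ^ b * (e' * B + C * e') \<le> 4 ^ b * (e' * (B + C + 1))" by simp
    also have "\<dots> = e" using B C by (simp add: e'_def add_nonneg_pos)
    finally show "4 ^ b * (e' * B + C * e') \<le> e" .
  qed
  have "\<forall>\<^sub>F d in at_right 0. \<forall>p\<in>short_lists (2 * b). \<forall>x x' :: real ^ 'n::{finite,linorder}. norm (x - x') \<le> d \<longrightarrow> \<bar>cutoff r m p x - cutoff r m p x'\<bar> \<le> e'"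
    using cutoff_modulus[of r "2 * b" m e'] assms e' by simp
  moreover have "\<forall>\<^sub>F d in at_right 0. \<forall>l\<in>idx b. \<forall>x x'. norm (x - x') \<le> d \<longrightarrow> norm (V l x - V l x') \<le> e'"
    using jet e' unfolding jet_def by blast
  ultimately have "\<forall>\<^sub>F d in at_right (0 :: real).
     (\<forall>p\<in>short_lists (2 * b). \<forall>x x' :: real ^ 'n::{finite,linorder}. norm (x - x') \<le> d \<longrightarrow> \<bar>cutoff r m p x - cutoff r m p x'\<bar> \<le> e') \<and>
     (\<forall>l\<in>idx b. \<forall>x x'. norm (x - x') \<le> d \<longrightarrow> norm (V l x - V l x') \<le> e')"
    by (rule eventually_conj)
  from at_right_0_witness[OF this] obtain d where d: "0 < d"
    and c: "\<And>p x x'. length p \<le> 2 * b \<Longrightarrow> norm (x - x') \<le> d \<Longrightarrow> \<bar>cutoff r m p x - cutoff r m p (x' :: real ^ 'n::{finite,linorder})\<bar> \<le> e'"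
    and v: "\<And>l x x'. l \<in> idx b \<Longrightarrow> norm (x - x') \<le> d \<Longrightarrow> norm (V l x - V l x') \<le> e'"
    unfolding short_lists_def by blast
  have "norm (localized r m y V l x - localized r m y V l x') \<le> e" if l: "l \<in> idx b" and xx: "norm (x - x') \<le> d" for l y x x'
  proof -
    have diff: "localized r m y V l x - localized r m y V l x'
        = (\<Sum>a\<leftarrow>splits l. (\<lambda>(p, q). cutoff r m p (x - y) *\<^sub>R V q x - cutoff r m p (x' - y) *\<^sub>R V q x') a)"
    proof -
      have "(\<Sum>(p, q)\<leftarrow>as. cutoff r m p (x - y) *\<^sub>R V q x) - (\<Sum>(p, q)\<leftarrow>as. cutoff r m p (x' - y) *\<^sub>R V q x')
        = (\<Sum>a\<leftarrow>as. (\<lambda>(p, q). cutoff r m p (x - y) *\<^sub>R V q x - cutoff r m p (x' - y) *\<^sub>R V q x') a)" for as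
        by (induction as) (auto simp: algebra_simps)
      then show ?thesis by (simp add: localized_def leibniz_sum_def)
    qed
    have "norm ((\<lambda>(p, q). cutoff r m p (x - y) *\<^sub>R V q x - cutoff r m p (x' - y) *\<^sub>R V q x') a) \<le> e' * B + C * e'"
      if a_in: "a \<in> set (splits l)" for a
    proof -
      obtain p q where a: "a = (p, q)" by (cases a)
      have pq: "length p \<le> 2 * b" "q \<in> idx b"
        using splits_length[of p q l] splits_idx[of p q l b] a a_in l by (auto simp: idx_def)
      have "norm ((cutoff r m p (x - y) - cutoff r m p (x' - y)) *\<^sub>R V q x + cutoff r m p (x' - y) *\<^sub>R (V q x - V q x')) \<le> e' * B + C * e'"
        using pq xx e' C(1)
        by (intro norm_triangle_le add_mono) (auto simp: intro!: mult_mono c v B C)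
      then show ?thesis by (simp add: a algebra_simps)
    qed
    then have "norm (\<Sum>a\<leftarrow>splits l. (\<lambda>(p, q). cutoff r m p (x - y) *\<^sub>R V q x - cutoff r m p (x' - y) *\<^sub>R V q x') a)
       \<le> real (length (splits l)) * (e' * B + C * e')"
      by (rule norm_sum_list_le)
    also have "\<dots> \<le> 4 ^ b * (e' * B + C * e')"
    proof (rule mult_right_mono)
      have "(2 :: real) ^ length l \<le> 2 ^ (2 * b)" using l by (intro power_increasing) (auto simp: idx_def)
      then show "real (length (splits l)) \<le> 4 ^ b" by (simp add: length_splits power_mult)
    qed (use e' B C in auto)
    also have "\<dots> \<le> e" by (rule e')
    finally show ?thesis unfolding diff .
  qed
  then show ?thesis using d by blast
qed

section \<open>Freezing the coefficients\<close>

definition coeff_term :: "complex ^ 'm::finite ^ 'm \<Rightarrow> nat \<Rightarrow> complex ^ 'm \<Rightarrow> complex ^ 'm" where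
  "coeff_term A k z = A *v ((1 / \<i>) ^ k *s z)"

lemma coeff_term_diff_right: "coeff_term A k (z - w) = coeff_term A k z - coeff_term A k w"
  by (simp add: coeff_term_def vec.scale_right_diff_distrib matrix_vector_mult_diff_distrib)

lemma coeff_term_diff_left: "coeff_term (A - B) k z = coeff_term A k z - coeff_term B k z"
  by (simp add: coeff_term_def matrix_vector_mult_diff_rdistrib)

lemma coeff_term_scaleR: "coeff_term A k (c *\<^sub>R z) = c *\<^sub>R coeff_term A k z"
  unfolding coeff_term_def scaleR_eq_smult vector_scalar_commute[symmetric] vector_smult_assoc by (simp add: mult.commute)

lemma norm_coeff_term_le:
  fixes A :: "complex ^ 'm::finite ^ 'm"
  assumes "\<And>i j. cmod (A $ i $ j) \<le> c"
  shows "norm (coeff_term A k z) \<le> (real CARD('m))\<^sup>2 * c * norm z"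
proof -
  have "norm ((1 / \<i>) ^ k *s z) = norm z"
    by (simp add: norm_vector_scalar_mult norm_power norm_divide)
  then show ?thesis using norm_matrix_vector_le[of A c, OF assms] unfolding coeff_term_def by metis
qed

lemma norm_sum_const_le:
  assumes "finite A" "A \<subseteq> A'" "finite A'" "\<And>x. x \<in> A \<Longrightarrow> norm (f x) \<le> c" "0 \<le> c"
  shows "norm (\<Sum>x\<in>A. f x) \<le> real (card A') * c"
proof -
  have "norm (\<Sum>x\<in>A. f x) \<le> (\<Sum>x\<in>A. c)" using assms(4) by (rule sum_norm_le)
  also have "\<dots> = real (card A) * c" by simp
  also have "\<dots> \<le> real (card A') * c" using assms card_mono[of A' A] by (intro mult_right_mono) auto
  finally show ?thesis .
qed

lemma frozen_op_coeff_term: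
  "frozen_op b a y L D = L *\<^sub>R D [] - (\<Sum>\<beta> | mi_order \<beta> = 2 * b. coeff_term (a \<beta> y) (2 * b) (D (index_list \<beta>)))"
  by (simp add: frozen_op_def coeff_term_def)

text \<open>
  The frozen operator applied to a localized function \<open>W\<close>, compared with the true operator applied to
  \<open>D\<close>: the second term is the equation, the third the lower order terms, the fourth the oscillation of
  the coefficients, the last the commutators with the cut-off.
\<close>

lemma frozen_op_localized:
  fixes a :: "('n::{finite,linorder}, 'm::finite) coeffs"
  shows "frozen_op b a y L W = L *\<^sub>R (W [] - c *\<^sub>R D []) + c *\<^sub>R (L *\<^sub>R D [] - full_op b a x D)
    + c *\<^sub>R (\<Sum>\<beta> | mi_order \<beta> < 2 * b. coeff_term (a \<beta> x) (mi_order \<beta>) (D (index_list \<beta>)))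
    + c *\<^sub>R (\<Sum>\<beta> | mi_order \<beta> = 2 * b. coeff_term (a \<beta> x - a \<beta> y) (2 * b) (D (index_list \<beta>)))
    - (\<Sum>\<beta> | mi_order \<beta> = 2 * b. coeff_term (a \<beta> y) (2 * b) (W (index_list \<beta>) - c *\<^sub>R D (index_list \<beta>)))"
proof -
  have "{\<beta> :: 'n \<Rightarrow> nat. mi_order \<beta> \<le> 2 * b} = {\<beta>. mi_order \<beta> < 2 * b} \<union> {\<beta>. mi_order \<beta> = 2 * b}" by auto
  moreover have "finite {\<beta> :: 'n \<Rightarrow> nat. mi_order \<beta> < 2 * b}" "finite {\<beta> :: 'n \<Rightarrow> nat. mi_order \<beta> = 2 * b}"
    by (rule finite_subset[OF _ finite_mi_order_le[of "2 * b"]], auto)+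
  ultimately have "full_op b a x D = (\<Sum>\<beta> | mi_order \<beta> < 2 * b. coeff_term (a \<beta> x) (mi_order \<beta>) (D (index_list \<beta>)))
      + (\<Sum>\<beta> | mi_order \<beta> = 2 * b. coeff_term (a \<beta> x) (mi_order \<beta>) (D (index_list \<beta>)))"
    unfolding full_op_def coeff_term_def[symmetric] by (simp only: sum.union_disjoint) (subst sum.union_disjoint, auto)
  then have full: "full_op b a x D = (\<Sum>\<beta> | mi_order \<beta> < 2 * b. coeff_term (a \<beta> x) (mi_order \<beta>) (D (index_list \<beta>)))
      + (\<Sum>\<beta> | mi_order \<beta> = 2 * b. coeff_term (a \<beta> x) (2 * b) (D (index_list \<beta>)))" by simp
  show ?thesis
    unfolding full frozen_op_coeff_term coeff_term_diff_right coeff_term_diff_left coeff_term_scaleR sum_subtractf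
      scaleR_sum_right[symmetric]
    by (simp add: algebra_simps)
qed

text \<open>
  The coefficients enter through an upper bound, a modulus of continuity and the
  parabolicity constant only.
\<close>

locale parabolic_operator =
  fixes b :: nat and a :: "('n::{finite,linorder}, 'm::finite) coeffs" and \<delta> A :: real
  assumes b: "1 \<le> b" and \<delta>: "0 < \<delta>" and A: "0 \<le> A"
    and par: "\<And>x \<eta> z. Re (cinner (symbol_A0 b a x \<eta> *v z) z) \<le> - \<delta> * norm \<eta> ^ (2 * b) * (norm z)\<^sup>2"
    and coeff_le: "\<And>\<beta> x i j. mi_order \<beta> \<le> 2 * b \<Longrightarrow> cmod (a \<beta> x $ i $ j) \<le> A"
    and coeff_modulus: "\<And>e. 0 < e \<Longrightarrow> \<exists>d>0. \<forall>\<beta> i j x x'. mi_order \<beta> \<le> 2 * b \<longrightarrow> norm (x - x') \<le> d \<longrightarrow>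
      cmod (a \<beta> x $ i $ j - a \<beta> x' $ i $ j) \<le> e"
begin

text \<open>
  These constants are independent of the radius \<open>r\<close> of the cut-off. The constants that do depend on
  \<open>r\<close> are always accompanied by a power of \<open>1/\<mu>\<close>.
\<close>

definition n_ord :: real where "n_ord = real (card {\<beta> :: 'n \<Rightarrow> nat. mi_order \<beta> \<le> 2 * b})"
definition n_mat :: real where "n_mat = (real CARD('m))\<^sup>2"
definition n_idx :: real where "n_idx = real (card (idx b :: 'n list set))"
definition cut_max :: real where "cut_max = (2 ^ (2 * b + 2)) ^ CARD('n)"
definition c_ell :: real where "c_ell = max 1 (1 / \<delta>)"

lemma consts_nonneg: "0 \<le> n_ord" "0 \<le> n_mat" "0 \<le> n_idx" "0 \<le> cut_max" "0 \<le> c_ell"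
  by (auto simp: n_ord_def n_mat_def n_idx_def cut_max_def c_ell_def)

text \<open>
  Each term of \<open>frozen_op_localized\<close> is measured by the energy: the oscillation of the leading
  coefficients comes with \<open>\<omega>\<close>, all lower order contributions with \<open>1/\<mu>\<close>.
\<close>

lemma frozen_localized_le:
  assumes "1 \<le> \<mu>" and G: "norm (\<mu> ^ (2 * b) *\<^sub>R V [] x - full_op b a x (\<lambda>l. V l x)) \<le> G"
    and C: "\<And>p x. length p \<le> 2 * b \<Longrightarrow> \<bar>cutoff r (2 * b + 2) p (x :: real ^ 'n::{finite,linorder})\<bar> \<le> C" "0 \<le> C"
    and \<omega>: "\<And>\<beta> i j. mi_order \<beta> = 2 * b \<Longrightarrow> cmod (a \<beta> x $ i $ j - a \<beta> y $ i $ j) \<le> \<omega>" "0 \<le> \<omega>"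
  shows "norm (frozen_op b a y (\<mu> ^ (2 * b)) (\<lambda>l. localized r (2 * b + 2) y V l x))
    \<le> cut_max * G + cut_max * n_ord * n_mat * \<omega> * sqrt (energy b \<mu> V x)
       + n_ord * n_mat * A * (cut_max + 4 ^ b * C) * (sqrt (energy b \<mu> V x) / \<mu>)"
proof -
  define c where "c = cutoff r (2 * b + 2) [] (x - y)"
  define s where "s = sqrt (energy b \<mu> V x)"
  define W where "W = (\<lambda>l. localized r (2 * b + 2) y V l x)"
  define ord where "ord = {\<beta> :: 'n \<Rightarrow> nat. mi_order \<beta> \<le> 2 * b}"
  have s: "0 \<le> s" by (simp add: s_def energy_nonneg)
  have c: "0 \<le> c" "c \<le> cut_max" unfolding c_def cut_max_def by (rule cutoff_range)+
  have fin: "finite ord" by (simp add: ord_def finite_mi_order_le)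
  have sub: "{\<beta>. mi_order \<beta> < 2 * b} \<subseteq> ord" "{\<beta>. mi_order \<beta> = 2 * b} \<subseteq> ord" by (auto simp: ord_def)
  note fin' = finite_subset[OF sub(1) fin] finite_subset[OF sub(2) fin]
  have n_mat_le: "norm (coeff_term M k z) \<le> n_mat * d * norm z" if "\<And>i j. cmod (M $ i $ j) \<le> d" for M :: "complex ^ 'm ^ 'm" and k z d
    unfolding n_mat_def by (rule norm_coeff_term_le[OF that])
  have scale: "norm (c *\<^sub>R z) \<le> cut_max * t" if "norm z \<le> t" for z :: "complex ^ 'm" and t
    unfolding norm_scaleR using c that by (intro mult_mono) auto
  have 1: "norm (c *\<^sub>R (\<mu> ^ (2 * b) *\<^sub>R V [] x - full_op b a x (\<lambda>l. V l x))) \<le> cut_max * G"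
    by (rule scale[OF G])
  have "norm (\<Sum>\<beta> | mi_order \<beta> < 2 * b. coeff_term (a \<beta> x) (mi_order \<beta>) (V (index_list \<beta>) x)) \<le> n_ord * (n_mat * A * (s / \<mu>))"
    unfolding n_ord_def ord_def[symmetric]
  proof (rule norm_sum_const_le[OF fin'(1) sub(1) fin])
    fix \<beta> :: "'n \<Rightarrow> nat" assume "\<beta> \<in> {\<beta>. mi_order \<beta> < 2 * b}"
    then have \<beta>: "mi_order \<beta> < 2 * b" by simp
    have "\<mu> ^ (2 * b - 2 * b) * norm (V (index_list \<beta>) x) \<le> s / \<mu>"
      unfolding s_def using \<beta> \<open>1 \<le> \<mu>\<close> by (intro lower_term_le_energy index_list_idx) auto
    then have "n_mat * A * norm (V (index_list \<beta>) x) \<le> n_mat * A * (s / \<mu>)"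
      using A consts_nonneg by (intro mult_left_mono) auto
    moreover have "norm (coeff_term (a \<beta> x) (mi_order \<beta>) (V (index_list \<beta>) x)) \<le> n_mat * A * norm (V (index_list \<beta>) x)"
      using \<beta> by (intro n_mat_le coeff_le) auto
    ultimately show "norm (coeff_term (a \<beta> x) (mi_order \<beta>) (V (index_list \<beta>) x)) \<le> n_mat * A * (s / \<mu>)" by linarith
  qed (use A s \<open>1 \<le> \<mu>\<close> consts_nonneg in auto)
  then have 2: "norm (c *\<^sub>R (\<Sum>\<beta> | mi_order \<beta> < 2 * b. coeff_term (a \<beta> x) (mi_order \<beta>) (V (index_list \<beta>) x))) \<le> cut_max * (n_ord * (n_mat * A * (s / \<mu>)))"
    by (rule scale)
  have "norm (\<Sum>\<beta> | mi_order \<beta> = 2 * b. coeff_term (a \<beta> x - a \<beta> y) (2 * b) (V (index_list \<beta>) x)) \<le> n_ord * (n_mat * \<omega> * s)"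
    unfolding n_ord_def ord_def[symmetric]
  proof (rule norm_sum_const_le[OF fin'(2) sub(2) fin])
    fix \<beta> :: "'n \<Rightarrow> nat" assume "\<beta> \<in> {\<beta>. mi_order \<beta> = 2 * b}"
    then have \<beta>: "mi_order \<beta> = 2 * b" by simp
    have "\<mu> ^ (2 * b - length (index_list \<beta>)) * norm (V (index_list \<beta>) x) \<le> s"
      unfolding s_def using \<beta> \<open>1 \<le> \<mu>\<close> by (intro term_le_energy index_list_idx) auto
    then have "n_mat * \<omega> * norm (V (index_list \<beta>) x) \<le> n_mat * \<omega> * s"
      using \<beta> \<omega>(2) consts_nonneg by (intro mult_left_mono) auto
    moreover have "norm (coeff_term (a \<beta> x - a \<beta> y) (2 * b) (V (index_list \<beta>) x)) \<le> n_mat * \<omega> * norm (V (index_list \<beta>) x)"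
      using \<beta> \<omega>(1) by (intro n_mat_le) auto
    ultimately show "norm (coeff_term (a \<beta> x - a \<beta> y) (2 * b) (V (index_list \<beta>) x)) \<le> n_mat * \<omega> * s" by linarith
  qed (use \<omega>(2) s consts_nonneg in auto)
  then have 3: "norm (c *\<^sub>R (\<Sum>\<beta> | mi_order \<beta> = 2 * b. coeff_term (a \<beta> x - a \<beta> y) (2 * b) (V (index_list \<beta>) x))) \<le> cut_max * (n_ord * (n_mat * \<omega> * s))"
    by (rule scale)
  have 4: "norm (\<Sum>\<beta> | mi_order \<beta> = 2 * b. coeff_term (a \<beta> y) (2 * b) (W (index_list \<beta>) - c *\<^sub>R V (index_list \<beta>) x)) \<le> n_ord * (n_mat * A * (4 ^ b * C * (s / \<mu>)))"
    unfolding n_ord_def ord_def[symmetric]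
  proof (rule norm_sum_const_le[OF fin'(2) sub(2) fin])
    fix \<beta> :: "'n \<Rightarrow> nat" assume "\<beta> \<in> {\<beta>. mi_order \<beta> = 2 * b}"
    then have \<beta>: "mi_order \<beta> = 2 * b" by simp
    have "\<mu> ^ (2 * b - length (index_list \<beta>)) * norm (W (index_list \<beta>) - c *\<^sub>R V (index_list \<beta>) x) \<le> 4 ^ b * C * (s / \<mu>)"
      unfolding s_def W_def c_def using \<beta> \<open>1 \<le> \<mu>\<close> C by (intro localized_leading index_list_idx) auto
    then have "n_mat * A * norm (W (index_list \<beta>) - c *\<^sub>R V (index_list \<beta>) x) \<le> n_mat * A * (4 ^ b * C * (s / \<mu>))"
      using \<beta> A consts_nonneg by (intro mult_left_mono) auto
    moreover have "norm (coeff_term (a \<beta> y) (2 * b) (W (index_list \<beta>) - c *\<^sub>R V (index_list \<beta>) x)) \<le> n_mat * A * norm (W (index_list \<beta>) - c *\<^sub>R V (index_list \<beta>) x)"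
      using \<beta> by (intro n_mat_le coeff_le) auto
    ultimately show "norm (coeff_term (a \<beta> y) (2 * b) (W (index_list \<beta>) - c *\<^sub>R V (index_list \<beta>) x)) \<le> n_mat * A * (4 ^ b * C * (s / \<mu>))" by linarith
  qed (use A C s \<open>1 \<le> \<mu>\<close> consts_nonneg in auto)
  have W0: "W [] - c *\<^sub>R V [] x = 0" by (simp add: W_def c_def localized_Nil)
  have "frozen_op b a y (\<mu> ^ (2 * b)) W =
      c *\<^sub>R (\<mu> ^ (2 * b) *\<^sub>R V [] x - full_op b a x (\<lambda>l. V l x))
    + c *\<^sub>R (\<Sum>\<beta> | mi_order \<beta> < 2 * b. coeff_term (a \<beta> x) (mi_order \<beta>) (V (index_list \<beta>) x))
    + c *\<^sub>R (\<Sum>\<beta> | mi_order \<beta> = 2 * b. coeff_term (a \<beta> x - a \<beta> y) (2 * b) (V (index_list \<beta>) x))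
    - (\<Sum>\<beta> | mi_order \<beta> = 2 * b. coeff_term (a \<beta> y) (2 * b) (W (index_list \<beta>) - c *\<^sub>R V (index_list \<beta>) x))"
    using frozen_op_localized[of b a y "\<mu> ^ (2 * b)" W c "\<lambda>l. V l x" x] W0 by simp
  then have "norm (frozen_op b a y (\<mu> ^ (2 * b)) W) \<le> cut_max * G + cut_max * (n_ord * (n_mat * A * (s / \<mu>)))
      + cut_max * (n_ord * (n_mat * \<omega> * s)) + n_ord * (n_mat * A * (4 ^ b * C * (s / \<mu>)))"
    using 1 2 3 4 by (simp only:) (intro order_trans[OF norm_triangle_ineq4] order_trans[OF norm_triangle_ineq] add_mono, auto)
  then show ?thesis unfolding s_def[symmetric] W_def[symmetric] by (simp add: algebra_simps)
qed

end

section \<open>The a priori estimate\<close>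

lemma dist_le_lattice_cube:
  fixes y :: "real ^ 'n::finite"
  assumes "k \<in> lattice_cube h r y"
  shows "norm (lattice_pt h k - y) \<le> real CARD('n) * r"
proof -
  have "norm (lattice_pt h k - y) \<le> (\<Sum>j\<in>UNIV. \<bar>(lattice_pt h k - y) $ j\<bar>)" by (rule norm_le_l1_cart)
  also have "\<dots> \<le> (\<Sum>j\<in>(UNIV :: 'n set). r)" using assms by (intro sum_mono) (auto simp: lattice_cube_def)
  finally show ?thesis by simp
qed

lemma lattice_cube_mono: "r \<le> r' \<Longrightarrow> lattice_cube h r y \<subseteq> lattice_cube h r' y"
  unfolding lattice_cube_def by (auto intro: order_trans)

lemma energy_le:
  fixes V :: "'n::{finite,linorder} list \<Rightarrow> real ^ 'n::{finite,linorder} \<Rightarrow> complex ^ 'm::finite"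
  assumes "\<And>l. l \<in> idx b \<Longrightarrow> \<mu> ^ (2 * b - length l) * norm (V l x) \<le> f l + G + H" "0 \<le> \<mu>"
  shows "energy b \<mu> V x \<le> 3 * (\<Sum>l\<in>idx b. (f l)\<^sup>2) + 3 * real (card (idx b :: 'n list set)) * (G\<^sup>2 + H\<^sup>2)"
proof -
  have "energy b \<mu> V x \<le> (\<Sum>l\<in>idx b. 3 * ((f l)\<^sup>2 + G\<^sup>2 + H\<^sup>2))"
    unfolding energy_def
  proof (rule sum_mono)
    fix l :: "'n list" assume "l \<in> idx b"
    then have "(\<mu> ^ (2 * b - length l) * norm (V l x))\<^sup>2 \<le> (f l + G + H)\<^sup>2"
      using assms by (intro power_mono) auto
    also have "\<dots> \<le> 3 * ((f l)\<^sup>2 + G\<^sup>2 + H\<^sup>2)" by (rule square_sum3_le)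
    finally show "(\<mu> ^ (2 * b - length l) * norm (V l x))\<^sup>2 \<le> 3 * ((f l)\<^sup>2 + G\<^sup>2 + H\<^sup>2)" .
  qed
  also have "\<dots> = 3 * (\<Sum>l\<in>idx b. (f l)\<^sup>2) + 3 * real (card (idx b :: 'n list set)) * (G\<^sup>2 + H\<^sup>2)"
    by (simp add: sum.distrib sum_distrib_left algebra_simps)
  finally show ?thesis .
qed

context parabolic_operator
begin

text \<open>
  The estimate on one cube, with the cube of twice the size on the right. Inside the cube the
  cut-off is at least \<open>1\<close>, so the energy there is bounded by the differences of the localized function,
  these by the frozen operator (\<open>discrete_estimate\<close>), and the latter by \<open>frozen_localized_le\<close>. Only
  \<open>c3\<close> depends on the cut-off radius, and it is divided by \<open>\<mu>\<^sup>2\<close>. The threshold for \<open>h\<close> may depend on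
  everything except the centre \<open>y\<close>.
\<close>

lemma local_step:
  fixes V :: "'n::{finite,linorder} list \<Rightarrow> real ^ 'n::{finite,linorder} \<Rightarrow> complex ^ 'm"
  assumes jet: "jet b V B" and "1 \<le> \<mu>" "0 < G" "0 < r"
    and G: "\<And>x. norm (\<mu> ^ (2 * b) *\<^sub>R V [] x - full_op b a x (\<lambda>l. V l x)) \<le> G"
    and C: "\<And>p x. length p \<le> 2 * b \<Longrightarrow> \<bar>cutoff r (2 * b + 2) p (x :: real ^ 'n::{finite,linorder})\<bar> \<le> C" "0 \<le> C"
    and \<omega>: "\<And>\<beta> i j x y. mi_order \<beta> \<le> 2 * b \<Longrightarrow> norm (x - y) \<le> real CARD('n) * (2 * r) \<Longrightarrow> cmod (a \<beta> x $ i $ j - a \<beta> y $ i $ j) \<le> \<omega>" "0 \<le> \<omega>"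
  defines "P \<equiv> cut_max * n_ord * n_mat"
    and "D \<equiv> n_ord * n_mat * A * (cut_max + 4 ^ b * C)"
  defines "c1 \<equiv> 3 * n_idx + 9 * n_idx * c_ell\<^sup>2 * (1 + cut_max)\<^sup>2"
    and "c2 \<equiv> 9 * n_idx * c_ell\<^sup>2 * P\<^sup>2"
    and "c3 \<equiv> 3 * n_idx * (4 ^ b * C)\<^sup>2 + 9 * n_idx * c_ell\<^sup>2 * D\<^sup>2"
  shows "\<exists>h\<^sub>0>0. \<forall>h. 0 < h \<longrightarrow> h \<le> h\<^sub>0 \<longrightarrow> (\<forall>y. (\<Sum>k\<in>lattice_cube h r y. energy b \<mu> V (lattice_pt h k))
     \<le> c1 * G\<^sup>2 * real (card (lattice_cube h (2 * r) y))
       + (c2 * \<omega>\<^sup>2 + c3 / \<mu>\<^sup>2) * (\<Sum>k\<in>lattice_cube h (2 * r) y. energy b \<mu> V (lattice_pt h k)))"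
proof -
  define m where "m = 2 * b + 2"
  \<comment> \<open>The admissible discretization error: even with weight \<open>\<mu>^(2b)\<close>, or after the frozen operator, it is at most \<open>G\<close>.\<close>
  define e where "e = G / ((1 + n_ord * n_mat * A) * \<mu> ^ (2 * b))"
  have e: "0 < e" "\<mu> ^ (2 * b) * e \<le> G" "n_ord * (n_mat * A * e) \<le> G"
  proof -
    have K: "1 \<le> 1 + n_ord * n_mat * A" "1 \<le> \<mu> ^ (2 * b)"
      using A consts_nonneg \<open>1 \<le> \<mu>\<close> by (auto intro: one_le_power)
    then show "0 < e" unfolding e_def using \<open>0 < G\<close> by (intro divide_pos_pos mult_pos_pos) linarith+
    have eq: "(1 + n_ord * n_mat * A) * \<mu> ^ (2 * b) * e = G"
    proof -
      have "0 < (1 + n_ord * n_mat * A) * \<mu> ^ (2 * b)" using K by (intro mult_pos_pos) linarith+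
      then have "(1 + n_ord * n_mat * A) * \<mu> ^ (2 * b) \<noteq> 0" by linarith
      moreover have "x * (G / x) = G" if "x \<noteq> 0" for x using that by simp
      ultimately show ?thesis unfolding e_def by blast
    qed
    have "1 * (\<mu> ^ (2 * b) * e) \<le> (1 + n_ord * n_mat * A) * (\<mu> ^ (2 * b) * e)"
      using K \<open>0 < e\<close> by (intro mult_right_mono) auto
    then show "\<mu> ^ (2 * b) * e \<le> G" using eq by (simp add: mult.assoc)
    have "n_ord * n_mat * A * (1 * e) \<le> (1 + n_ord * n_mat * A) * (\<mu> ^ (2 * b) * e)"
      using K \<open>0 < e\<close> A consts_nonneg by (intro mult_mono) auto
    then show "n_ord * (n_mat * A * e) \<le> G" using eq by (simp add: mult.assoc)
  qed
  obtain d where d: "0 < d" "\<And>l y x x'. l \<in> idx b \<Longrightarrow> norm (x - x') \<le> d \<Longrightarrow> norm (localized r m y V l x - localized r m y V l x') \<le> e"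
    using localized_modulus[OF jet, of m r e] \<open>0 < r\<close> \<open>0 < e\<close> by (auto simp: m_def)
  define h\<^sub>0 where "h\<^sub>0 = min d (r / 2) / (2 * b)"
  have h0: "0 < h\<^sub>0" using d \<open>0 < r\<close> b by (simp add: h\<^sub>0_def)
  show ?thesis
  proof (intro exI[of _ h\<^sub>0] conjI h0 allI impI)
    fix h y assume h: "0 < h" "h \<le> h\<^sub>0"
    define f where "f = (\<lambda>l. central_diffs h l (localized r m y V []))"
    define s where "s = (\<lambda>x. sqrt (energy b \<mu> V x))"
    define Q2 where "Q2 = lattice_cube h (2 * r) y"
    \<comment> \<open>Differences of order at most \<open>2b\<close> stay within the modulus radius \<open>d\<close>, and the stencil stays within \<open>r/2\<close>,
      so that supports of half-width \<open>3r/2\<close> grow to at most \<open>2r\<close>.\<close>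
    have h_small: "real (length l) * h \<le> d" "real (length l) * h \<le> r / 2" if "l \<in> idx b" for l :: "'n list"
    proof -
      have "real (length l) * h \<le> real (2 * b) * h\<^sub>0"
        using that h by (intro mult_mono) (auto simp: idx_def)
      also have "\<dots> = min d (r / 2)" using b by (simp add: h\<^sub>0_def)
      finally show "real (length l) * h \<le> d" "real (length l) * h \<le> r / 2" by auto
    qed
    have chain: "dir_deriv j (localized r m y V q) (localized r m y V (j # q))" if "l = p @ j # q" "l \<in> idx b" for l p j q
      using that idx_tail[of p "j # q"] by (intro dir_deriv_localized[OF jet]) (auto simp: m_def)
    have approx: "norm (f l x - localized r m y V l x) \<le> e" if l: "l \<in> idx b" for l x
      unfolding f_def
    proof (rule central_diffs_approx[OF chain[OF _ l] h(1)])
      fix z assume "norm (z - x) \<le> real (length l) * h"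
      then show "norm (localized r m y V l z - localized r m y V l x) \<le> e" using h_small[OF l] by (intro d(2) l) linarith
    qed auto
    have f_out: "f l (lattice_pt h k) = 0" if l: "l \<in> idx b" and k: "k \<notin> Q2" for l k
    proof -
      obtain j where j: "2 * r < \<bar>lattice_pt h k $ j - y $ j\<bar>" using k by (auto simp: Q2_def lattice_cube_def not_le)
      have "norm (central_diffs h l (localized r m y V []) (lattice_pt h k) - 0) \<le> 0"
      proof (rule central_diffs_approx[OF chain[OF _ l] h(1)])
        fix z assume z: "norm (z - lattice_pt h k) \<le> real (length l) * h"
        have "\<bar>(z - lattice_pt h k) $ j\<bar> \<le> norm (z - lattice_pt h k)" by (rule component_le_norm_cart)
        then have "\<bar>z $ j - lattice_pt h k $ j\<bar> \<le> r / 2" using z h_small(2)[OF l] by simp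
        then have "3 / 2 * r \<le> \<bar>z $ j - y $ j\<bar>" using j by linarith
        then have "localized r m y V l z = 0"
          using l \<open>0 < r\<close> by (intro localized_support[of _ b]) (auto simp: m_def)
        then show "norm (localized r m y V l z - 0) \<le> 0" by simp
      qed auto
      then show ?thesis by (simp add: f_def)
    qed
    have fin: "finite Q2" by (simp add: Q2_def finite_lattice_cube h)
    obtain N where N: "Q2 \<subseteq> lattice_box N"
    proof -
      have "finite ((\<lambda>(k, j). nat \<bar>k j\<bar>) ` (Q2 \<times> UNIV))" using fin by simp
      then obtain N where N: "\<forall>n\<in>(\<lambda>(k, j). nat \<bar>k j\<bar>) ` (Q2 \<times> UNIV). n \<le> N"
        unfolding finite_nat_set_iff_bounded_le by blast
      have "\<bar>k j\<bar> \<le> int N" if "k \<in> Q2" for k j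
      proof -
        have "(k, j) \<in> Q2 \<times> UNIV" using that by simp
        then have "nat \<bar>k j\<bar> \<le> N" using N by (metis (no_types, lifting) case_prod_conv image_eqI)
        then show ?thesis by simp
      qed
      then show ?thesis by (intro that[of N]) (auto simp: lattice_box_def)
    qed
    define K where "K = (lattice_box (N + 2 * b) :: ('n \<Rightarrow> int) set)"
    have "lattice_box N \<subseteq> K" unfolding K_def lattice_box_def by (auto intro: order_trans)
    then have Q2_K: "Q2 \<subseteq> K" using N by blast
    define R where "R = (\<lambda>k. frozen_op b a y (\<mu> ^ (2 * b)) (\<lambda>l. f l (lattice_pt h k)))"
    \<comment> \<open>\<open>R\<close> lives on \<open>Q2\<close>, so the sums over the large box \<open>K\<close> cost nothing beyond \<open>Q2\<close>.\<close>
    have R_out: "R k = 0" if "k \<notin> Q2" for k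
      using f_out[OF _ that] by (simp add: R_def frozen_op_coeff_term index_list_idx coeff_term_def)
    have ellip: "(\<mu> ^ (2 * b - length l))\<^sup>2 * (\<Sum>k\<in>K. (norm (f l (lattice_pt h k)))\<^sup>2) \<le> c_ell\<^sup>2 * (\<Sum>k\<in>K. (norm (R k))\<^sup>2)"
      if l: "l \<in> idx b" for l
      unfolding K_def f_def R_def c_ell_def
    proof (rule discrete_estimate[OF par \<delta>, of _ N])
      fix k :: "'n \<Rightarrow> int" assume "k \<notin> lattice_box N"
      then show "localized r m y V [] (lattice_pt h k) = 0" using f_out[of "[]" k] N by (auto simp: f_def)
    qed (use \<open>1 \<le> \<mu>\<close> l in \<open>auto simp: idx_def\<close>)
    have R_le: "(norm (R k))\<^sup>2 \<le> 3 * ((1 + cut_max)\<^sup>2 * G\<^sup>2 + P\<^sup>2 * \<omega>\<^sup>2 * energy b \<mu> V (lattice_pt h k) + D\<^sup>2 / \<mu>\<^sup>2 * energy b \<mu> V (lattice_pt h k))"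
      if k: "k \<in> Q2" for k
    proof -
      define x where "x = lattice_pt h k"
      have close: "norm (x - y) \<le> real CARD('n) * (2 * r)"
        unfolding x_def using k by (intro dist_le_lattice_cube) (simp add: Q2_def)
      have localized: "norm (frozen_op b a y (\<mu> ^ (2 * b)) (\<lambda>l. localized r m y V l x)) \<le> cut_max * G + P * \<omega> * s x + D * (s x / \<mu>)"
        unfolding s_def m_def P_def D_def
        by (rule frozen_localized_le[OF \<open>1 \<le> \<mu>\<close> G C _ \<omega>(2)]) (use \<omega>(1)[OF _ close] in auto)
      have "R k - frozen_op b a y (\<mu> ^ (2 * b)) (\<lambda>l. localized r m y V l x)
          = - (\<Sum>\<beta> | mi_order \<beta> = 2 * b. coeff_term (a \<beta> y) (2 * b) (f (index_list \<beta>) x - localized r m y V (index_list \<beta>) x))"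
        by (simp add: R_def frozen_op_coeff_term coeff_term_diff_right sum_subtractf f_def x_def)
      moreover have "norm (\<Sum>\<beta> | mi_order \<beta> = 2 * b. coeff_term (a \<beta> y) (2 * b) (f (index_list \<beta>) x - localized r m y V (index_list \<beta>) x)) \<le> n_ord * (n_mat * A * e)"
        unfolding n_ord_def
      proof (rule norm_sum_const_le)
        fix \<beta> :: "'n \<Rightarrow> nat" assume "\<beta> \<in> {\<beta>. mi_order \<beta> = 2 * b}"
        then have \<beta>: "mi_order \<beta> \<le> 2 * b" by simp
        have "norm (coeff_term (a \<beta> y) (2 * b) (f (index_list \<beta>) x - localized r m y V (index_list \<beta>) x)) \<le> n_mat * A * norm (f (index_list \<beta>) x - localized r m y V (index_list \<beta>) x)"
          unfolding n_mat_def using \<beta> by (intro norm_coeff_term_le coeff_le)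
        also have "\<dots> \<le> n_mat * A * e" using \<beta> A consts_nonneg by (intro mult_left_mono approx index_list_idx) auto
        finally show "norm (coeff_term (a \<beta> y) (2 * b) (f (index_list \<beta>) x - localized r m y V (index_list \<beta>) x)) \<le> n_mat * A * e" .
      next
        show "finite {\<beta> :: 'n \<Rightarrow> nat. mi_order \<beta> = 2 * b}" by (rule finite_subset[OF _ finite_mi_order_le[of "2 * b"]]) auto
        show "finite {\<beta> :: 'n \<Rightarrow> nat. mi_order \<beta> \<le> 2 * b}" by (rule finite_mi_order_le)
      qed (use A e consts_nonneg in auto)
      ultimately have "norm (R k - frozen_op b a y (\<mu> ^ (2 * b)) (\<lambda>l. localized r m y V l x)) \<le> G"
        using e(3) by simp
      then have "norm (R k) \<le> (1 + cut_max) * G + P * \<omega> * s x + D * (s x / \<mu>)"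
        using localized norm_triangle_sub[of "R k" "frozen_op b a y (\<mu> ^ (2 * b)) (\<lambda>l. localized r m y V l x)"] by (simp add: algebra_simps)
      then have "(norm (R k))\<^sup>2 \<le> ((1 + cut_max) * G + P * \<omega> * s x + D * (s x / \<mu>))\<^sup>2"
        by (intro power_mono) auto
      also have "\<dots> \<le> 3 * (((1 + cut_max) * G)\<^sup>2 + (P * \<omega> * s x)\<^sup>2 + (D * (s x / \<mu>))\<^sup>2)" by (rule square_sum3_le)
      also have "(s x)\<^sup>2 = energy b \<mu> V x" by (simp add: s_def energy_nonneg)
      then have "3 * (((1 + cut_max) * G)\<^sup>2 + (P * \<omega> * s x)\<^sup>2 + (D * (s x / \<mu>))\<^sup>2)
         = 3 * ((1 + cut_max)\<^sup>2 * G\<^sup>2 + P\<^sup>2 * \<omega>\<^sup>2 * energy b \<mu> V x + D\<^sup>2 / \<mu>\<^sup>2 * energy b \<mu> V x)"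
        by (simp add: power_mult_distrib power_divide)
      finally show ?thesis unfolding x_def .
    qed
    define S2 where "S2 = (\<Sum>k\<in>Q2. energy b \<mu> V (lattice_pt h k))"
    define RR where "RR = (1 + cut_max)\<^sup>2 * G\<^sup>2 * real (card Q2) + P\<^sup>2 * \<omega>\<^sup>2 * S2 + D\<^sup>2 / \<mu>\<^sup>2 * S2"
    have sumR: "(\<Sum>k\<in>K. (norm (R k))\<^sup>2) \<le> 3 * RR"
    proof -
      have "(\<Sum>k\<in>K. (norm (R k))\<^sup>2) = (\<Sum>k\<in>Q2. (norm (R k))\<^sup>2)"
        by (rule sum.mono_neutral_right) (use Q2_K R_out in \<open>auto simp: K_def\<close>)
      also have "\<dots> \<le> (\<Sum>k\<in>Q2. 3 * ((1 + cut_max)\<^sup>2 * G\<^sup>2 + P\<^sup>2 * \<omega>\<^sup>2 * energy b \<mu> V (lattice_pt h k) + D\<^sup>2 / \<mu>\<^sup>2 * energy b \<mu> V (lattice_pt h k)))"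
        by (rule sum_mono[OF R_le])
      also have "\<dots> = 3 * RR"
        by (simp add: RR_def S2_def sum.distrib sum_distrib_left sum_divide_distrib algebra_simps)
      finally show ?thesis .
    qed
    define Q where "Q = lattice_cube h r y"
    have QQ: "Q \<subseteq> Q2" unfolding Q_def Q2_def using \<open>0 < r\<close> by (intro lattice_cube_mono) simp
    have cardQ: "real (card Q) \<le> real (card Q2)" using card_mono[OF fin QQ] by simp
    have sumQ: "(\<Sum>k\<in>Q. energy b \<mu> V (lattice_pt h k)) \<le> S2"
      unfolding S2_def by (rule sum_mono2[OF fin QQ]) (rule energy_nonneg)
    have pt: "energy b \<mu> V (lattice_pt h k) \<le> 3 * (\<Sum>l\<in>idx b. (\<mu> ^ (2 * b - length l) * norm (f l (lattice_pt h k)))\<^sup>2)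
        + 3 * n_idx * (G\<^sup>2 + (4 ^ b * C)\<^sup>2 / \<mu>\<^sup>2 * energy b \<mu> V (lattice_pt h k))" if k: "k \<in> Q" for k
    proof -
      define x where "x = lattice_pt h k"
      define c where "c = cutoff r m [] (x - y)"
      have "energy b \<mu> V x \<le> 3 * (\<Sum>l\<in>idx b. (\<mu> ^ (2 * b - length l) * norm (f l x))\<^sup>2) + 3 * n_idx * (G\<^sup>2 + (4 ^ b * C * (s x / \<mu>))\<^sup>2)"
        unfolding n_idx_def
      proof (rule energy_le)
        fix l :: "'n list" assume l: "l \<in> idx b"
        have "1 \<le> c" unfolding c_def using k \<open>0 < r\<close> by (intro cutoff_ge_1) (auto simp: x_def Q_def lattice_cube_def)
        then have "norm (V l x) \<le> norm (c *\<^sub>R V l x)" using mult_right_mono[of 1 c "norm (V l x)"] by simp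
        also have "\<dots> \<le> norm (f l x) + norm (f l x - localized r m y V l x) + norm (localized r m y V l x - c *\<^sub>R V l x)"
          using norm_triangle_ineq4[of "f l x - (f l x - localized r m y V l x)" "localized r m y V l x - c *\<^sub>R V l x"]
            norm_triangle_ineq4[of "f l x" "f l x - localized r m y V l x"] by simp
        also have "\<dots> \<le> norm (f l x) + e + norm (localized r m y V l x - c *\<^sub>R V l x)" using approx[OF l, of x] by simp
        finally have "\<mu> ^ (2 * b - length l) * norm (V l x) \<le> \<mu> ^ (2 * b - length l) * (norm (f l x) + e + norm (localized r m y V l x - c *\<^sub>R V l x))"
          using \<open>1 \<le> \<mu>\<close> by (intro mult_left_mono) auto
        moreover have "\<mu> ^ (2 * b - length l) * e \<le> G"
        proof -
          have "\<mu> ^ (2 * b - length l) * e \<le> \<mu> ^ (2 * b) * e"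
            using \<open>1 \<le> \<mu>\<close> e by (intro mult_right_mono power_increasing) auto
          then show ?thesis using e by linarith
        qed
        moreover have "\<mu> ^ (2 * b - length l) * norm (localized r m y V l x - c *\<^sub>R V l x) \<le> 4 ^ b * C * (s x / \<mu>)"
          unfolding c_def s_def m_def by (rule localized_leading[OF l \<open>1 \<le> \<mu>\<close> C])
        ultimately show "\<mu> ^ (2 * b - length l) * norm (V l x) \<le> \<mu> ^ (2 * b - length l) * norm (f l x) + G + 4 ^ b * C * (s x / \<mu>)"
          by (simp add: algebra_simps)
      qed (use \<open>1 \<le> \<mu>\<close> in auto)
      also have "(4 ^ b * C * (s x / \<mu>))\<^sup>2 = (4 ^ b * C)\<^sup>2 / \<mu>\<^sup>2 * energy b \<mu> V x"
        by (simp add: power_mult_distrib power_divide s_def energy_nonneg)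
      finally show ?thesis unfolding x_def .
    qed
    have "(\<Sum>k\<in>Q. energy b \<mu> V (lattice_pt h k)) \<le> (\<Sum>k\<in>Q. 3 * (\<Sum>l\<in>idx b. (\<mu> ^ (2 * b - length l) * norm (f l (lattice_pt h k)))\<^sup>2)
        + 3 * n_idx * (G\<^sup>2 + (4 ^ b * C)\<^sup>2 / \<mu>\<^sup>2 * energy b \<mu> V (lattice_pt h k)))"
      by (rule sum_mono[OF pt])
    also have "\<dots> = 3 * (\<Sum>l\<in>idx b. \<Sum>k\<in>Q. (\<mu> ^ (2 * b - length l) * norm (f l (lattice_pt h k)))\<^sup>2)
        + 3 * n_idx * (G\<^sup>2 * real (card Q) + (4 ^ b * C)\<^sup>2 / \<mu>\<^sup>2 * (\<Sum>k\<in>Q. energy b \<mu> V (lattice_pt h k)))"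
    proof -
      have "(\<Sum>k\<in>Q. \<Sum>l\<in>idx b. (\<mu> ^ (2 * b - length l) * norm (f l (lattice_pt h k)))\<^sup>2)
          = (\<Sum>l\<in>idx b. \<Sum>k\<in>Q. (\<mu> ^ (2 * b - length l) * norm (f l (lattice_pt h k)))\<^sup>2)" by (rule sum.swap)
      then show ?thesis by (simp add: sum.distrib flip: sum_distrib_left sum_divide_distrib)
    qed
    also have "\<dots> \<le> 3 * (n_idx * (c_ell\<^sup>2 * (3 * RR))) + 3 * n_idx * (G\<^sup>2 * real (card Q2) + (4 ^ b * C)\<^sup>2 / \<mu>\<^sup>2 * S2)"
    proof -
      have "(\<Sum>l\<in>idx b. \<Sum>k\<in>Q. (\<mu> ^ (2 * b - length l) * norm (f l (lattice_pt h k)))\<^sup>2) \<le> (\<Sum>l\<in>(idx b :: 'n list set). c_ell\<^sup>2 * (3 * RR))"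
      proof (rule sum_mono)
        fix l :: "'n list" assume l: "l \<in> idx b"
        have "(\<Sum>k\<in>Q. (\<mu> ^ (2 * b - length l) * norm (f l (lattice_pt h k)))\<^sup>2) \<le> (\<Sum>k\<in>K. (\<mu> ^ (2 * b - length l) * norm (f l (lattice_pt h k)))\<^sup>2)"
          using QQ Q2_K by (intro sum_mono2) (auto simp: K_def)
        also have "\<dots> = (\<mu> ^ (2 * b - length l))\<^sup>2 * (\<Sum>k\<in>K. (norm (f l (lattice_pt h k)))\<^sup>2)"
          by (simp only: power_mult_distrib sum_distrib_left)
        also have "\<dots> \<le> c_ell\<^sup>2 * (\<Sum>k\<in>K. (norm (R k))\<^sup>2)" by (rule ellip[OF l])
        also have "\<dots> \<le> c_ell\<^sup>2 * (3 * RR)" by (rule mult_left_mono[OF sumR]) simp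
        finally show "(\<Sum>k\<in>Q. (\<mu> ^ (2 * b - length l) * norm (f l (lattice_pt h k)))\<^sup>2) \<le> c_ell\<^sup>2 * (3 * RR)" .
      qed
      then have 1: "(\<Sum>l\<in>idx b. \<Sum>k\<in>Q. (\<mu> ^ (2 * b - length l) * norm (f l (lattice_pt h k)))\<^sup>2) \<le> n_idx * (c_ell\<^sup>2 * (3 * RR))"
        by (simp add: n_idx_def)
      have 2: "G\<^sup>2 * real (card Q) + (4 ^ b * C)\<^sup>2 / \<mu>\<^sup>2 * (\<Sum>k\<in>Q. energy b \<mu> V (lattice_pt h k))
          \<le> G\<^sup>2 * real (card Q2) + (4 ^ b * C)\<^sup>2 / \<mu>\<^sup>2 * S2"
        by (intro add_mono mult_left_mono cardQ sumQ) auto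
      have "3 * n_idx * (G\<^sup>2 * real (card Q) + (4 ^ b * C)\<^sup>2 / \<mu>\<^sup>2 * (\<Sum>k\<in>Q. energy b \<mu> V (lattice_pt h k)))
          \<le> 3 * n_idx * (G\<^sup>2 * real (card Q2) + (4 ^ b * C)\<^sup>2 / \<mu>\<^sup>2 * S2)"
        using consts_nonneg by (intro mult_left_mono[OF 2]) auto
      then show ?thesis using 1 by linarith
    qed
    also have "\<dots> = c1 * G\<^sup>2 * real (card Q2) + (c2 * \<omega>\<^sup>2 + c3 / \<mu>\<^sup>2) * S2"
      by (simp add: RR_def c1_def c2_def c3_def algebra_simps add_divide_distrib)
    finally show "(\<Sum>k\<in>lattice_cube h r y. energy b \<mu> V (lattice_pt h k))
     \<le> c1 * G\<^sup>2 * real (card (lattice_cube h (2 * r) y))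
       + (c2 * \<omega>\<^sup>2 + c3 / \<mu>\<^sup>2) * (\<Sum>k\<in>lattice_cube h (2 * r) y. energy b \<mu> V (lattice_pt h k))"
      unfolding Q_def Q2_def S2_def .
  qed
qed

text \<open>
  If first \<open>r\<close> is small and then \<open>\<mu>\<close> is large, the oscillation of the coefficients and the lower order
  terms in \<open>local_step\<close> are absorbed by \<open>absorb_translates\<close>. The result bounds the energy in each cube
  by \<open>G\<^sup>2 h^(-n)\<close> up to a constant. A lower bound \<open>M\<close> for the function on a cube of half-width \<open>\<rho>\<close> contributes
  at least \<open>(\<rho>/h)\<^sup>n M\<^sup>2\<close> to it, and the powers of \<open>h\<close> cancel. In this form no trace of the lattice is left.
\<close>

lemma stationary_estimate:
  obtains r c \<mu>\<^sub>0 :: real where "0 < r" "0 \<le> c" "1 \<le> \<mu>\<^sub>0"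
    and "\<And>\<mu> V B G \<rho> M (x\<^sub>0 :: real ^ 'n::{finite,linorder}). \<lbrakk>\<mu>\<^sub>0 \<le> \<mu>; jet b V B; 0 < G;
      \<And>x. norm (\<mu> ^ (2 * b) *\<^sub>R V [] x - full_op b a x (\<lambda>l. V l x)) \<le> G; 0 < \<rho>; \<rho> \<le> r; 0 \<le> M;
      \<And>x. (\<And>j. \<bar>x $ j - x\<^sub>0 $ j\<bar> \<le> \<rho>) \<Longrightarrow> M \<le> norm (V [] x)\<rbrakk> \<Longrightarrow> \<rho> ^ CARD('n) * M\<^sup>2 \<le> c * G\<^sup>2"
proof -
  define n where "n = CARD('n)"
  define P where "P = cut_max * n_ord * n_mat"
  define c1 where "c1 = 3 * n_idx + 9 * n_idx * c_ell\<^sup>2 * (1 + cut_max)\<^sup>2"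
  define c2 where "c2 = 9 * n_idx * c_ell\<^sup>2 * P\<^sup>2"
  have c12: "0 \<le> c1" "0 \<le> c2" using consts_nonneg by (auto simp: c1_def c2_def)
  \<comment> \<open>\<open>\<omega>\<close> is the oscillation of the coefficients that \<open>2\<^sup>n\<close> neighbouring cubes tolerate.\<close>
  define q where "q = 2 ^ n * (c2 + 1)"
  have "1 * 1 \<le> 2 ^ n * (c2 + 1)" using c12 by (intro mult_mono) auto
  then have q: "1 \<le> q" by (simp add: q_def)
  define \<omega> where "\<omega> = 1 / (2 * q)"
  have \<omega>: "0 < \<omega>" using q by (simp add: \<omega>_def)
  have \<omega>_small: "c2 * \<omega>\<^sup>2 * 2 ^ n \<le> 1 / 4"
  proof -
    have "c2 * 2 ^ n \<le> q" by (simp add: q_def algebra_simps)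
    then have "(c2 * 2 ^ n) * \<omega>\<^sup>2 \<le> q * \<omega>\<^sup>2" by (rule mult_right_mono) simp
    also have "\<dots> = 1 / (4 * q)" using q by (simp add: \<omega>_def power2_eq_square)
    also have "\<dots> \<le> 1 / 4" using q by simp
    finally show ?thesis by (simp add: mult_ac)
  qed
  obtain d where d: "0 < d" "\<And>\<beta> i j x x'. mi_order \<beta> \<le> 2 * b \<Longrightarrow> norm (x - x') \<le> d \<Longrightarrow>
      cmod (a \<beta> x $ i $ j - a \<beta> x' $ i $ j) \<le> \<omega>"
    using coeff_modulus[OF \<omega>] by blast
  define r where "r = d / (2 * real CARD('n))"
  have n0: "0 < real CARD('n)" by simp
  have r: "0 < r" "real CARD('n) * (2 * r) = d" using d(1) n0 by (auto simp: r_def)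
  obtain C where C: "0 \<le> C" "\<And>p x. length p \<le> 2 * b \<Longrightarrow> \<bar>cutoff r (2 * b + 2) p (x :: real ^ 'n::{finite,linorder})\<bar> \<le> C"
    using cutoff_bounds[of r "2 * b" "2 * b + 2"] r(1) by auto
  define D where "D = n_ord * n_mat * A * (cut_max + 4 ^ b * C)"
  define c3 where "c3 = 3 * n_idx * (4 ^ b * C)\<^sup>2 + 9 * n_idx * c_ell\<^sup>2 * D\<^sup>2"
  have c3: "0 \<le> c3" using consts_nonneg by (simp add: c3_def)
  define \<mu>\<^sub>0 where "\<mu>\<^sub>0 = max 1 (4 * 2 ^ n * c3)"
  define c where "c = 2 * c1 * (6 * r) ^ n"
  show ?thesis
  proof (rule that[of r c \<mu>\<^sub>0])
    fix \<mu> V B G \<rho> M and x\<^sub>0 :: "real ^ 'n::{finite,linorder}"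
    assume \<mu>: "\<mu>\<^sub>0 \<le> \<mu>" and jet: "jet b V B" and "0 < G"
      and G: "\<And>x. norm (\<mu> ^ (2 * b) *\<^sub>R V [] x - full_op b a x (\<lambda>l. V l x)) \<le> G"
      and \<rho>: "0 < \<rho>" "\<rho> \<le> r" and M: "0 \<le> M" "\<And>x. (\<And>j. \<bar>x $ j - x\<^sub>0 $ j\<bar> \<le> \<rho>) \<Longrightarrow> M \<le> norm (V [] x)"
    have \<mu>1: "1 \<le> \<mu>" "4 * 2 ^ n * c3 \<le> \<mu>" using \<mu> by (auto simp: \<mu>\<^sub>0_def)
    have \<mu>_large: "c3 / \<mu>\<^sup>2 * 2 ^ n \<le> 1 / 4"
    proof -
      have "4 * (c3 * 2 ^ n) \<le> \<mu>" using \<mu>1(2) by (simp add: mult_ac)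
      also have "\<mu> \<le> \<mu>\<^sup>2" using \<mu>1(1) by (simp add: power2_eq_square)
      finally show ?thesis using \<mu>1(1) by (simp add: field_simps)
    qed
    obtain h\<^sub>0 where h0: "0 < h\<^sub>0" and step: "\<And>h y. 0 < h \<Longrightarrow> h \<le> h\<^sub>0 \<Longrightarrow> (\<Sum>k\<in>lattice_cube h r y. energy b \<mu> V (lattice_pt h k))
     \<le> c1 * G\<^sup>2 * real (card (lattice_cube h (2 * r) y))
       + (c2 * \<omega>\<^sup>2 + c3 / \<mu>\<^sup>2) * (\<Sum>k\<in>lattice_cube h (2 * r) y. energy b \<mu> V (lattice_pt h k))"
      using local_step[OF jet \<mu>1(1) \<open>0 < G\<close> r(1) G C(2,1) d(2)] r(2) \<omega>
      unfolding c1_def c2_def c3_def P_def D_def by (metis less_imp_le order_refl)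
    define h where "h = min h\<^sub>0 \<rho>"
    have h: "0 < h" "h \<le> h\<^sub>0" "h \<le> \<rho>" "h \<le> r" using h0 \<rho> by (auto simp: h_def)
    define E where "E = (\<lambda>y. \<Sum>k\<in>lattice_cube h r y. energy b \<mu> V (lattice_pt h k))"
    define X where "X = c1 * G\<^sup>2 * (6 * r / h) ^ n"
    have "E x\<^sub>0 \<le> 2 * X"
    proof (rule absorb_translates[where \<theta> = "c2 * \<omega>\<^sup>2 + c3 / \<mu>\<^sup>2" and r = r])
      fix y
      have B: "energy b \<mu> V x \<le> n_idx * (\<mu> ^ (2 * b) * B)\<^sup>2" for x
      proof -
        have "energy b \<mu> V x \<le> (\<Sum>l\<in>(idx b :: 'n list set). (\<mu> ^ (2 * b) * B)\<^sup>2)"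
          unfolding energy_def using jet \<mu>1
          by (intro sum_mono power_mono mult_mono power_increasing) (auto simp: jet_def)
        then show ?thesis by (simp add: n_idx_def)
      qed
      have "E y \<le> (\<Sum>k\<in>lattice_cube h r y. n_idx * (\<mu> ^ (2 * b) * B)\<^sup>2)"
        unfolding E_def by (rule sum_mono[OF B])
      also have "\<dots> = real (card (lattice_cube h r y)) * (n_idx * (\<mu> ^ (2 * b) * B)\<^sup>2)" by simp
      also have "\<dots> \<le> (3 * r / h) ^ CARD('n) * (n_idx * (\<mu> ^ (2 * b) * B)\<^sup>2)"
        using consts_nonneg by (intro mult_right_mono card_lattice_cube h) auto
      finally show "E y \<le> (3 * r / h) ^ CARD('n) * (n_idx * (\<mu> ^ (2 * b) * B)\<^sup>2)" .
      show "0 \<le> E y" unfolding E_def by (intro sum_nonneg energy_nonneg)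
      have "E y \<le> c1 * G\<^sup>2 * real (card (lattice_cube h (2 * r) y))
         + (c2 * \<omega>\<^sup>2 + c3 / \<mu>\<^sup>2) * (\<Sum>k\<in>lattice_cube h (2 * r) y. energy b \<mu> V (lattice_pt h k))"
        unfolding E_def by (rule step[OF h(1,2)])
      also have "\<dots> \<le> X + (c2 * \<omega>\<^sup>2 + c3 / \<mu>\<^sup>2) * (\<Sum>\<sigma>\<in>signs. E (y + r *\<^sub>R \<sigma>))"
      proof (intro add_mono mult_left_mono)
        have "real (card (lattice_cube h (2 * r) y)) \<le> (3 * (2 * r) / h) ^ CARD('n)"
          using h r by (intro card_lattice_cube) auto
        then have "c1 * G\<^sup>2 * real (card (lattice_cube h (2 * r) y)) \<le> c1 * G\<^sup>2 * (3 * (2 * r) / h) ^ CARD('n)"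
          using c12 by (intro mult_left_mono) auto
        then show "c1 * G\<^sup>2 * real (card (lattice_cube h (2 * r) y)) \<le> X" by (simp add: X_def n_def)
        show "(\<Sum>k\<in>lattice_cube h (2 * r) y. energy b \<mu> V (lattice_pt h k)) \<le> (\<Sum>\<sigma>\<in>signs. E (y + r *\<^sub>R \<sigma>))"
          unfolding E_def by (rule sum_lattice_cube_double[OF h(1)]) (rule energy_nonneg)
      qed (use c12 c3 in auto)
      finally show "E y \<le> X + (c2 * \<omega>\<^sup>2 + c3 / \<mu>\<^sup>2) * (\<Sum>\<sigma>\<in>signs. E (y + r *\<^sub>R \<sigma>))" .
    next
      show "(c2 * \<omega>\<^sup>2 + c3 / \<mu>\<^sup>2) * 2 ^ CARD('n) \<le> 1 / 2"
        using \<omega>_small \<mu>_large unfolding n_def distrib_right by linarith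
    qed (use c12 c3 in auto)
    moreover have "(\<rho> / h) ^ n * M\<^sup>2 \<le> E x\<^sub>0"
    proof -
      have "(\<rho> / h) ^ n * M\<^sup>2 \<le> real (card (lattice_cube h \<rho> x\<^sub>0)) * M\<^sup>2"
        unfolding n_def using h by (intro mult_right_mono card_lattice_cube) auto
      also have "\<dots> = (\<Sum>k\<in>lattice_cube h \<rho> x\<^sub>0. M\<^sup>2)" by simp
      also have "\<dots> \<le> (\<Sum>k\<in>lattice_cube h \<rho> x\<^sub>0. energy b \<mu> V (lattice_pt h k))"
      proof (rule sum_mono)
        fix k assume "k \<in> lattice_cube h \<rho> x\<^sub>0"
        then have "M \<le> norm (V [] (lattice_pt h k))" by (intro M(2)) (simp add: lattice_cube_def)
        also have "\<dots> \<le> \<mu> ^ (2 * b - length ([] :: 'n list)) * norm (V [] (lattice_pt h k))"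
          using mult_right_mono[of 1 "\<mu> ^ (2 * b)" "norm (V [] (lattice_pt h k))"] one_le_power[OF \<mu>1(1)] by simp
        also have "\<dots> \<le> sqrt (energy b \<mu> V (lattice_pt h k))" using \<mu>1 by (intro term_le_energy) auto
        finally have "M\<^sup>2 \<le> (sqrt (energy b \<mu> V (lattice_pt h k)))\<^sup>2" using M(1) by (intro power_mono)
        then show "M\<^sup>2 \<le> energy b \<mu> V (lattice_pt h k)" by (simp add: energy_nonneg)
      qed
      also have "\<dots> \<le> E x\<^sub>0" unfolding E_def
      proof (rule sum_mono2)
        show "lattice_cube h \<rho> x\<^sub>0 \<subseteq> lattice_cube h r x\<^sub>0" using \<rho> by (intro lattice_cube_mono)
      qed (auto simp: finite_lattice_cube h energy_nonneg)
      finally show ?thesis .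
    qed
    ultimately have "(\<rho> / h) ^ n * M\<^sup>2 \<le> 2 * c1 * G\<^sup>2 * (6 * r / h) ^ n" unfolding X_def by linarith
    then have "\<rho> ^ n * M\<^sup>2 \<le> 2 * c1 * G\<^sup>2 * (6 * r) ^ n"
      using h(1) by (simp add: power_divide field_simps)
    then show "\<rho> ^ CARD('n) * M\<^sup>2 \<le> c * G\<^sup>2" by (simp add: c_def n_def mult_ac)
  qed (use r c12 in \<open>auto simp: \<mu>\<^sub>0_def c_def\<close>)
qed

end

section \<open>Functions with bounded exponential moments\<close>

lemma exp_sums: "(\<lambda>k. y ^ k / fact k) sums exp (y :: real)"
proof -
  have "(\<lambda>k. y ^ k /\<^sub>R fact k) = (\<lambda>k. y ^ k / fact k)"
    by (rule ext) (simp add: field_simps)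
  then show ?thesis using exp_converges[of y] by simp
qed

lemma exp_partial_sum_split: "(\<Sum>k<Suc N. x ^ k / fact k) = 1 + (\<Sum>k=1..N. x ^ k / fact k :: real)"
  by (induction N) auto

lemma exp_partial_sum_le:
  assumes "0 \<le> (y :: real)"
  shows "(\<Sum>k<N. y ^ k / fact k) \<le> exp y"
  using sum_le_suminf[OF sums_summable[OF exp_sums], of "{..<N}" y] assms
  by (simp add: sums_unique[OF exp_sums, symmetric])

lemma abs_exp_partial_sum_le:
  assumes "0 \<le> (y :: real)"
  shows "\<bar>\<Sum>k<N. (- y) ^ k / fact k\<bar> \<le> exp y"
proof -
  have "\<bar>\<Sum>k<N. (- y) ^ k / fact k\<bar> \<le> (\<Sum>k<N. y ^ k / fact k)"
    using assms by (intro order_trans[OF sum_abs] sum_mono) (simp add: power_abs)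
  then show ?thesis using exp_partial_sum_le[OF assms, of N] by linarith
qed

text \<open>
  Expanding the outer exponential shows that \<open>1 - exp(- exp(p(S-c-t)))\<close> is a series of the
  exponentials \<open>exp(kp(S-t))\<close>, \<open>k \<ge> 1\<close>, with coefficients \<open>exp(-kpc) / k!\<close> up to sign. For large \<open>p\<close> this
  function is close to the indicator of \<open>t < S - c\<close>, while the bound tends to \<open>0\<close>.
\<close>

lemma integral_exp_cutoff_le:
  fixes g :: "real \<Rightarrow> 'a::euclidean_space"
  assumes g: "continuous_on {0..S} g" and "0 \<le> p" "0 \<le> c" "0 \<le> K"
    and bound: "\<And>k :: nat. 1 \<le> k \<Longrightarrow> norm (integral {0..S} (\<lambda>t. exp (k * p * (S - t)) *\<^sub>R g t)) \<le> K"
  shows "norm (integral {0..S} (\<lambda>t. (1 - exp (- exp (p * (S - c - t)))) *\<^sub>R g t)) \<le> K * (exp (exp (- p * c)) - 1)"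
proof -
  define y where "y = (\<lambda>t. exp (p * (S - c - t)))"
  define F where "F = (\<lambda>N t. (1 - (\<Sum>k<Suc N. (- y t) ^ k / fact k)) *\<^sub>R g t)"
  have cont: "continuous_on {0..S} (\<lambda>t. exp (k * p * (S - t)) *\<^sub>R g t)" for k :: nat
    by (intro continuous_intros g)
  have F_eq: "F N t = (\<Sum>k=1..N. (- ((- exp (- p * c)) ^ k / fact k)) *\<^sub>R (exp (k * p * (S - t)) *\<^sub>R g t))" for N t
  proof -
    have "(- y t) ^ k = (- exp (- p * c)) ^ k * exp (k * p * (S - t))" for k
    proof -
      have "y t = exp (- p * c) * exp (p * (S - t))" by (simp add: y_def algebra_simps flip: exp_add)
      then have "- y t = (- exp (- p * c)) * exp (p * (S - t))" by simp
      then have "(- y t) ^ k = (- exp (- p * c)) ^ k * exp (p * (S - t)) ^ k" by (simp only: power_mult_distrib)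
      also have "exp (p * (S - t)) ^ k = exp (k * p * (S - t))" by (simp add: mult.assoc flip: exp_of_nat_mult)
      finally show ?thesis .
    qed
    then have "1 - (\<Sum>k<Suc N. (- y t) ^ k / fact k) = (\<Sum>k=1..N. - ((- exp (- p * c)) ^ k / fact k) * exp (k * p * (S - t)))"
      unfolding exp_partial_sum_split by (simp add: sum_negf)
    then show ?thesis unfolding F_def by (simp only: scaleR_sum_left scaleR_scaleR)
  qed
  have F_int: "F N integrable_on {0..S}" for N
    unfolding F_eq[abs_def] by (intro integrable_sum integrable_cmul integrable_continuous_real cont) auto
  have F_le: "norm (integral {0..S} (F N)) \<le> K * (exp (exp (- p * c)) - 1)" for N
  proof -
    have "integral {0..S} (F N) = (\<Sum>k=1..N. (- ((- exp (- p * c)) ^ k / fact k)) *\<^sub>R integral {0..S} (\<lambda>t. exp (k * p * (S - t)) *\<^sub>R g t))"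
    proof -
      have int: "(\<lambda>t. q *\<^sub>R (exp (k * p * (S - t)) *\<^sub>R g t)) integrable_on {0..S}" for q and k :: nat
        by (intro integrable_cmul integrable_continuous_real cont)
      show ?thesis
        unfolding F_eq[abs_def] by (subst integral_sum) (simp_all only: int integral_cmul finite_atLeastAtMost)
    qed
    also have "norm \<dots> \<le> (\<Sum>k=1..N. exp (- p * c) ^ k / fact k * K)"
    proof (rule sum_norm_le)
      fix k assume "k \<in> {1..N}"
      then have le: "norm (integral {0..S} (\<lambda>t. exp (k * p * (S - t)) *\<^sub>R g t)) \<le> K" by (intro bound) auto
      show "norm ((- ((- exp (- p * c)) ^ k / fact k)) *\<^sub>R integral {0..S} (\<lambda>t. exp (k * p * (S - t)) *\<^sub>R g t)) \<le> exp (- p * c) ^ k / fact k * K"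
      proof -
        have "\<bar>- ((- exp (- p * c)) ^ k / fact k)\<bar> = exp (- p * c) ^ k / fact k" by (simp add: power_abs)
        then show ?thesis unfolding norm_scaleR using le by (simp only:) (intro mult_left_mono, auto)
      qed
    qed
    also have "\<dots> = ((\<Sum>k<Suc N. exp (- p * c) ^ k / fact k) - 1) * K"
      unfolding exp_partial_sum_split by (simp add: sum_distrib_right)
    also have "\<dots> \<le> (exp (exp (- p * c)) - 1) * K"
      using \<open>0 \<le> K\<close> by (intro mult_right_mono diff_right_mono exp_partial_sum_le) auto
    finally show ?thesis by (simp add: mult.commute)
  qed
  have lim: "(\<lambda>N. integral {0..S} (F N)) \<longlonglongrightarrow> integral {0..S} (\<lambda>t. (1 - exp (- y t)) *\<^sub>R g t)"
  proof (rule dominated_convergence(2)[OF F_int])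
    show "(\<lambda>t. (1 + exp (y t)) * norm (g t)) integrable_on {0..S}"
      unfolding y_def by (intro integrable_continuous_real continuous_intros g)
    fix N t
    have "\<bar>1 - (\<Sum>k<Suc N. (- y t) ^ k / fact k)\<bar> \<le> 1 + exp (y t)"
      using abs_exp_partial_sum_le[of "y t" "Suc N"] by (simp add: y_def)
    then show "norm (F N t) \<le> (1 + exp (y t)) * norm (g t)"
      unfolding F_def norm_scaleR by (intro mult_right_mono) auto
    show "(\<lambda>N. F N t) \<longlonglongrightarrow> (1 - exp (- y t)) *\<^sub>R g t"
      unfolding F_def by (intro tendsto_intros LIMSEQ_Suc[OF exp_sums[unfolded sums_def]])
  qed
  show ?thesis
    by (rule LIMSEQ_le_const2[OF tendsto_norm[OF lim, unfolded y_def]]) (use F_le in blast)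
qed

text \<open>
  Letting \<open>p \<rightarrow> \<infinity>\<close> in \<open>integral_exp_cutoff_le\<close> shows that the integral of \<open>g\<close> over \<open>[0, S - c]\<close> vanishes for
  every \<open>c > 0\<close>; differentiation in \<open>c\<close> gives \<open>g = 0\<close>.
\<close>

lemma bounded_exponential_moments_imp_zero:
  fixes g :: "real \<Rightarrow> 'a::euclidean_space"
  assumes g: "continuous_on {0..S} g" and "0 < S"
    and bound: "\<And>p. p\<^sub>0 \<le> p \<Longrightarrow> norm (integral {0..S} (\<lambda>t. exp (p * (S - t)) *\<^sub>R g t)) \<le> K"
    and t: "t \<in> {0..S}"
  shows "g t = 0"
proof -
  have K: "0 \<le> K" using bound[of p\<^sub>0] norm_ge_zero order_trans by blast
  have zero: "integral {0..S - c} g = 0" if c: "0 < c" "c < S" for c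
  proof -
    \<comment> \<open>The pointwise limit of the approximate indicators; its value at \<open>S - c\<close> is \<open>1 - 1/e\<close>.\<close>
    define L where "L = (\<lambda>t. (if t < S - c then 1 else if t = S - c then 1 - exp (- 1) else 0) *\<^sub>R g t)"
    define \<phi> where "\<phi> = (\<lambda>n t. (1 - exp (- exp (real n * (S - c - t)))) *\<^sub>R g t)"
    have lim: "(\<lambda>n. integral {0..S} (\<phi> n)) \<longlonglongrightarrow> integral {0..S} L"
    proof (rule dominated_convergence(2))
      show "\<phi> n integrable_on {0..S}" for n
        unfolding \<phi>_def by (intro integrable_continuous_real continuous_intros g)
      show "(\<lambda>t. norm (g t)) integrable_on {0..S}"
        by (intro integrable_continuous_real continuous_intros g)
      fix n t
      have "\<bar>1 - exp (- exp (real n * (S - c - t)))\<bar> \<le> 1" by (simp add: abs_le_iff)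
      then show "norm (\<phi> n t) \<le> norm (g t)"
        unfolding \<phi>_def norm_scaleR using mult_right_mono[of _ 1 "norm (g t)"] by simp
      show "(\<lambda>n. \<phi> n t) \<longlonglongrightarrow> L t"
        unfolding \<phi>_def L_def
      proof (rule tendsto_scaleR[OF _ tendsto_const])
        consider "t < S - c" | "t = S - c" | "S - c < t" by linarith
        then show "(\<lambda>n. 1 - exp (- exp (real n * (S - c - t)))) \<longlonglongrightarrow> (if t < S - c then 1 else if t = S - c then 1 - exp (- 1) else 0)"
        proof cases
          case 1
          then have "0 < S - c - t" by simp
          then have "(\<lambda>n. 1 - exp (- exp (real n * (S - c - t)))) \<longlonglongrightarrow> 1" by real_asymp
          then show ?thesis using 1 by simp
        next
          case 3
          then have "S - c - t < 0" by simp
          then have "(\<lambda>n. 1 - exp (- exp (real n * (S - c - t)))) \<longlonglongrightarrow> 0" by real_asymp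
          then show ?thesis using 3 by simp
        qed simp
      qed
    qed
    obtain n\<^sub>0 :: nat where n0: "p\<^sub>0 \<le> real n\<^sub>0" using real_arch_simple by blast
    have le: "norm (integral {0..S} (\<phi> n)) \<le> K * (exp (exp (- real n * c)) - 1)" if "n\<^sub>0 \<le> n" for n
    proof -
      have "norm (integral {0..S} (\<lambda>t. exp (real k * real n * (S - t)) *\<^sub>R g t)) \<le> K" if k: "1 \<le> k" for k :: nat
      proof -
        have "n \<le> k * n" using k by simp
        then have "real n \<le> real k * real n" by (metis of_nat_le_iff of_nat_mult)
        then show ?thesis using n0 \<open>n\<^sub>0 \<le> n\<close> by (intro bound) linarith
      qed
      then show ?thesis
        unfolding \<phi>_def using c K by (intro integral_exp_cutoff_le[OF g]) auto
    qed
    have "(\<lambda>n. exp (exp (- real n * c)) - 1) \<longlonglongrightarrow> 0" using c by real_asymp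
    then have null: "(\<lambda>n. K * (exp (exp (- real n * c)) - 1)) \<longlonglongrightarrow> 0"
      using tendsto_mult_left[of _ 0 sequentially K] by (simp only: mult_zero_right)
    have "(\<lambda>n. integral {0..S} (\<phi> n)) \<longlonglongrightarrow> 0"
      by (rule Lim_null_comparison[OF eventually_sequentiallyI null]) (rule le)
    then have L0: "integral {0..S} L = 0" using lim LIMSEQ_unique by blast
    have "g integrable_on {0..S - c}"
      using c by (intro integrable_continuous_real continuous_on_subset[OF g]) auto
    then have "(g has_integral integral {0..S - c} g) {0..S - c}" by (rule integrable_integral)
    then have "(L has_integral integral {0..S - c} g) {0..S - c}"
      by (rule has_integral_spike_finite[of "{S - c}", rotated 2]) (auto simp: L_def)
    moreover have "(L has_integral 0) {S - c..S}"
      by (rule has_integral_spike_finite[of "{S - c}" _ _ "\<lambda>_. 0"]) (auto simp: L_def)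
    ultimately have "(L has_integral integral {0..S - c} g + 0) {0..S}"
      using c by (intro has_integral_combine[of 0 "S - c" S]) auto
    then show ?thesis using L0 by (simp add: integral_unique)
  qed
  have int0: "integral {0..y} g = 0" if "y \<in> {0<..<S}" for y
    using zero[of "S - y"] that by simp
  have inner: "g y = 0" if y: "y \<in> {0<..<S}" for y
  proof -
    have "((\<lambda>u. integral {0..u} g) has_vector_derivative g y) (at y within {0..S})"
      using y by (intro integral_has_vector_derivative g) auto
    then have d: "((\<lambda>u. integral {0..u} g) has_vector_derivative g y) (at y)"
      using y at_within_interior[of y "{0..S}"] by simp
    have "((\<lambda>u. 0) has_vector_derivative g y) (at y)"
      by (rule has_vector_derivative_transform_within_open[OF d, of "{0<..<S}"]) (use y int0 in auto)
    then show ?thesis using vector_derivative_unique_at has_vector_derivative_const by metis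
  qed
  have "closure {0<..<S} = {0..S}" using \<open>0 < S\<close> by simp
  then show ?thesis
    using continuous_constant_on_closure[of "{0<..<S}" g 0 t] g inner t by auto
qed

section \<open>Laplace transform of a fractional integral\<close>

text \<open>
  The kernel \<open>s^(-\<alpha>)\<close> of the fractional integral, damped by \<open>exp(-ps)\<close>. The damping turns the fractional
  integral into a convolution of integrable functions on the whole line.
\<close>

definition laplace_ker :: "real \<Rightarrow> real \<Rightarrow> real \<Rightarrow> real" where
  "laplace_ker \<alpha> p s = (if 0 < s then s powr (- \<alpha>) * exp (- p * s) else 0)"

lemma laplace_ker_nonneg: "0 \<le> laplace_ker \<alpha> p s"
  by (simp add: laplace_ker_def)

lemma borel_measurable_laplace_ker [measurable]: "laplace_ker \<alpha> p \<in> borel_measurable borel"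
  unfolding laplace_ker_def[abs_def] by measurable

lemma has_bochner_integral_laplace_ker:
  assumes "0 < \<alpha>" "\<alpha> < 1" "0 < p"
  shows "has_bochner_integral lborel (laplace_ker \<alpha> p) (Gamma (1 - \<alpha>) * p powr (\<alpha> - 1))"
proof -
  have "((\<lambda>t. t powr ((1 - \<alpha>) - 1) / exp t) has_integral Gamma (1 - \<alpha>)) {0..}"
    using assms by (intro Gamma_integral_real) auto
  then have "((\<lambda>t. if t \<in> {0..} then t powr ((1 - \<alpha>) - 1) / exp t else 0) has_integral Gamma (1 - \<alpha>)) UNIV"
    by (simp only: has_integral_restrict_UNIV)
  moreover have "(\<lambda>t. if t \<in> {0..} then t powr ((1 - \<alpha>) - 1) / exp t else 0) = laplace_ker \<alpha> 1"
    by (auto simp: fun_eq_iff laplace_ker_def exp_minus divide_inverse)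
  ultimately have "(laplace_ker \<alpha> 1 has_integral Gamma (1 - \<alpha>)) UNIV" by simp
  then have "(\<integral>\<^sup>+s. laplace_ker \<alpha> 1 s \<partial>lborel) = ennreal (Gamma (1 - \<alpha>))"
    by (intro nn_integral_has_integral_lborel laplace_ker_nonneg) auto
  then have 1: "has_bochner_integral lborel (laplace_ker \<alpha> 1) (Gamma (1 - \<alpha>))"
    using assms by (intro has_bochner_integral_nn_integral) (auto simp: laplace_ker_nonneg Gamma_real_pos less_imp_le)
  then have "has_bochner_integral lborel (\<lambda>x. laplace_ker \<alpha> 1 (0 + p * x)) (Gamma (1 - \<alpha>) /\<^sub>R \<bar>p\<bar>)"
    using assms by (intro lborel_has_bochner_integral_real_affine_iff[THEN iffD1]) auto
  then have "has_bochner_integral lborel (\<lambda>x. p powr \<alpha> * laplace_ker \<alpha> 1 (0 + p * x)) (p powr \<alpha> * (Gamma (1 - \<alpha>) /\<^sub>R \<bar>p\<bar>))"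
    by (rule has_bochner_integral_mult_right)
  moreover have "(\<lambda>x. p powr \<alpha> * laplace_ker \<alpha> 1 (0 + p * x)) = laplace_ker \<alpha> p"
    using assms by (auto simp: fun_eq_iff laplace_ker_def powr_mult powr_minus zero_less_mult_iff)
  moreover have "p powr \<alpha> * (Gamma (1 - \<alpha>) /\<^sub>R \<bar>p\<bar>) = Gamma (1 - \<alpha>) * p powr (\<alpha> - 1)"
    using assms by (simp add: powr_diff divide_inverse mult_ac)
  ultimately show ?thesis by (simp only:)
qed

lemma laplace_ker_translate:
  assumes "0 < \<alpha>" "\<alpha> < 1" "0 < p"
  shows "integrable lborel (\<lambda>t. laplace_ker \<alpha> p (t - \<tau>))" "(LINT t|lborel. laplace_ker \<alpha> p (t - \<tau>)) = Gamma (1 - \<alpha>) * p powr (\<alpha> - 1)"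
    and "integrable lborel (\<lambda>\<tau>. laplace_ker \<alpha> p (t - \<tau>))" "(LINT \<tau>|lborel. laplace_ker \<alpha> p (t - \<tau>)) = Gamma (1 - \<alpha>) * p powr (\<alpha> - 1)"
proof -
  note k = has_bochner_integral_laplace_ker[OF assms]
  have "has_bochner_integral lborel (\<lambda>t. laplace_ker \<alpha> p (- \<tau> + 1 * t)) ((Gamma (1 - \<alpha>) * p powr (\<alpha> - 1)) /\<^sub>R \<bar>1\<bar>)"
    using k by (intro lborel_has_bochner_integral_real_affine_iff[THEN iffD1]) auto
  then have 1: "has_bochner_integral lborel (\<lambda>t. laplace_ker \<alpha> p (t - \<tau>)) (Gamma (1 - \<alpha>) * p powr (\<alpha> - 1))"
    by (simp add: add.commute)
  then show "integrable lborel (\<lambda>t. laplace_ker \<alpha> p (t - \<tau>))" "(LINT t|lborel. laplace_ker \<alpha> p (t - \<tau>)) = Gamma (1 - \<alpha>) * p powr (\<alpha> - 1)"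
    by (auto simp: has_bochner_integral_iff)
  have "has_bochner_integral lborel (\<lambda>\<tau>. laplace_ker \<alpha> p (t + (- 1) * \<tau>)) ((Gamma (1 - \<alpha>) * p powr (\<alpha> - 1)) /\<^sub>R \<bar>- 1\<bar>)"
    using k by (intro lborel_has_bochner_integral_real_affine_iff[THEN iffD1]) auto
  then have 2: "has_bochner_integral lborel (\<lambda>\<tau>. laplace_ker \<alpha> p (t - \<tau>)) (Gamma (1 - \<alpha>) * p powr (\<alpha> - 1))"
    by simp
  then show "integrable lborel (\<lambda>\<tau>. laplace_ker \<alpha> p (t - \<tau>))" "(LINT \<tau>|lborel. laplace_ker \<alpha> p (t - \<tau>)) = Gamma (1 - \<alpha>) * p powr (\<alpha> - 1)"
    by (auto simp: has_bochner_integral_iff)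
qed

text \<open>
  Beyond \<open>T\<close> the kernel started at \<open>\<tau>\<close> is at most \<open>exp(-p(T-\<tau>))\<close> times the kernel started at \<open>T\<close>.
\<close>

lemma truncated_laplace_ker_mass:
  assumes "0 < \<alpha>" "\<alpha> < 1" "0 < p" "\<tau> \<le> T"
  defines "c \<equiv> Gamma (1 - \<alpha>) * p powr (\<alpha> - 1)"
  shows "\<bar>(LINT t|lborel. indicator {..T} t * laplace_ker \<alpha> p (t - \<tau>)) - c\<bar> \<le> c * exp (- p * (T - \<tau>))"
proof -
  note k = laplace_ker_translate[OF assms(1-3)]
  have i1: "integrable lborel (\<lambda>t. indicator {..T} t * laplace_ker \<alpha> p (t - \<tau>))"
    and i2: "integrable lborel (\<lambda>t. indicator {T<..} t * laplace_ker \<alpha> p (t - \<tau>))"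
    by (intro Bochner_Integration.integrable_bound[OF k(1)[of \<tau>]]; auto simp: laplace_ker_nonneg split: split_indicator)+
  have "c = (LINT t|lborel. indicator {..T} t * laplace_ker \<alpha> p (t - \<tau>) + indicator {T<..} t * laplace_ker \<alpha> p (t - \<tau>))"
    unfolding c_def k(2)[of \<tau>, symmetric] by (intro Bochner_Integration.integral_cong) (auto split: split_indicator)
  also have "\<dots> = (LINT t|lborel. indicator {..T} t * laplace_ker \<alpha> p (t - \<tau>)) + (LINT t|lborel. indicator {T<..} t * laplace_ker \<alpha> p (t - \<tau>))"
    by (rule Bochner_Integration.integral_add[OF i1 i2])
  finally have split: "c - (LINT t|lborel. indicator {..T} t * laplace_ker \<alpha> p (t - \<tau>)) = (LINT t|lborel. indicator {T<..} t * laplace_ker \<alpha> p (t - \<tau>))"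
    by simp
  have "(LINT t|lborel. indicator {T<..} t * laplace_ker \<alpha> p (t - \<tau>)) \<le> (LINT t|lborel. exp (- p * (T - \<tau>)) * laplace_ker \<alpha> p (t - T))"
  proof (rule integral_mono[OF i2])
    show "integrable lborel (\<lambda>t. exp (- p * (T - \<tau>)) * laplace_ker \<alpha> p (t - T))" by (intro integrable_mult_right k)
    fix t
    show "indicator {T<..} t * laplace_ker \<alpha> p (t - \<tau>) \<le> exp (- p * (T - \<tau>)) * laplace_ker \<alpha> p (t - T)"
    proof (cases "T < t")
      case True
      have "(t - \<tau>) powr (- \<alpha>) \<le> (t - T) powr (- \<alpha>)" using True assms by (intro powr_mono2') auto
      then have "(t - \<tau>) powr (- \<alpha>) * exp (- p * (t - \<tau>)) \<le> (t - T) powr (- \<alpha>) * exp (- p * (t - \<tau>))" by (rule mult_right_mono) simp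
      also have "\<dots> = exp (- p * (T - \<tau>)) * ((t - T) powr (- \<alpha>) * exp (- p * (t - T)))"
      proof -
        have "exp (- p * (t - \<tau>)) = exp (- p * (T - \<tau>)) * exp (- p * (t - T))" by (simp add: algebra_simps flip: exp_add)
        then show ?thesis by (simp only: mult_ac)
      qed
      finally show ?thesis using True assms by (simp add: laplace_ker_def)
    qed (simp add: laplace_ker_nonneg)
  qed
  also have "\<dots> = c * exp (- p * (T - \<tau>))" by (simp add: k c_def)
  finally have "(LINT t|lborel. indicator {T<..} t * laplace_ker \<alpha> p (t - \<tau>)) \<le> c * exp (- p * (T - \<tau>))" .
  moreover have "0 \<le> (LINT t|lborel. indicator {T<..} t * laplace_ker \<alpha> p (t - \<tau>))" by (intro Bochner_Integration.integral_nonneg) (simp add: laplace_ker_nonneg)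
  ultimately show ?thesis using split by linarith
qed

text \<open>
  The factor \<open>exp(-pt) = exp(-p(t-\<tau>)) exp(-p\<tau>)\<close> is shared between the kernel and the function. The last claim
  is the bound of a convolution by the mass of its kernel.
\<close>

lemma frac_convolution:
  fixes g :: "real \<Rightarrow> 'a::euclidean_space"
  assumes \<alpha>: "0 < \<alpha>" "\<alpha> < 1" and "0 < p" and g: "continuous_on {0..T} g" and B: "\<And>t. t \<in> {0..T} \<Longrightarrow> norm (g t) \<le> B" and "0 \<le> B"
  defines "f \<equiv> \<lambda>\<tau>. indicator {0..T} \<tau> *\<^sub>R (exp (- p * \<tau>) *\<^sub>R g \<tau>)"
  defines "J \<equiv> \<lambda>t. integral {0..t} (\<lambda>\<tau>. (t - \<tau>) powr (- \<alpha>) *\<^sub>R g \<tau>)"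
  shows "t \<in> {0..T} \<Longrightarrow> (LINT \<tau>|lborel. laplace_ker \<alpha> p (t - \<tau>) *\<^sub>R f \<tau>) = exp (- p * t) *\<^sub>R J t"
    and "integrable lborel (\<lambda>\<tau>. laplace_ker \<alpha> p (t - \<tau>) *\<^sub>R f \<tau>)"
    and "t \<in> {0..T} \<Longrightarrow> norm (J t) \<le> exp (p * t) * (Gamma (1 - \<alpha>) * p powr (\<alpha> - 1) * B)"
proof -
  note k = laplace_ker_translate[OF \<alpha> \<open>0 < p\<close>]
  have fint: "integrable lborel f"
  proof -
    have "continuous_on {0..T} (\<lambda>\<tau>. exp (- p * \<tau>) *\<^sub>R g \<tau>)" by (intro continuous_intros g)
    then show ?thesis using borel_integrable_atLeastAtMost' unfolding f_def set_integrable_def by blast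
  qed
  then have [measurable]: "f \<in> borel_measurable borel" by (auto dest: borel_measurable_integrable)
  have f_le: "norm (f \<tau>) \<le> B" for \<tau>
  proof (cases "\<tau> \<in> {0..T}")
    case True
    then have "exp (- p * \<tau>) \<le> 1" using \<open>0 < p\<close> by simp
    then have "exp (- p * \<tau>) * norm (g \<tau>) \<le> 1 * B" using B[OF True] by (intro mult_mono) auto
    then show ?thesis using True by (simp add: f_def)
  qed (simp add: f_def \<open>0 \<le> B\<close>)
  have le: "norm (laplace_ker \<alpha> p (t - \<tau>) *\<^sub>R f \<tau>) \<le> laplace_ker \<alpha> p (t - \<tau>) * B" for t \<tau>
    using f_le laplace_ker_nonneg[of \<alpha> p "t - \<tau>"] by (simp add: mult_left_mono)
  show int: "integrable lborel (\<lambda>\<tau>. laplace_ker \<alpha> p (t - \<tau>) *\<^sub>R f \<tau>)" for t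
  proof (rule Bochner_Integration.integrable_bound)
    show "integrable lborel (\<lambda>\<tau>. laplace_ker \<alpha> p (t - \<tau>) * B)" by (intro integrable_mult_left k)
    show "AE \<tau> in lborel. norm (laplace_ker \<alpha> p (t - \<tau>) *\<^sub>R f \<tau>) \<le> norm (laplace_ker \<alpha> p (t - \<tau>) * B)"
    proof (rule AE_I2)
      fix \<tau>
      show "norm (laplace_ker \<alpha> p (t - \<tau>) *\<^sub>R f \<tau>) \<le> norm (laplace_ker \<alpha> p (t - \<tau>) * B)"
        using le[of t \<tau>] abs_ge_self[of "laplace_ker \<alpha> p (t - \<tau>) * B"] unfolding real_norm_def by linarith
    qed
  qed measurable
  show eq: "(LINT \<tau>|lborel. laplace_ker \<alpha> p (t - \<tau>) *\<^sub>R f \<tau>) = exp (- p * t) *\<^sub>R J t" if t: "t \<in> {0..T}" for t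
  proof -
    define h where "h = (\<lambda>\<tau>. exp (- p * t) *\<^sub>R ((t - \<tau>) powr (- \<alpha>) *\<^sub>R g \<tau>))"
    have pt: "laplace_ker \<alpha> p (t - \<tau>) *\<^sub>R f \<tau> = indicator {0..t} \<tau> *\<^sub>R h \<tau>" for \<tau>
    proof -
      consider "\<tau> < 0" | "0 \<le> \<tau>" "\<tau> < t" | "\<tau> = t" | "t < \<tau>" by linarith
      then show ?thesis
      proof cases
        case 2
        have "exp (- p * (t - \<tau>)) * exp (- p * \<tau>) = exp (- p * t)" by (simp add: algebra_simps flip: exp_add)
        then have "(t - \<tau>) powr (- \<alpha>) * exp (- p * (t - \<tau>)) * exp (- p * \<tau>) = exp (- p * t) * (t - \<tau>) powr (- \<alpha>)"
          by (simp only: mult.assoc) (simp only: mult.commute)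
        then show ?thesis using 2 t unfolding laplace_ker_def f_def h_def by (simp add: mult.assoc)
      qed (use t in \<open>auto simp: laplace_ker_def f_def h_def\<close>)
    qed
    have "set_integrable lborel {0..t} h"
      using int[of t] unfolding set_integrable_def pt .
    then have "(LINT \<tau>:{0..t}|lborel. h \<tau>) = integral {0..t} h"
      by (rule set_borel_integral_eq_integral)
    moreover have "integral {0..t} h = exp (- p * t) *\<^sub>R J t" unfolding h_def J_def by (rule integral_cmul)
    ultimately show ?thesis by (simp only: set_lebesgue_integral_def pt)
  qed
  show "norm (J t) \<le> exp (p * t) * (Gamma (1 - \<alpha>) * p powr (\<alpha> - 1) * B)" if t: "t \<in> {0..T}" for t
  proof -
    have "norm (exp (- p * t) *\<^sub>R J t) \<le> (LINT \<tau>|lborel. laplace_ker \<alpha> p (t - \<tau>) * B)"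
      unfolding eq[OF t, symmetric]
      by (rule order_trans[OF integral_norm_bound]) (intro integral_mono le integrable_norm int integrable_mult_left k)
    then have "exp (- p * t) * norm (J t) \<le> Gamma (1 - \<alpha>) * p powr (\<alpha> - 1) * B"
      by (simp add: k)
    then have "exp (p * t) * (exp (- p * t) * norm (J t)) \<le> exp (p * t) * (Gamma (1 - \<alpha>) * p powr (\<alpha> - 1) * B)"
      by (intro mult_left_mono) auto
    then show ?thesis by (simp add: mult.assoc[symmetric] flip: exp_add)
  qed
qed

text \<open>
  By Fubini, the truncated transform of the fractional integral is the integral of \<open>exp(-p\<tau>) g(\<tau>)\<close> against the
  mass that the kernel started at \<open>\<tau>\<close> has before \<open>T\<close>. Replacing this mass by the full one
  costs \<open>exp(-p(T-\<tau>))\<close>, and the exponentials combine to \<open>exp(-pT)\<close>, whatever \<open>\<tau>\<close> is.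
\<close>

lemma laplace_frac_integral:
  fixes g :: "real \<Rightarrow> 'a::euclidean_space"
  assumes \<alpha>: "0 < \<alpha>" "\<alpha> < 1" and p: "0 < p" and "0 \<le> T" and g: "continuous_on {0..T} g"
    and B: "\<And>t. t \<in> {0..T} \<Longrightarrow> norm (g t) \<le> B" "0 \<le> B"
  defines "J \<equiv> \<lambda>t. integral {0..t} (\<lambda>\<tau>. (t - \<tau>) powr (- \<alpha>) *\<^sub>R g \<tau>)"
    and "c \<equiv> Gamma (1 - \<alpha>) * p powr (\<alpha> - 1)"
  assumes J: "continuous_on {0..T} J"
  shows "norm (integral {0..T} (\<lambda>t. exp (- p * t) *\<^sub>R J t) - c *\<^sub>R integral {0..T} (\<lambda>\<tau>. exp (- p * \<tau>) *\<^sub>R g \<tau>))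
    \<le> c * B * T * exp (- p * T)"
proof -
  define f where "f = (\<lambda>\<tau>. indicator {0..T} \<tau> *\<^sub>R (exp (- p * \<tau>) *\<^sub>R g \<tau>))"
  define G where "G = (\<lambda>\<tau> t. (indicator {..T} t * laplace_ker \<alpha> p (t - \<tau>)) *\<^sub>R f \<tau>)"
  define Z where "Z = (\<lambda>\<tau>. LINT t|lborel. indicator {..T} t * laplace_ker \<alpha> p (t - \<tau>))"
  note k = laplace_ker_translate[OF \<alpha> p]
  note conv = frac_convolution[OF \<alpha> p g B]
  have c: "0 \<le> c" using \<alpha> by (auto simp: c_def intro!: mult_nonneg_nonneg less_imp_le[OF Gamma_real_pos])
  have set_int: "set_integrable lborel {0..T} (\<lambda>\<tau>. exp (- p * \<tau>) *\<^sub>R w \<tau>)" if "continuous_on {0..T} w" for w :: "real \<Rightarrow> 'a"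
    using that by (intro borel_integrable_atLeastAtMost' continuous_intros)
  have fint: "integrable lborel f"
    using set_int[OF g] unfolding f_def set_integrable_def .
  then have [measurable]: "f \<in> borel_measurable borel" by (auto dest: borel_measurable_integrable)
  have trunc: "integrable lborel (\<lambda>t. indicator {..T} t * laplace_ker \<alpha> p (t - \<tau>))" for \<tau>
    by (rule Bochner_Integration.integrable_bound[OF k(1)[of \<tau>]]) (auto simp: laplace_ker_nonneg split: split_indicator)
  have Z: "0 \<le> Z \<tau>" "Z \<tau> \<le> c" for \<tau>
  proof -
    show "0 \<le> Z \<tau>" unfolding Z_def by (intro Bochner_Integration.integral_nonneg) (simp add: laplace_ker_nonneg)
    show "Z \<tau> \<le> c" unfolding Z_def c_def k(2)[of \<tau>, symmetric]
      by (intro integral_mono trunc k) (auto simp: laplace_ker_nonneg split: split_indicator)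
  qed
  have G_meas [measurable]: "case_prod G \<in> borel_measurable (lborel \<Otimes>\<^sub>M lborel)"
    unfolding G_def by measurable
  have inner_t: "(LINT t|lborel. G \<tau> t) = Z \<tau> *\<^sub>R f \<tau>" for \<tau>
    unfolding G_def Z_def by (rule integral_scaleR_left) (use trunc in auto)
  have inner_norm: "(LINT t|lborel. norm (G \<tau> t)) = Z \<tau> * norm (f \<tau>)" for \<tau>
    unfolding G_def Z_def by (simp add: laplace_ker_nonneg abs_mult)
  have Gint: "integrable (lborel \<Otimes>\<^sub>M lborel) (case_prod G)"
  proof (rule lborel_pair.Fubini_integrable[OF G_meas])
    have Z_meas: "Z \<in> borel_measurable borel" unfolding Z_def by measurable
    show "integrable lborel (\<lambda>\<tau>. LINT t|lborel. norm (case_prod G (\<tau>, t)))"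
      unfolding split_conv inner_norm
    proof (rule Bochner_Integration.integrable_bound)
      show "integrable lborel (\<lambda>\<tau>. c * norm (f \<tau>))" by (intro integrable_mult_right integrable_norm fint)
      show "(\<lambda>\<tau>. Z \<tau> * norm (f \<tau>)) \<in> borel_measurable lborel" using Z_meas by measurable
      show "AE \<tau> in lborel. norm (Z \<tau> * norm (f \<tau>)) \<le> norm (c * norm (f \<tau>))"
        using Z c by (intro AE_I2) (simp add: abs_mult mult_right_mono)
    qed
    show "AE \<tau> in lborel. integrable lborel (\<lambda>t. case_prod G (\<tau>, t))"
      unfolding G_def using trunc by (intro AE_I2) simp
  qed
  have "integral {0..T} (\<lambda>t. exp (- p * t) *\<^sub>R J t) = (LINT t:{0..T}|lborel. exp (- p * t) *\<^sub>R J t)"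
    using set_borel_integral_eq_integral(2)[OF set_int[OF J]] by simp
  also have "\<dots> = (LINT t|lborel. LINT \<tau>|lborel. G \<tau> t)"
    unfolding set_lebesgue_integral_def
  proof (rule Bochner_Integration.integral_cong[OF refl])
    fix t :: real
    have "(LINT \<tau>|lborel. G \<tau> t) = indicator {..T} t *\<^sub>R (LINT \<tau>|lborel. laplace_ker \<alpha> p (t - \<tau>) *\<^sub>R f \<tau>)"
      unfolding G_def scaleR_scaleR[symmetric] by (rule integral_scaleR_right)
    also have "\<dots> = indicator {0..T} t *\<^sub>R (exp (- p * t) *\<^sub>R J t)"
    proof (cases "0 \<le> t")
      case True
      then show ?thesis using conv(1)[of t] unfolding f_def J_def by (auto split: split_indicator)
    next
      case False
      have "(\<lambda>\<tau>. laplace_ker \<alpha> p (t - \<tau>) *\<^sub>R f \<tau>) = (\<lambda>_. 0)"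
        using False by (auto simp: fun_eq_iff laplace_ker_def f_def)
      then show ?thesis using False by simp
    qed
    finally show "indicator {0..T} t *\<^sub>R (exp (- p * t) *\<^sub>R J t) = (LINT \<tau>|lborel. G \<tau> t)" ..
  qed
  also have "\<dots> = (LINT \<tau>|lborel. LINT t|lborel. G \<tau> t)"
    by (rule lborel_pair.Fubini_integral[OF Gint])
  also have "\<dots> = (LINT \<tau>|lborel. Z \<tau> *\<^sub>R f \<tau>)" unfolding inner_t ..
  finally have lhs: "integral {0..T} (\<lambda>t. exp (- p * t) *\<^sub>R J t) = (LINT \<tau>|lborel. Z \<tau> *\<^sub>R f \<tau>)" .
  have rhs: "c *\<^sub>R integral {0..T} (\<lambda>\<tau>. exp (- p * \<tau>) *\<^sub>R g \<tau>) = (LINT \<tau>|lborel. c *\<^sub>R f \<tau>)"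
  proof -
    have "(LINT \<tau>|lborel. f \<tau>) = integral {0..T} (\<lambda>\<tau>. exp (- p * \<tau>) *\<^sub>R g \<tau>)"
      using set_borel_integral_eq_integral(2)[OF set_int[OF g]] by (simp only: set_lebesgue_integral_def f_def)
    then show ?thesis by (simp only: integral_scaleR_right)
  qed
  have Zf: "integrable lborel (\<lambda>\<tau>. Z \<tau> *\<^sub>R f \<tau>)"
    using lborel_pair.integrable_fst'[OF Gint] by (simp add: inner_t)
  have "norm ((LINT \<tau>|lborel. Z \<tau> *\<^sub>R f \<tau>) - (LINT \<tau>|lborel. c *\<^sub>R f \<tau>)) = norm (LINT \<tau>|lborel. (Z \<tau> - c) *\<^sub>R f \<tau>)"
    using Zf fint by (subst Bochner_Integration.integral_diff[symmetric]) (auto simp: scaleR_diff_left)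
  also have "\<dots> \<le> (LINT \<tau>|lborel. norm ((Z \<tau> - c) *\<^sub>R f \<tau>))" by (rule integral_norm_bound)
  also have "\<dots> \<le> (LINT \<tau>|lborel. indicator {0..T} \<tau> * (c * B * exp (- p * T)))"
  proof (rule integral_mono)
    show "integrable lborel (\<lambda>\<tau>. norm ((Z \<tau> - c) *\<^sub>R f \<tau>))"
      using Zf fint by (auto simp: scaleR_diff_left intro!: integrable_norm Bochner_Integration.integrable_diff)
    show "integrable lborel (\<lambda>\<tau>. indicator {0..T} \<tau> * (c * B * exp (- p * T)))"
      by (intro integrable_mult_left) (simp add: integrable_real_indicator \<open>0 \<le> T\<close>)
    fix \<tau>
    show "norm ((Z \<tau> - c) *\<^sub>R f \<tau>) \<le> indicator {0..T} \<tau> * (c * B * exp (- p * T))"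
    proof (cases "\<tau> \<in> {0..T}")
      case True
      have "\<bar>Z \<tau> - c\<bar> \<le> c * exp (- p * (T - \<tau>))"
        unfolding Z_def c_def using True by (intro truncated_laplace_ker_mass \<alpha> p) auto
      then have "\<bar>Z \<tau> - c\<bar> * (exp (- p * \<tau>) * norm (g \<tau>)) \<le> (c * exp (- p * (T - \<tau>))) * (exp (- p * \<tau>) * B)"
        using B(1)[OF True] c by (intro mult_mono) auto
      also have "\<dots> = c * B * (exp (- p * (T - \<tau>)) * exp (- p * \<tau>))" by (simp only: mult_ac)
      also have "exp (- p * (T - \<tau>)) * exp (- p * \<tau>) = exp (- p * T)" by (simp add: algebra_simps flip: exp_add)
      finally show ?thesis using True by (simp add: f_def abs_mult mult.assoc)
    qed (simp add: f_def)
  qed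
  also have "\<dots> = c * B * T * exp (- p * T)" using \<open>0 \<le> T\<close> by simp
  finally show ?thesis unfolding lhs rhs .
qed

section \<open>The Laplace transform of a solution\<close>

lemma jetI:
  assumes "\<And>j l. j # l \<in> idx b \<Longrightarrow> dir_deriv j (V l) (V (j # l))" "\<And>l x. l \<in> idx b \<Longrightarrow> norm (V l x) \<le> B"
    and "\<And>e. 0 < e \<Longrightarrow> \<forall>\<^sub>F d in at_right 0. \<forall>l\<in>idx b. \<forall>x x'. norm (x - x') \<le> d \<longrightarrow> norm (V l x - V l x') \<le> e"
  shows "jet b V B"
  using assms unfolding jet_def by blast

text \<open>
  \<open>u t l x\<close> is the derivative of the solution along the list \<open>l\<close>.
\<close>

locale null_solution = parabolic_operator b a \<delta> A
  for b :: nat and a :: "('n::{finite,linorder}, 'm::finite) coeffs" and \<delta> A :: real +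
  fixes \<alpha> T B H \<gamma> :: real and u :: "real \<Rightarrow> 'n list \<Rightarrow> real ^ 'n::{finite,linorder} \<Rightarrow> complex ^ 'm"
  assumes \<alpha>: "0 < \<alpha>" "\<alpha> < 1" and T: "0 < T" and B: "0 \<le> B" and H: "0 \<le> H" and \<gamma>: "0 < \<gamma>"
    and u_dir_deriv: "\<And>t j l. t \<in> {0..T} \<Longrightarrow> j # l \<in> idx b \<Longrightarrow> dir_deriv j (u t l) (u t (j # l))"
    and u_le: "\<And>t l x. t \<in> {0..T} \<Longrightarrow> l \<in> idx b \<Longrightarrow> norm (u t l x) \<le> B"
    and u_modulus: "\<And>e. 0 < e \<Longrightarrow> \<forall>\<^sub>F d in at_right 0. \<forall>l\<in>idx b. \<forall>t\<in>{0..T}. \<forall>x x'.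
      norm (x - x') \<le> d \<longrightarrow> norm (u t l x - u t l x') \<le> e"
    and u_cont: "\<And>l x. l \<in> idx b \<Longrightarrow> continuous_on {0..T} (\<lambda>t. u t l x)"
    and u_hoelder: "\<And>t x x'. t \<in> {0..T} \<Longrightarrow> norm (u t [] x - u t [] x') \<le> H * norm (x - x') powr \<gamma>"
    and u_eqn: "\<And>x. \<exists>w. continuous_on {0..T} w \<and>
      (\<forall>t\<in>{0..T}. (frac_integral (1 - \<alpha>) (\<lambda>\<tau>. u \<tau> [] x) has_vector_derivative w t) (at t within {0..T})) \<and>
      (\<forall>t\<in>{0<..T}. w t = full_op b a x (\<lambda>l. u t l x))"
begin

definition laplace :: "real \<Rightarrow> 'n list \<Rightarrow> real ^ 'n::{finite,linorder} \<Rightarrow> complex ^ 'm" where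
  "laplace p l x = integral {0..T} (\<lambda>t. exp (- p * t) *\<^sub>R u t l x)"

lemma laplace_integrable: "l \<in> idx b \<Longrightarrow> (\<lambda>t. exp (- p * t) *\<^sub>R u t l x) integrable_on {0..T}"
  by (intro integrable_continuous_real continuous_intros u_cont)

lemma norm_weighted_integral_le:
  fixes w :: "real \<Rightarrow> 'v::euclidean_space"
  assumes "0 \<le> p" "0 \<le> s" "s \<le> T" "0 \<le> C" "(\<lambda>t. exp (- p * t) *\<^sub>R w t) integrable_on {s..T}" "\<And>t. t \<in> {s..T} \<Longrightarrow> norm (w t) \<le> C"
  shows "norm (integral {s..T} (\<lambda>t. exp (- p * t) *\<^sub>R w t)) \<le> exp (- p * s) * (C * T)"
proof -
  have "norm (integral {s..T} (\<lambda>t. exp (- p * t) *\<^sub>R w t)) \<le> integral {s..T} (\<lambda>t. exp (- p * s) * C)"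
  proof (rule integral_norm_bound_integral)
    fix t assume t: "t \<in> {s..T}"
    then have "exp (- p * t) \<le> exp (- p * s)" using assms by (simp add: mult_left_mono)
    then show "norm (exp (- p * t) *\<^sub>R w t) \<le> exp (- p * s) * C"
      using assms(6)[OF t] by (simp add: mult_mono)
  qed (use assms in auto)
  also have "\<dots> = (T - s) * (exp (- p * s) * C)" using assms by simp
  also have "\<dots> \<le> T * (exp (- p * s) * C)" using assms by (intro mult_right_mono) auto
  finally show ?thesis by (simp add: mult_ac)
qed

text \<open>
  The modulus of continuity in \<open>x\<close> is uniform in \<open>t\<close>, so it survives integration in \<open>t\<close> and
  justifies differentiation under the integral.
\<close>

lemma jet_laplace:
  assumes p: "0 \<le> p"
  shows "jet b (laplace p) (B * T)"
proof (rule jetI)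
  fix l :: "'n list" and x assume l: "l \<in> idx b"
  show "norm (laplace p l x) \<le> B * T"
    using norm_weighted_integral_le[of p 0 B "\<lambda>t. u t l x"] p T B laplace_integrable[OF l, of p x] u_le[OF _ l]
    by (simp add: laplace_def)
next
  fix e :: real assume e: "0 < e"
  then have "0 < e / T" using T by simp
  from u_modulus[OF this]
  show "\<forall>\<^sub>F d in at_right 0. \<forall>l\<in>idx b. \<forall>x x'. norm (x - x') \<le> d \<longrightarrow> norm (laplace p l x - laplace p l x') \<le> e"
  proof eventually_elim
    case (elim d)
    show ?case
    proof (intro ballI allI impI)
      fix l :: "'n list" and x x' :: "real ^ 'n::{finite,linorder}" assume l: "l \<in> idx b" and xx: "norm (x - x') \<le> d"
      have "laplace p l x - laplace p l x' = integral {0..T} (\<lambda>t. exp (- p * t) *\<^sub>R (u t l x - u t l x'))"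
        unfolding laplace_def scaleR_diff_right by (intro integral_diff[symmetric] laplace_integrable l)
      also have "norm \<dots> \<le> exp (- p * 0) * (e / T * T)"
        using p T e elim l xx laplace_integrable[OF l, of p]
        by (intro norm_weighted_integral_le) (auto simp: scaleR_diff_right intro!: integrable_diff)
      finally show "norm (laplace p l x - laplace p l x') \<le> e" using T by simp
    qed
  qed
next
  fix j :: 'n and l :: "'n list" assume jl: "j # l \<in> idx b"
  have l: "l \<in> idx b" using idx_tail[of "[j]" l b] jl by simp
  show "dir_deriv j (laplace p l) (laplace p (j # l))"
    unfolding dir_deriv_def has_vector_derivative_def has_derivative_at_alt
  proof (intro allI conjI impI bounded_linear_scaleR_left)
    fix x and e :: real assume e: "0 < e"
    then have "0 < e / T" using T by simp
    from at_right_0_witness[OF u_modulus[OF this]]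
    obtain d where d: "0 < d" "\<And>t x x'. t \<in> {0..T} \<Longrightarrow> norm (x - x') \<le> d \<Longrightarrow> norm (u t (j # l) x - u t (j # l) x') \<le> e / T"
      using jl by blast
    show "\<exists>d>0. \<forall>s. norm (s - 0) < d \<longrightarrow> norm (laplace p l (x + s *\<^sub>R axis j 1) - laplace p l (x + 0 *\<^sub>R axis j 1) - (s - 0) *\<^sub>R laplace p (j # l) x) \<le> e * norm (s - 0)"
    proof (intro exI[of _ d] conjI allI impI d(1))
      fix s :: real assume s: "norm (s - 0) < d"
      have "laplace p l (x + s *\<^sub>R axis j 1) - laplace p l x - s *\<^sub>R laplace p (j # l) x
         = integral {0..T} (\<lambda>t. exp (- p * t) *\<^sub>R (u t l (x + s *\<^sub>R axis j 1) - u t l x - s *\<^sub>R u t (j # l) x))"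
      proof -
        have "((\<lambda>t. exp (- p * t) *\<^sub>R u t l (x + s *\<^sub>R axis j 1) - exp (- p * t) *\<^sub>R u t l x - s *\<^sub>R (exp (- p * t) *\<^sub>R u t (j # l) x)) has_integral
            laplace p l (x + s *\<^sub>R axis j 1) - laplace p l x - s *\<^sub>R laplace p (j # l) x) {0..T}"
          unfolding laplace_def by (intro has_integral_diff has_integral_cmul integrable_integral laplace_integrable l jl)
        then show ?thesis by (simp add: scaleR_diff_right mult.commute integral_unique)
      qed
      also have "norm \<dots> \<le> exp (- p * 0) * (e / T * \<bar>s\<bar> * T)"
      proof (rule norm_weighted_integral_le)
        show "(\<lambda>t. exp (- p * t) *\<^sub>R (u t l (x + s *\<^sub>R axis j 1) - u t l x - s *\<^sub>R u t (j # l) x)) integrable_on {0..T}"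
          by (intro integrable_continuous_real continuous_intros u_cont l jl)
        fix t assume t: "t \<in> {0..T}"
        show "norm (u t l (x + s *\<^sub>R axis j 1) - u t l x - s *\<^sub>R u t (j # l) x) \<le> e / T * \<bar>s\<bar>"
          by (rule dir_deriv_quotient[OF u_dir_deriv[OF t jl]]) (use d(2)[OF t] s in auto)
      qed (use p T e in auto)
      finally show "norm (laplace p l (x + s *\<^sub>R axis j 1) - laplace p l (x + 0 *\<^sub>R axis j 1) - (s - 0) *\<^sub>R laplace p (j # l) x) \<le> e * norm (s - 0)"
        using T by simp
    qed
  qed
qed

lemma bounded_linear_coeff_term:
  fixes M :: "complex ^ 'v::finite ^ 'v"
  shows "bounded_linear (coeff_term M k)"
proof (rule bounded_linear_intro)
  show "coeff_term M k (z + w) = coeff_term M k z + coeff_term M k w" for z w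
    by (simp add: coeff_term_def vec.scale_right_distrib matrix_vector_right_distrib)
  show "coeff_term M k (r *\<^sub>R z) = r *\<^sub>R coeff_term M k z" for r z by (rule coeff_term_scaleR)
  define C where "C = (\<Sum>i\<in>UNIV. \<Sum>j\<in>UNIV. cmod (M $ i $ j))"
  have "cmod (M $ i $ j) \<le> C" for i j
  proof -
    have "cmod (M $ i $ j) \<le> (\<Sum>j\<in>UNIV. cmod (M $ i $ j))" by (rule member_le_sum) auto
    also have "\<dots> \<le> C" unfolding C_def by (rule member_le_sum) (auto intro: sum_nonneg)
    finally show ?thesis .
  qed
  then show "norm (coeff_term M k z) \<le> norm z * ((real CARD('v))\<^sup>2 * C)" for z
    using norm_coeff_term_le[of M C k z] by (simp add: mult_ac)
qed

lemma full_op_laplace: "((\<lambda>t. exp (- p * t) *\<^sub>R full_op b a x (\<lambda>l. u t l x)) has_integral full_op b a x (\<lambda>l. laplace p l x)) {0..T}"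
proof -
  have "((\<lambda>t. \<Sum>\<beta> | mi_order \<beta> \<le> 2 * b. coeff_term (a \<beta> x) (mi_order \<beta>) (exp (- p * t) *\<^sub>R u t (index_list \<beta>) x)) has_integral
      (\<Sum>\<beta> | mi_order \<beta> \<le> 2 * b. coeff_term (a \<beta> x) (mi_order \<beta>) (laplace p (index_list \<beta>) x))) {0..T}"
  proof (rule has_integral_sum[OF finite_mi_order_le])
    fix \<beta> :: "'n \<Rightarrow> nat" assume "\<beta> \<in> {\<beta>. mi_order \<beta> \<le> 2 * b}"
    then have l: "index_list \<beta> \<in> idx b" by (intro index_list_idx) simp
    have "((\<lambda>t. exp (- p * t) *\<^sub>R u t (index_list \<beta>) x) has_integral laplace p (index_list \<beta>) x) {0..T}"
      unfolding laplace_def by (rule integrable_integral[OF laplace_integrable[OF l]])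
    from has_integral_linear[OF this bounded_linear_coeff_term, of "a \<beta> x" "mi_order \<beta>"]
    show "((\<lambda>t. coeff_term (a \<beta> x) (mi_order \<beta>) (exp (- p * t) *\<^sub>R u t (index_list \<beta>) x)) has_integral coeff_term (a \<beta> x) (mi_order \<beta>) (laplace p (index_list \<beta>) x)) {0..T}"
      by (simp add: o_def)
  qed
  then show ?thesis
    unfolding full_op_def coeff_term_def[symmetric] by (simp add: coeff_term_scaleR scaleR_sum_right)
qed

text \<open>
  Integration by parts moves the time derivative onto \<open>exp(-pt)\<close>, with the boundary term \<open>exp(-pT) J(T)\<close>, where
  \<open>J\<close> is the fractional integral; \<open>laplace_frac_integral\<close> identifies \<open>p\<close> times the transform of \<open>J\<close> with
  \<open>p\<^sup>\<alpha>\<close> times the transform of \<open>u\<close>.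
\<close>

lemma laplace_equation:
  assumes p: "0 < p"
  shows "norm (p powr \<alpha> *\<^sub>R laplace p [] x - full_op b a x (\<lambda>l. laplace p l x)) \<le> exp (- p * T) * (exp T * B + p powr \<alpha> * B * T)"
proof -
  define g where "g = (\<lambda>t. u t [] x)"
  define R where "R = (\<lambda>t. integral {0..t} (\<lambda>\<tau>. (t - \<tau>) powr (- \<alpha>) *\<^sub>R g \<tau>))"
  define J where "J = frac_integral (1 - \<alpha>) g"
  have \<Gamma>: "0 < Gamma (1 - \<alpha>)" using \<alpha> by (intro Gamma_real_pos) simp
  have J_R: "J t = (1 / Gamma (1 - \<alpha>)) *\<^sub>R R t" for t
    by (simp add: J_def R_def frac_integral_def)
  obtain w where w: "continuous_on {0..T} w" "\<And>t. t \<in> {0..T} \<Longrightarrow> (J has_vector_derivative w t) (at t within {0..T})"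
    "\<And>t. t \<in> {0<..T} \<Longrightarrow> w t = full_op b a x (\<lambda>l. u t l x)"
    using u_eqn[of x] unfolding J_def g_def by blast
  have J_cont: "continuous_on {0..T} J"
    unfolding continuous_on_eq_continuous_within using w(2) has_vector_derivative_continuous by blast
  have R_eq: "R t = Gamma (1 - \<alpha>) *\<^sub>R J t" for t using \<Gamma> by (simp add: J_R)
  have R_cont: "continuous_on {0..T} R" unfolding R_eq[abs_def] by (intro continuous_intros J_cont)
  have g_cont: "continuous_on {0..T} g" unfolding g_def by (rule u_cont) simp
  have g_le: "norm (g t) \<le> B" if "t \<in> {0..T}" for t unfolding g_def using that by (rule u_le) simp
  have parts: "((\<lambda>t. exp (- p * t) *\<^sub>R w t - (p * exp (- p * t)) *\<^sub>R J t) has_integral exp (- p * T) *\<^sub>R J T) {0..T}"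
  proof -
    have "((\<lambda>t. exp (- p * t) *\<^sub>R J t) has_vector_derivative (exp (- p * t) *\<^sub>R w t + (- p * exp (- p * t)) *\<^sub>R J t)) (at t within {0..T})"
      if t: "t \<in> {0..T}" for t
      by (rule has_vector_derivative_scaleR[OF _ w(2)[OF t]]) (auto intro!: derivative_eq_intros)
    then have "((\<lambda>t. exp (- p * t) *\<^sub>R w t + (- p * exp (- p * t)) *\<^sub>R J t) has_integral exp (- p * T) *\<^sub>R J T - exp (- p * 0) *\<^sub>R J 0) {0..T}"
      using T by (intro fundamental_theorem_of_calculus) auto
    moreover have "J 0 = 0" by (simp add: J_R R_def)
    ultimately show ?thesis by simp
  qed
  \<comment> \<open>The equation is known for \<open>t > 0\<close> only; the point \<open>0\<close> does not affect the integral.\<close>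
  have full: "((\<lambda>t. exp (- p * t) *\<^sub>R w t) has_integral full_op b a x (\<lambda>l. laplace p l x)) {0..T}"
    by (rule has_integral_spike_finite[OF _ _ full_op_laplace, of "{0}"]) (auto simp: w(3))
  have "((\<lambda>t. exp (- p * t) *\<^sub>R w t - p *\<^sub>R (exp (- p * t) *\<^sub>R J t)) has_integral
      full_op b a x (\<lambda>l. laplace p l x) - p *\<^sub>R integral {0..T} (\<lambda>t. exp (- p * t) *\<^sub>R J t)) {0..T}"
    by (intro has_integral_diff has_integral_cmul full integrable_integral integrable_continuous_real continuous_intros J_cont)
  then have eq: "full_op b a x (\<lambda>l. laplace p l x) = exp (- p * T) *\<^sub>R J T + p *\<^sub>R integral {0..T} (\<lambda>t. exp (- p * t) *\<^sub>R J t)"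
    using has_integral_unique[OF parts] by (simp add: algebra_simps)
  define I where "I = integral {0..T} (\<lambda>t. exp (- p * t) *\<^sub>R R t)"
  have I: "integral {0..T} (\<lambda>t. exp (- p * t) *\<^sub>R J t) = (1 / Gamma (1 - \<alpha>)) *\<^sub>R I"
  proof -
    have "(\<lambda>t. exp (- p * t) *\<^sub>R J t) = (\<lambda>t. (1 / Gamma (1 - \<alpha>)) *\<^sub>R (exp (- p * t) *\<^sub>R R t))"
      by (simp add: J_R mult.commute)
    then show ?thesis unfolding I_def by (simp only: integral_cmul)
  qed
  have laplace_g: "laplace p [] x = integral {0..T} (\<lambda>\<tau>. exp (- p * \<tau>) *\<^sub>R g \<tau>)" by (simp add: laplace_def g_def)
  have "norm (I - (Gamma (1 - \<alpha>) * p powr (\<alpha> - 1)) *\<^sub>R laplace p [] x) \<le> Gamma (1 - \<alpha>) * p powr (\<alpha> - 1) * B * T * exp (- p * T)"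
    unfolding I_def laplace_g R_def
    by (rule laplace_frac_integral[OF \<alpha> p _ g_cont g_le B R_cont[unfolded R_def]]) (use T in auto)
  then have "(p / Gamma (1 - \<alpha>)) * norm (I - (Gamma (1 - \<alpha>) * p powr (\<alpha> - 1)) *\<^sub>R laplace p [] x)
      \<le> (p / Gamma (1 - \<alpha>)) * (Gamma (1 - \<alpha>) * p powr (\<alpha> - 1) * B * T * exp (- p * T))"
    using p \<Gamma> by (intro mult_left_mono) auto
  also have "(p / Gamma (1 - \<alpha>)) * (Gamma (1 - \<alpha>) * p powr (\<alpha> - 1) * B * T * exp (- p * T)) = p powr \<alpha> * B * T * exp (- p * T)"
    using p \<Gamma> by (simp add: powr_diff)
  also have "(p / Gamma (1 - \<alpha>)) * norm (I - (Gamma (1 - \<alpha>) * p powr (\<alpha> - 1)) *\<^sub>R laplace p [] x)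
      = norm ((p / Gamma (1 - \<alpha>)) *\<^sub>R (I - (Gamma (1 - \<alpha>) * p powr (\<alpha> - 1)) *\<^sub>R laplace p [] x))"
    using p \<Gamma> by simp
  also have "(p / Gamma (1 - \<alpha>)) *\<^sub>R (I - (Gamma (1 - \<alpha>) * p powr (\<alpha> - 1)) *\<^sub>R laplace p [] x)
      = p *\<^sub>R ((1 / Gamma (1 - \<alpha>)) *\<^sub>R I) - p powr \<alpha> *\<^sub>R laplace p [] x"
  proof -
    have "(p / Gamma (1 - \<alpha>)) * (Gamma (1 - \<alpha>) * p powr (\<alpha> - 1)) = p powr \<alpha>" using p \<Gamma> by (simp add: powr_diff)
    then show ?thesis by (simp add: scaleR_diff_right)
  qed
  finally have main: "norm (p *\<^sub>R ((1 / Gamma (1 - \<alpha>)) *\<^sub>R I) - p powr \<alpha> *\<^sub>R laplace p [] x) \<le> p powr \<alpha> * B * T * exp (- p * T)" .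
  \<comment> \<open>Here damping is only a device to bound \<open>J(T)\<close>; the exponent \<open>1\<close> keeps the bound independent of \<open>p\<close>.\<close>
  have "norm (R T) \<le> exp (1 * T) * (Gamma (1 - \<alpha>) * 1 powr (\<alpha> - 1) * B)"
    unfolding R_def by (rule frac_convolution(3)[OF \<alpha> zero_less_one g_cont g_le B]) (use T in auto)
  then have J_T: "norm (J T) \<le> exp T * B" using \<Gamma> by (simp add: J_R field_simps)
  have "p powr \<alpha> *\<^sub>R laplace p [] x - full_op b a x (\<lambda>l. laplace p l x)
      = - (p *\<^sub>R ((1 / Gamma (1 - \<alpha>)) *\<^sub>R I) - p powr \<alpha> *\<^sub>R laplace p [] x) - exp (- p * T) *\<^sub>R J T"
    unfolding eq I by simp
  also have "norm \<dots> \<le> p powr \<alpha> * B * T * exp (- p * T) + exp (- p * T) * (exp T * B)"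
  proof (rule order_trans[OF norm_triangle_ineq4], rule add_mono)
    show "norm (exp (- p * T) *\<^sub>R J T) \<le> exp (- p * T) * (exp T * B)" using J_T by simp
  qed (use main in \<open>simp only: norm_minus_cancel\<close>)
  finally show ?thesis by (simp add: algebra_simps)
qed

end

section \<open>Propagation of vanishing in time\<close>

lemma powr_le_imp_le_powr:
  assumes "0 \<le> (x :: real)" "0 < a" "x powr a \<le> K"
  shows "x \<le> K powr (1 / a)"
proof -
  have "x = (x powr a) powr (1 / a)" using assms by (simp add: powr_powr)
  also have "\<dots> \<le> K powr (1 / a)" using assms by (intro powr_mono2) auto
  finally show ?thesis .
qed

lemma square_exp_decay:
  fixes p \<eta> :: real
  assumes "1 \<le> p" "0 < \<eta>"
  shows "p\<^sup>2 * exp (- p * \<eta>) \<le> 2 / \<eta>\<^sup>2"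
proof -
  have "(p * \<eta>)\<^sup>2 / 2 \<le> exp (p * \<eta>)"
    using exp_lower_Taylor_quadratic[of "p * \<eta>"] assms by (smt (verit) mult_nonneg_nonneg)
  then have "(p * \<eta>)\<^sup>2 / 2 * exp (- p * \<eta>) \<le> exp (p * \<eta>) * exp (- p * \<eta>)" by (rule mult_right_mono) simp
  also have "\<dots> = 1" by (simp flip: exp_add)
  finally show ?thesis using assms by (simp add: power_mult_distrib field_simps)
qed

context null_solution
begin

text \<open>
  Let \<open>m\<close> be the norm of the transform at \<open>x\<^sub>0\<close>. As \<open>u\<close> vanishes on \<open>[0,s]\<close>, the transform stays above
  \<open>m/2\<close> on a cube whose half-width \<open>\<rho>\<close> is of size \<open>(m exp(ps))^(1/\<gamma>)\<close>. Then \<open>stationary_estimate\<close> bounds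
  \<open>\<rho>\<^sup>n m\<^sup>2\<close> by a multiple of \<open>p\<^sup>2 exp(-2pT)\<close>, that is, \<open>(m exp(ps))^(\<kappa>+2) \<le> K p\<^sup>2 exp(-2p(T-s))\<close> with
  \<open>\<kappa> = n/\<gamma>\<close>. Half of the decay is spent on the factor \<open>p\<^sup>2\<close>; the other half shows that \<open>m\<close> decays like
  \<open>exp(-p(s+e))\<close> with \<open>e = (T - s)/(\<kappa> + 2)\<close>.
\<close>

lemma vanishing_extends:
  assumes s: "0 \<le> s" "s < T" and zero: "\<And>t x. t \<in> {0..s} \<Longrightarrow> u t [] x = 0"
  shows "\<exists>s'. s < s' \<and> s' \<le> T \<and> (\<forall>t\<in>{0..s'}. \<forall>x. u t [] x = 0)"
proof (rule stationary_estimate)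
  fix r c \<mu>\<^sub>0 :: real assume r: "0 < r" and c: "0 \<le> c" and \<mu>\<^sub>0: "1 \<le> \<mu>\<^sub>0"
    and est: "\<And>\<mu> V B G \<rho> M (x\<^sub>0 :: real ^ 'n::{finite,linorder}). \<lbrakk>\<mu>\<^sub>0 \<le> \<mu>; jet b V B; 0 < G;
      \<And>x. norm (\<mu> ^ (2 * b) *\<^sub>R V [] x - full_op b a x (\<lambda>l. V l x)) \<le> G; 0 < \<rho>; \<rho> \<le> r; 0 \<le> M;
      \<And>x. (\<And>j. \<bar>x $ j - x\<^sub>0 $ j\<bar> \<le> \<rho>) \<Longrightarrow> M \<le> norm (V [] x)\<rbrakk> \<Longrightarrow> \<rho> ^ CARD('n) * M\<^sup>2 \<le> c * G\<^sup>2"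
  define n where "n = real CARD('n)"
  have n: "0 < n" by (simp add: n_def)
  define \<kappa> where "\<kappa> = n / \<gamma>"
  have \<kappa>: "0 < \<kappa>" using n \<gamma> by (simp add: \<kappa>_def)
  define \<eta> where "\<eta> = T - s"
  have \<eta>: "0 < \<eta>" using s by (simp add: \<eta>_def)
  define e where "e = \<eta> / (\<kappa> + 2)"
  have e: "0 < e" "e \<le> \<eta>" using \<kappa> \<eta> by (auto simp: e_def divide_le_eq)
  define C1 where "C1 = exp T * B + B * T + 1"
  have C1: "0 < C1" using B T by (auto simp: C1_def intro!: add_nonneg_pos)
  \<comment> \<open>The last entry of the maximum ensures \<open>\<rho> \<le> r\<close> below.\<close>
  define L where "L = max 1 (max H (B / (2 * (n * r) powr \<gamma>)))"
  have L: "1 \<le> L" "H \<le> L" "B \<le> 2 * L * (n * r) powr \<gamma>"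
  proof -
    have "B / (2 * (n * r) powr \<gamma>) \<le> L" by (simp add: L_def)
    moreover have "0 < 2 * (n * r) powr \<gamma>" using n r by simp
    ultimately have "B \<le> L * (2 * (n * r) powr \<gamma>)" by (simp add: divide_le_eq)
    then show "B \<le> 2 * L * (n * r) powr \<gamma>" by (simp add: mult_ac)
  qed (auto simp: L_def)
  define Y where "Y = T * L"
  have Y: "0 < Y" using T L by (simp add: Y_def)
  define K1 where "K1 = c * n ^ CARD('n) * C1\<^sup>2 / Y\<^sup>2"
  define K3 where "K3 = (K1 * 8 / \<eta>\<^sup>2) powr (1 / (\<kappa> + 2))"
  define p\<^sub>0 where "p\<^sub>0 = max 1 (\<mu>\<^sub>0 powr (2 * b / \<alpha>))"
  have b0: "0 < real b" using b by simp
  have decay: "norm (laplace p [] x\<^sub>0) * exp (p * (s + e)) \<le> 2 * Y * K3" if p: "p\<^sub>0 \<le> p" for p x\<^sub>0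
  proof (cases "laplace p [] x\<^sub>0 = 0")
    case True
    then show ?thesis using Y by (simp add: K3_def)
  next
    case False
    have p1: "1 \<le> p" "\<mu>\<^sub>0 powr (2 * b / \<alpha>) \<le> p" using p by (auto simp: p\<^sub>0_def)
    \<comment> \<open>Chosen so that \<open>\<mu>^(2b) = p\<^sup>\<alpha>\<close>.\<close>
    define \<mu> where "\<mu> = p powr (\<alpha> / (2 * b))"
    have \<mu>: "\<mu>\<^sub>0 \<le> \<mu>"
    proof -
      have "\<mu>\<^sub>0 = (\<mu>\<^sub>0 powr (2 * b / \<alpha>)) powr (\<alpha> / (2 * b))" using \<mu>\<^sub>0 \<alpha> b0 by (simp add: powr_powr)
      also have "\<dots> \<le> \<mu>" unfolding \<mu>_def using p1 \<alpha> b0 by (intro powr_mono2) auto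
      finally show ?thesis .
    qed
    have \<mu>_pow: "\<mu> ^ (2 * b) = p powr \<alpha>"
    proof -
      have "0 < \<mu>" using p1 by (simp add: \<mu>_def)
      then have "\<mu> ^ (2 * b) = \<mu> powr (2 * b)" by (simp add: powr_realpow[symmetric])
      then show ?thesis using b0 by (simp add: \<mu>_def powr_powr)
    qed
    define G where "G = C1 * (2 * p) * exp (- p * T)"
    have G: "0 < G" using C1 p1 by (simp add: G_def)
    have G_eq: "norm (\<mu> ^ (2 * b) *\<^sub>R laplace p [] x - full_op b a x (\<lambda>l. laplace p l x)) \<le> G" for x
    proof -
      have "p powr \<alpha> \<le> p powr 1" using p1 \<alpha> by (intro powr_mono) auto
      then have pa: "p powr \<alpha> \<le> p" using p1 by simp
      have "exp T * B + p powr \<alpha> * B * T \<le> exp T * B * p + p * (B * T)"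
      proof -
        have "exp T * B * 1 \<le> exp T * B * p" using p1 B by (intro mult_left_mono) auto
        moreover have "p powr \<alpha> * (B * T) \<le> p * (B * T)" using pa B T by (intro mult_right_mono) auto
        ultimately show ?thesis by (simp only: mult_1_right mult.assoc)
      qed
      also have "\<dots> \<le> C1 * (2 * p)"
      proof -
        have "C1 * (2 * p) = 2 * (exp T * B * p) + 2 * (p * (B * T)) + 2 * p" by (simp add: C1_def algebra_simps)
        moreover have "0 \<le> exp T * B * p" "0 \<le> p * (B * T)" using B T p1 by auto
        ultimately show ?thesis using p1 by linarith
      qed
      finally have "exp (- p * T) * (exp T * B + p powr \<alpha> * B * T) \<le> exp (- p * T) * (C1 * (2 * p))"
        by (rule mult_left_mono) simp
      then have "norm (p powr \<alpha> *\<^sub>R laplace p [] x - full_op b a x (\<lambda>l. laplace p l x)) \<le> exp (- p * T) * (C1 * (2 * p))"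
        using p1 by (intro order_trans[OF laplace_equation]) auto
      then show ?thesis unfolding \<mu>_pow G_def by (simp only: mult_ac)
    qed
    \<comment> \<open>Transforms of functions that vanish on \<open>[0,s]\<close> carry a factor \<open>exp(-ps)\<close>.\<close>
    have tail: "norm (integral {0..T} (\<lambda>t. exp (- p * t) *\<^sub>R w t)) \<le> exp (- p * s) * (C * T)"
      if w: "continuous_on {0..T} w" "\<And>t. t \<in> {0..s} \<Longrightarrow> w t = 0" "\<And>t. t \<in> {0..T} \<Longrightarrow> norm (w t) \<le> C" "0 \<le> C"
      for w :: "real \<Rightarrow> complex ^ 'm" and C
    proof -
      have i: "(\<lambda>t. exp (- p * t) *\<^sub>R w t) integrable_on {s'..T}" if "0 \<le> s'" for s'
        using that by (intro integrable_continuous_real continuous_intros continuous_on_subset[OF w(1)]) auto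
      have "integral {0..s} (\<lambda>t. exp (- p * t) *\<^sub>R w t) + integral {s..T} (\<lambda>t. exp (- p * t) *\<^sub>R w t)
          = integral {0..T} (\<lambda>t. exp (- p * t) *\<^sub>R w t)"
        using s i[of 0] by (intro Henstock_Kurzweil_Integration.integral_combine) auto
      moreover have "integral {0..s} (\<lambda>t. exp (- p * t) *\<^sub>R w t) = 0"
        using w(2) Henstock_Kurzweil_Integration.integral_cong[of "{0..s}" "\<lambda>t. exp (- p * t) *\<^sub>R w t" "\<lambda>_. 0"] by simp
      ultimately show ?thesis
        using norm_weighted_integral_le[of p s C w] p1 s i[of s] w by simp
    qed
    have laplace_le: "norm (laplace p [] x\<^sub>0) \<le> exp (- p * s) * (B * T)"
      unfolding laplace_def using zero u_le B by (intro tail u_cont) auto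
    have laplace_diff: "norm (laplace p [] x - laplace p [] x\<^sub>0) \<le> exp (- p * s) * (L * norm (x - x\<^sub>0) powr \<gamma> * T)" for x
    proof -
      have "laplace p [] x - laplace p [] x\<^sub>0 = integral {0..T} (\<lambda>t. exp (- p * t) *\<^sub>R (u t [] x - u t [] x\<^sub>0))"
        unfolding laplace_def scaleR_diff_right by (intro integral_diff[symmetric] laplace_integrable) auto
      also have "norm \<dots> \<le> exp (- p * s) * (L * norm (x - x\<^sub>0) powr \<gamma> * T)"
      proof (rule tail)
        show "continuous_on {0..T} (\<lambda>t. u t [] x - u t [] x\<^sub>0)" by (intro continuous_intros u_cont) auto
        show "u t [] x - u t [] x\<^sub>0 = 0" if "t \<in> {0..s}" for t using zero[OF that] by simp
        show "norm (u t [] x - u t [] x\<^sub>0) \<le> L * norm (x - x\<^sub>0) powr \<gamma>" if "t \<in> {0..T}" for t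
          using u_hoelder[OF that, of x x\<^sub>0] L(2) by (meson mult_right_mono order_trans powr_ge_zero)
        show "0 \<le> L * norm (x - x\<^sub>0) powr \<gamma>" using L by simp
      qed
      finally show ?thesis .
    qed
    define m where "m = norm (laplace p [] x\<^sub>0)"
    have m: "0 < m" using False by (simp add: m_def)
    \<comment> \<open>\<open>z\<close> is the value of \<open>|x - x\<^sub>0|\<^sup>\<gamma>\<close> up to which the Hoelder bound loses at most \<open>m/2\<close>; the cube of
      half-width \<open>\<rho>\<close> lies in the corresponding ball.\<close>
    define z where "z = m * exp (p * s) / (2 * Y)"
    have z: "0 < z" using m Y by (simp add: z_def)
    have es: "exp (- p * s) * exp (p * s) = 1" by (simp flip: exp_add)
    have m_z: "m = 2 * Y * z * exp (- p * s)"
    proof -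
      have "2 * Y * z = m * exp (p * s)" using Y by (simp add: z_def)
      then have "2 * Y * z * exp (- p * s) = m * (exp (- p * s) * exp (p * s))" by (simp add: mult_ac)
      then show ?thesis unfolding es by simp
    qed
    have z_le: "z \<le> (n * r) powr \<gamma>"
    proof -
      have "2 * Y * z = m * exp (p * s)" using Y by (simp add: z_def)
      also have "\<dots> \<le> exp (- p * s) * (B * T) * exp (p * s)"
        unfolding m_def by (rule mult_right_mono[OF laplace_le]) simp
      also have "\<dots> = (B * T) * (exp (- p * s) * exp (p * s))" by (simp only: mult_ac)
      also have "\<dots> \<le> (2 * L * (n * r) powr \<gamma>) * T" unfolding es using L(3) T by (simp add: mult_right_mono)
      also have "\<dots> = 2 * Y * (n * r) powr \<gamma>" by (simp add: Y_def)
      finally show ?thesis using Y by simp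
    qed
    define \<rho> where "\<rho> = z powr (1 / \<gamma>) / n"
    have \<rho>: "0 < \<rho>" "\<rho> \<le> r"
    proof -
      show "0 < \<rho>" using z n by (simp add: \<rho>_def)
      have "z powr (1 / \<gamma>) \<le> ((n * r) powr \<gamma>) powr (1 / \<gamma>)" using z z_le \<gamma> by (intro powr_mono2) auto
      also have "\<dots> = n * r" using \<gamma> n r by (simp add: powr_powr)
      finally show "\<rho> \<le> r" using n by (simp add: \<rho>_def field_simps)
    qed
    have z_\<rho>: "(n * \<rho>) powr \<gamma> = z" using n z \<gamma> by (simp add: \<rho>_def powr_powr)
    have "\<rho> ^ CARD('n) * (m / 2)\<^sup>2 \<le> c * G\<^sup>2"
    proof (rule est[OF \<mu> jet_laplace[of p] G G_eq \<rho>])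
      fix x assume x: "\<And>j. \<bar>x $ j - x\<^sub>0 $ j\<bar> \<le> \<rho>"
      have "norm (x - x\<^sub>0) \<le> (\<Sum>j\<in>UNIV. \<bar>(x - x\<^sub>0) $ j\<bar>)" by (rule norm_le_l1_cart)
      also have "\<dots> \<le> (\<Sum>j\<in>(UNIV :: 'n set). \<rho>)" using x by (intro sum_mono) simp
      also have "\<dots> = n * \<rho>" by (simp add: n_def)
      finally have "norm (x - x\<^sub>0) powr \<gamma> \<le> z" unfolding z_\<rho>[symmetric] using \<gamma> by (intro powr_mono2) auto
      then have "exp (- p * s) * (L * norm (x - x\<^sub>0) powr \<gamma> * T) \<le> exp (- p * s) * (L * z * T)"
        using L T by (intro mult_left_mono mult_right_mono) auto
      also have "\<dots> = m / 2" unfolding m_z Y_def by simp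
      finally have "norm (laplace p [] x - laplace p [] x\<^sub>0) \<le> m / 2" using laplace_diff[of x] by linarith
      then show "m / 2 \<le> norm (laplace p [] x)"
        using norm_triangle_ineq2[of "laplace p [] x\<^sub>0" "laplace p [] x"] by (simp add: m_def norm_minus_commute)
    qed (use p1 m in auto)
    moreover have "\<rho> ^ CARD('n) = z powr \<kappa> / n ^ CARD('n)"
    proof -
      have "(z powr (1 / \<gamma>)) ^ CARD('n) = (z powr (1 / \<gamma>)) powr n" unfolding n_def using z by (subst powr_realpow) auto
      also have "\<dots> = z powr \<kappa>" by (simp add: powr_powr \<kappa>_def)
      finally show ?thesis by (simp add: \<rho>_def power_divide)
    qed
    ultimately have "z powr \<kappa> / n ^ CARD('n) * (m / 2)\<^sup>2 \<le> c * G\<^sup>2" by simp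
    moreover have "(m / 2)\<^sup>2 = Y\<^sup>2 * z powr 2 * (exp (- p * s))\<^sup>2"
      using z by (simp add: m_z power_mult_distrib powr_numeral)
    ultimately have "z powr \<kappa> / n ^ CARD('n) * (Y\<^sup>2 * z powr 2 * (exp (- p * s))\<^sup>2) \<le> c * (C1 * (2 * p) * exp (- p * T))\<^sup>2"
      by (simp only: G_def)
    then have "z powr \<kappa> / n ^ CARD('n) * (Y\<^sup>2 * z powr 2 * (exp (- p * s))\<^sup>2) * ((exp (p * s))\<^sup>2 * n ^ CARD('n) / Y\<^sup>2)
        \<le> c * (C1 * (2 * p) * exp (- p * T))\<^sup>2 * ((exp (p * s))\<^sup>2 * n ^ CARD('n) / Y\<^sup>2)"
      using n by (intro mult_right_mono) auto
    also have "z powr \<kappa> / n ^ CARD('n) * (Y\<^sup>2 * z powr 2 * (exp (- p * s))\<^sup>2) * ((exp (p * s))\<^sup>2 * n ^ CARD('n) / Y\<^sup>2)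
        = z powr \<kappa> * z powr 2 * (exp (- p * s) * exp (p * s))\<^sup>2"
      using n Y by (simp add: power_mult_distrib)
    also have "\<dots> = z powr (\<kappa> + 2)" unfolding es by (simp add: powr_add)
    also have "c * (C1 * (2 * p) * exp (- p * T))\<^sup>2 * ((exp (p * s))\<^sup>2 * n ^ CARD('n) / Y\<^sup>2)
        = K1 * 4 * p\<^sup>2 * (exp (- p * T) * exp (p * s))\<^sup>2"
      by (simp add: K1_def power_mult_distrib)
    also have "exp (- p * T) * exp (p * s) = exp (- p * \<eta>)" by (simp add: \<eta>_def algebra_simps flip: exp_add)
    finally have z_bound: "z powr (\<kappa> + 2) \<le> K1 * 4 * p\<^sup>2 * (exp (- p * \<eta>))\<^sup>2" .
    have "(z * exp (p * e)) powr (\<kappa> + 2) = z powr (\<kappa> + 2) * exp (p * e) powr (\<kappa> + 2)"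
      using z by (simp add: powr_mult)
    also have "exp (p * e) powr (\<kappa> + 2) = exp (p * \<eta>)"
      using \<kappa> by (simp add: powr_def e_def)
    also have "z powr (\<kappa> + 2) * exp (p * \<eta>) \<le> K1 * 4 * p\<^sup>2 * (exp (- p * \<eta>))\<^sup>2 * exp (p * \<eta>)"
      by (rule mult_right_mono[OF z_bound]) simp
    also have "\<dots> = K1 * 4 * (p\<^sup>2 * exp (- p * \<eta>)) * (exp (- p * \<eta>) * exp (p * \<eta>))"
      by (simp only: power2_eq_square mult_ac)
    also have "exp (- p * \<eta>) * exp (p * \<eta>) = 1" by (simp flip: exp_add)
    also have "K1 * 4 * (p\<^sup>2 * exp (- p * \<eta>)) * 1 \<le> K1 * 4 * (2 / \<eta>\<^sup>2)"
    proof -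
      have "0 \<le> K1" using c n by (simp add: K1_def)
      then show ?thesis using square_exp_decay[OF p1(1) \<eta>] by (simp only: mult_1_right) (intro mult_left_mono, auto)
    qed
    also have "\<dots> = K1 * 8 / \<eta>\<^sup>2" by simp
    finally have "z * exp (p * e) \<le> K3" unfolding K3_def using z \<kappa> by (intro powr_le_imp_le_powr) auto
    then have "2 * Y * (z * exp (p * e)) \<le> 2 * Y * K3" using Y by simp
    moreover have "m * exp (p * (s + e)) = 2 * Y * (z * exp (p * e))"
    proof -
      have "m * exp (p * (s + e)) = 2 * Y * z * exp (p * e) * (exp (- p * s) * exp (p * s))"
        unfolding m_z by (simp add: distrib_left exp_add mult_ac)
      then show ?thesis unfolding es by simp
    qed
    ultimately show ?thesis by (simp add: m_def)
  qed
  define S where "S = s + e"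
  have S: "s < S" "S \<le> T" "0 < S" using s e by (auto simp: S_def \<eta>_def)
  have "u t [] x = 0" if t: "t \<in> {0..S}" for t x
  proof (rule bounded_exponential_moments_imp_zero[where g = "\<lambda>t. u t [] x" and p\<^sub>0 = p\<^sub>0 and K = "2 * Y * K3 + B * T", OF _ S(3) _ t])
    show "continuous_on {0..S} (\<lambda>t. u t [] x)" using S by (intro continuous_on_subset[OF u_cont]) auto
    fix p assume p: "p\<^sub>0 \<le> p"
    then have p1: "1 \<le> p" by (simp add: p\<^sub>0_def)
    have i: "(\<lambda>t. exp (- p * t) *\<^sub>R u t [] x) integrable_on {s'..T}" if "0 \<le> s'" for s'
      using that by (intro integrable_continuous_real continuous_intros continuous_on_subset[OF u_cont]) auto
    have "integral {0..S} (\<lambda>t. exp (- p * t) *\<^sub>R u t [] x) + integral {S..T} (\<lambda>t. exp (- p * t) *\<^sub>R u t [] x) = laplace p [] x"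
      unfolding laplace_def using S i[of 0] by (intro Henstock_Kurzweil_Integration.integral_combine) auto
    then have I: "integral {0..S} (\<lambda>t. exp (- p * t) *\<^sub>R u t [] x) = laplace p [] x - integral {S..T} (\<lambda>t. exp (- p * t) *\<^sub>R u t [] x)"
      by (simp add: algebra_simps)
    have "(\<lambda>t. exp (p * (S - t)) *\<^sub>R u t [] x) = (\<lambda>t. exp (p * S) *\<^sub>R (exp (- p * t) *\<^sub>R u t [] x))"
      by (simp add: fun_eq_iff algebra_simps flip: exp_add)
    then have "norm (integral {0..S} (\<lambda>t. exp (p * (S - t)) *\<^sub>R u t [] x))
        = exp (p * S) * norm (laplace p [] x - integral {S..T} (\<lambda>t. exp (- p * t) *\<^sub>R u t [] x))"
      by (simp only: integral_cmul I norm_scaleR abs_exp_cancel)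
    also have "\<dots> \<le> exp (p * S) * (norm (laplace p [] x) + norm (integral {S..T} (\<lambda>t. exp (- p * t) *\<^sub>R u t [] x)))"
      by (intro mult_left_mono norm_triangle_ineq4) auto
    also have "\<dots> \<le> exp (p * S) * (norm (laplace p [] x) + exp (- p * S) * (B * T))"
      using S p1 B i[of S] u_le by (intro mult_left_mono add_left_mono norm_weighted_integral_le) auto
    also have "\<dots> = norm (laplace p [] x) * exp (p * S) + (exp (p * S) * exp (- p * S)) * (B * T)"
      by (simp only: distrib_left mult_ac)
    also have "exp (p * S) * exp (- p * S) = 1" by (simp flip: exp_add)
    also have "norm (laplace p [] x) * exp (p * S) + 1 * (B * T) \<le> 2 * Y * K3 + B * T"
      using decay[OF p, of x] by (simp add: S_def)
    finally show "norm (integral {0..S} (\<lambda>t. exp (p * (S - t)) *\<^sub>R u t [] x)) \<le> 2 * Y * K3 + B * T" .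
  qed
  then show ?thesis using S by blast
qed

lemma vanishing:
  assumes init: "\<And>x. u 0 [] x = 0" and t: "t \<in> {0..T}"
  shows "u t [] x = 0"
proof -
  \<comment> \<open>The supremum of the vanishing intervals is attained by continuity in \<open>t\<close>, so it can only be \<open>T\<close>.\<close>
  define Z where "Z = {s \<in> {0..T}. \<forall>t\<in>{0..s}. \<forall>x. u t [] x = 0}"
  have Z0: "0 \<in> Z" using T init by (simp add: Z_def)
  have bdd: "bdd_above Z" by (rule bdd_aboveI[of _ T]) (simp add: Z_def)
  define s where "s = Sup Z"
  have s: "0 \<le> s" "s \<le> T"
  proof -
    show "0 \<le> s" unfolding s_def by (rule cSup_upper[OF Z0 bdd])
    show "s \<le> T" unfolding s_def by (rule cSup_least) (use Z0 in \<open>auto simp: Z_def\<close>)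
  qed
  have below: "u t [] x = 0" if t: "0 \<le> t" "t < s" for t x
  proof -
    obtain s' where "s' \<in> Z" "t < s'" using less_cSupD[of Z t] Z0 t(2) unfolding s_def by blast
    then show ?thesis using t(1) by (auto simp: Z_def)
  qed
  have upto: "u t [] x = 0" if "t \<in> {0..s}" for t x
  proof (cases "s = 0")
    case True
    then show ?thesis using that init by auto
  next
    case False
    then have "closure {0..<s} = {0..s}" using s by simp
    moreover have "continuous_on {0..s} (\<lambda>t. u t [] x)" using s by (intro continuous_on_subset[OF u_cont]) auto
    ultimately show ?thesis
      using continuous_constant_on_closure[of "{0..<s}" "\<lambda>t. u t [] x" 0 t] below that by auto
  qed
  have "s = T"
  proof (rule ccontr)
    assume "s \<noteq> T"
    then obtain s' where s': "s < s'" "s' \<le> T" "\<forall>t\<in>{0..s'}. \<forall>x. u t [] x = 0"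
      using vanishing_extends[of s] s upto by (metis order_le_less)
    then have "s' \<in> Z" using s by (simp add: Z_def)
    then have "s' \<le> s" unfolding s_def using bdd by (rule cSup_upper)
    then show False using s'(1) by simp
  qed
  then show ?thesis using upto t by simp
qed

end

section \<open>Iterated partial derivatives and uniqueness\<close>

definition iter_pderiv :: "'n::finite list \<Rightarrow> (real ^ 'n \<Rightarrow> 'a::real_normed_vector) \<Rightarrow> real ^ 'n \<Rightarrow> 'a" where
  "iter_pderiv l f = foldr partial_deriv l f"

lemma iter_pderiv_Nil [simp]: "iter_pderiv [] f = f" and iter_pderiv_Cons [simp]: "iter_pderiv (j # l) f = partial_deriv j (iter_pderiv l f)"
  by (simp_all add: iter_pderiv_def)

lemma cont_diff_iter_pderiv: "cont_diff k f \<Longrightarrow> length l \<le> k \<Longrightarrow> cont_diff (k - length l) (iter_pderiv l f)"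
proof (induction l)
  case (Cons j l)
  then have "cont_diff (Suc (k - Suc (length l))) (iter_pderiv l f)"
    by (simp add: Suc_diff_Suc less_eq_Suc_le)
  then show ?case by simp
qed simp

lemma dir_deriv_iter_pderiv:
  assumes "cont_diff k f" "length l < k"
  shows "dir_deriv j (iter_pderiv l f) (iter_pderiv (j # l) f)"
proof -
  have "cont_diff (Suc (k - Suc (length l))) (iter_pderiv l f)"
    using cont_diff_iter_pderiv[OF assms(1), of l] assms(2) by (simp add: Suc_diff_Suc less_eq_Suc_le)
  then have "(\<lambda>s::real. iter_pderiv l f (x + s *\<^sub>R axis j 1)) differentiable (at 0)" for x by simp
  then show ?thesis
    unfolding dir_deriv_def by (simp add: partial_deriv_def vector_derivative_works[symmetric])
qed

text \<open>
  Powers of \<open>1/\<i>\<close> can be collected in front, since partial derivatives commute with complex scalars.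
\<close>

lemma foldr_Dx:
  fixes f :: "real ^ 'n::finite \<Rightarrow> complex ^ 'm::finite"
  assumes "cont_diff k f" "length l \<le> k"
  shows "foldr Dx l f = (\<lambda>x. (1 / \<i>) ^ length l *s iter_pderiv l f x)"
  using assms(2)
proof (induction l)
  case Nil
  then show ?case by (simp add: fun_eq_iff)
next
  case (Cons j l)
  have pd: "partial_deriv j (\<lambda>x. c *s iter_pderiv l f x) x = c *s iter_pderiv (j # l) f x" for c x
  proof -
    have "bounded_linear ((*s) c :: complex ^ 'm \<Rightarrow> _)"
      by (rule bounded_linear_intro[where K = "cmod c"])
        (simp_all add: vec.scale_right_distrib scaleR_eq_smult vector_smult_assoc mult.commute norm_vector_scalar_mult)
    moreover have "((\<lambda>s. iter_pderiv l f (x + s *\<^sub>R axis j 1)) has_vector_derivative iter_pderiv (j # l) f x) (at 0)"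
      using dir_deriv_iter_pderiv[OF assms(1), of l j] Cons.prems by (simp add: dir_deriv_def)
    ultimately have "((\<lambda>s. c *s iter_pderiv l f (x + s *\<^sub>R axis j 1)) has_vector_derivative c *s iter_pderiv (j # l) f x) (at 0)"
      by (rule bounded_linear.has_vector_derivative)
    then show ?thesis unfolding partial_deriv_def by (rule vector_derivative_at)
  qed
  have IH: "foldr Dx l f = (\<lambda>x. (1 / \<i>) ^ length l *s iter_pderiv l f x)"
    by (rule Cons.IH) (use Cons.prems in simp)
  have "foldr Dx (j # l) f = Dx j (foldr Dx l f)" by simp
  also have "\<dots> = (\<lambda>x. (1 / \<i>) *s ((1 / \<i>) ^ length l *s iter_pderiv (j # l) f x))"
    unfolding IH Dx_def pd ..
  finally show ?case by (simp only: vector_smult_assoc list.size power_Suc add_Suc_right add_0_right)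
qed

lemma Dx_mi_eq_foldr:
  fixes f :: "real ^ 'n::{finite,linorder} \<Rightarrow> complex ^ 'm::finite"
  shows "Dx_mi \<beta> f = foldr Dx (index_list \<beta>) f"
proof -
  have "foldr Dx (replicate k j) v = (Dx j ^^ k) v" for k and j :: 'n and v :: "real ^ 'n::{finite,linorder} \<Rightarrow> complex ^ 'm"
    by (induction k) auto
  then have "foldr (\<lambda>j. Dx j ^^ \<beta> j) xs f = foldr Dx (concat (map (\<lambda>j. replicate (\<beta> j) j) xs)) f" for xs
    by (induction xs) auto
  then show ?thesis by (simp add: Dx_mi_def index_list_def)
qed

lemma Dx_mi_eq:
  assumes "cont_diff k f" "mi_order \<beta> \<le> k"
  shows "Dx_mi \<beta> f x = (1 / \<i>) ^ mi_order \<beta> *s iter_pderiv (index_list \<beta>) f x"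
  using foldr_Dx[of k f "index_list \<beta>"] assms by (simp add: Dx_mi_eq_foldr)

lemma norm_imag_power: "norm ((1 / \<i>) ^ k *s (z :: complex ^ 'm::finite)) = norm z"
  by (simp add: norm_vector_scalar_mult norm_power norm_divide)

lemma cont_diff_zero: "cont_diff k (\<lambda>x :: real ^ 'n::finite. 0 :: 'a::real_normed_vector)"
proof (induction k)
  case (Suc k)
  have "partial_deriv j (\<lambda>x :: real ^ 'n. 0 :: 'a) = (\<lambda>x. 0)" for j
    by (auto simp: partial_deriv_def fun_eq_iff)
  then show ?case using Suc by simp
qed simp

lemma op_A_eq_full_op:
  fixes a :: "('n::{finite,linorder}, 'm::finite) coeffs"
  assumes "cont_diff (2 * b) v"
  shows "op_A b a v x = full_op b a x (\<lambda>l. iter_pderiv l v x)"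
proof -
  have fin: "finite {\<beta> :: 'n \<Rightarrow> nat. mi_order \<beta> < 2 * b}" "finite {\<beta> :: 'n \<Rightarrow> nat. mi_order \<beta> = 2 * b}"
    by (rule finite_subset[OF _ finite_mi_order_le[of "2 * b"]], auto)+
  have comp: "(\<chi> i. \<Sum>j\<in>UNIV. \<Sum>\<beta>\<in>S. a \<beta> x $ i $ j * Dx_mi \<beta> v x $ j) = (\<Sum>\<beta>\<in>S. a \<beta> x *v Dx_mi \<beta> v x)" for S
    by (simp add: vec_eq_iff matrix_vector_mult_def) (intro allI sum.swap)
  have "op_A b a v x = (\<Sum>\<beta> | mi_order \<beta> = 2 * b. a \<beta> x *v Dx_mi \<beta> v x) + (\<Sum>\<beta> | mi_order \<beta> < 2 * b. a \<beta> x *v Dx_mi \<beta> v x)"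
    by (simp add: op_A_def op_A0_def op_A1_def comp)
  also have "\<dots> = (\<Sum>\<beta>\<in>{\<beta>. mi_order \<beta> = 2 * b} \<union> {\<beta>. mi_order \<beta> < 2 * b}. a \<beta> x *v Dx_mi \<beta> v x)"
    by (rule sum.union_disjoint[symmetric]) (use fin in auto)
  also have "{\<beta> :: 'n \<Rightarrow> nat. mi_order \<beta> = 2 * b} \<union> {\<beta>. mi_order \<beta> < 2 * b} = {\<beta>. mi_order \<beta> \<le> 2 * b}" by auto
  also have "(\<Sum>\<beta> | mi_order \<beta> \<le> 2 * b. a \<beta> x *v Dx_mi \<beta> v x) = full_op b a x (\<lambda>l. iter_pderiv l v x)"
    unfolding full_op_def by (rule sum.cong[OF refl]) (simp add: Dx_mi_eq[OF assms])
  finally show ?thesis .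
qed

lemma hoelder_modulus:
  fixes C \<gamma> e :: real
  assumes "0 < \<gamma>" "0 < e"
  shows "\<forall>\<^sub>F d in at_right 0. C * d powr \<gamma> \<le> e"
proof -
  have "((\<lambda>d. C * d powr \<gamma>) \<longlongrightarrow> C * 0 powr \<gamma>) (at_right 0)"
    using assms by (intro tendsto_intros) (auto intro!: eventually_at_rightI[of 0 1])
  then have "\<forall>\<^sub>F d in at_right 0. C * d powr \<gamma> < e"
    using assms by (intro order_tendstoD(2)) auto
  then show ?thesis by eventually_elim simp
qed

text \<open>
  Continuity in time passes from a function to its derivative: on a fixed step \<open>h\<close> the
  difference quotients converge, and they differ from the derivatives by the common modulus of continuity
  in \<open>x\<close>.
\<close>

lemma derivative_uniform_limit:
  fixes f f' :: "real \<Rightarrow> real ^ 'n::finite \<Rightarrow> 'a::real_normed_vector"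
  assumes f: "uniform_limit UNIV f (f t) (at t within S)" and t: "t \<in> S"
    and d: "\<And>s. s \<in> S \<Longrightarrow> dir_deriv j (f s) (f' s)"
    and m: "\<And>e. 0 < e \<Longrightarrow> \<forall>\<^sub>F d in at_right 0. \<forall>s\<in>S. \<forall>x x'. norm (x - x') \<le> d \<longrightarrow> norm (f' s x - f' s x') \<le> e"
  shows "uniform_limit UNIV f' (f' t) (at t within S)"
proof (rule uniform_limitI)
  fix e :: real assume e: "0 < e"
  have "0 < e / 4" using e by simp
  from at_right_0_witness[OF m[OF this]] obtain h where h: "0 < h" "\<And>s x x'. s \<in> S \<Longrightarrow> norm (x - x') \<le> h \<Longrightarrow> norm (f' s x - f' s x') \<le> e / 4" by blast
  have quot: "norm (f s (x + h *\<^sub>R axis j 1) - f s x - h *\<^sub>R f' s x) \<le> e / 4 * h" if "s \<in> S" for s x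
    using dir_deriv_quotient[OF d[OF that], of x h "f' s x" "e / 4"] h that by simp
  have "\<forall>\<^sub>F s in at t within S. s \<in> S \<and> (\<forall>x\<in>UNIV. dist (f s x) (f t x) < e / 8 * h)"
    using uniform_limitD[OF f, of "e / 8 * h"] e h(1) by (auto simp: eventually_at_filter elim: eventually_mono)
  then show "\<forall>\<^sub>F s in at t within S. \<forall>x\<in>UNIV. dist (f' s x) (f' t x) < e"
  proof eventually_elim
    case (elim s)
    show ?case
    proof
      fix x :: "real ^ 'n"
      define y where "y = x + h *\<^sub>R axis j 1"
      have s: "s \<in> S" and fx: "norm (f s x - f t x) < e / 8 * h" and fy: "norm (f s y - f t y) < e / 8 * h"
        using elim by (auto simp: dist_norm)
      define q where "q = (\<lambda>s. f s y - f s x - h *\<^sub>R f' s x)"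
      have q: "norm (q s) \<le> e / 4 * h" "norm (q t) \<le> e / 4 * h"
        using quot[OF t, of x] quot[OF s, of x] unfolding y_def q_def by auto
      have "h *\<^sub>R (f' s x - f' t x) = (q t - q s) + ((f s y - f t y) - (f s x - f t x))"
        by (simp add: q_def algebra_simps)
      also have "norm \<dots> \<le> (e / 4 * h + e / 4 * h) + (e / 8 * h + e / 8 * h)"
        using norm_triangle_ineq[of "q t - q s" "(f s y - f t y) - (f s x - f t x)"] norm_triangle_ineq4[of "q t" "q s"]
          norm_triangle_ineq4[of "f s y - f t y" "f s x - f t x"] q fx fy by linarith
      also have "(e / 4 * h + e / 4 * h) + (e / 8 * h + e / 8 * h) = h * (3 / 4 * e)" by (simp add: algebra_simps)
      finally have "norm (f' s x - f' t x) \<le> 3 / 4 * e" using h(1) by simp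
      then show "dist (f' s x) (f' t x) < e" using e by (simp add: dist_norm)
    qed
  qed
qed

text \<open>
  For vanishing initial value the singular term of the Caputo derivative disappears.
\<close>

lemma caputo_eq_derivative:
  assumes T: "0 < T" and \<alpha>: "\<alpha> < 1" and t: "t \<in> {0..T}" and g0: "g 0 = 0"
    and d: "(frac_integral (1 - \<alpha>) g has_vector_derivative w) (at t within {0..T})"
  shows "caputo T \<alpha> g t = w"
proof -
  have \<Gamma>: "0 < Gamma (1 - \<alpha>)" using \<alpha> by (intro Gamma_real_pos) simp
  have eq: "integral {0..s} (\<lambda>\<tau>. (s - \<tau>) powr (- \<alpha>) *\<^sub>R g \<tau>) = Gamma (1 - \<alpha>) *\<^sub>R frac_integral (1 - \<alpha>) g s" for s
    using \<Gamma> by (simp add: frac_integral_def)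
  have "((\<lambda>s. Gamma (1 - \<alpha>) *\<^sub>R frac_integral (1 - \<alpha>) g s) has_vector_derivative Gamma (1 - \<alpha>) *\<^sub>R w) (at t within {0..T})"
    by (rule bounded_linear.has_vector_derivative[OF bounded_linear_scaleR_right d])
  then have "vector_derivative (\<lambda>s. integral {0..s} (\<lambda>\<tau>. (s - \<tau>) powr (- \<alpha>) *\<^sub>R g \<tau>)) (at t within {0..T}) = Gamma (1 - \<alpha>) *\<^sub>R w"
    unfolding eq using T t by (intro vector_derivative_within_closed_interval) auto
  then show ?thesis using \<Gamma> g0 by (simp add: caputo_def)
qed

theorem theorem3:
  fixes \<alpha> T :: real and b :: nat
    and a :: "('n::{finite,linorder}, 'm::finite) coeffs"
    and u :: "real \<Rightarrow> real ^ 'n::{finite,linorder} \<Rightarrow> complex ^ 'm"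
  assumes "0 < \<alpha>" and "\<alpha> < 1" and "0 < T" and "1 \<le> b"
    and "bounded_coeffs b a"
    and "globally_Hoelder_coeffs b a"
    and "uniformly_strongly_parabolic b a"
    and "uniform_classical_solution \<alpha> T b a (\<lambda>t x. 0) (\<lambda>x. 0) u"
    and "\<And>\<beta>. mi_order \<beta> \<le> 2 * b \<Longrightarrow> bounded_in_space_time T (\<lambda>t. Dx_mi \<beta> (u t))"
    and "\<And>\<beta>. mi_order \<beta> \<le> 2 * b \<Longrightarrow> globally_Hoelder_in_space T (\<lambda>t. Dx_mi \<beta> (u t))"
  shows "\<forall>t\<in>{0..T}. \<forall>x. u t x = 0"
proof -
  obtain \<delta> where \<delta>: "0 < \<delta>" "\<And>x \<eta> z. Re (cinner (symbol_A0 b a x \<eta> *v z) z) \<le> - \<delta> * norm \<eta> ^ (2 * b) * (norm z)\<^sup>2"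
    using assms(7) unfolding uniformly_strongly_parabolic_def by blast
  have fin: "finite {\<beta> :: 'n \<Rightarrow> nat. mi_order \<beta> \<le> 2 * b}" by (rule finite_mi_order_le)
  have "\<forall>\<^sub>F A in at_top. \<forall>\<beta>\<in>{\<beta>. mi_order \<beta> \<le> 2 * b}. \<forall>i\<in>UNIV. \<forall>j\<in>UNIV. \<forall>x. cmod (a \<beta> x $ i $ j) \<le> A"
  proof (intro eventually_ball_finite fin finite ballI)
    fix \<beta> :: "'n \<Rightarrow> nat" and i j :: 'm assume "\<beta> \<in> {\<beta>. mi_order \<beta> \<le> 2 * b}"
    then have "bounded (range (\<lambda>x. a \<beta> x $ i $ j))" using assms(5) unfolding bounded_coeffs_def by blast
    then obtain A where A: "\<And>x. cmod (a \<beta> x $ i $ j) \<le> A" by (auto simp: bounded_iff)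
    show "\<forall>\<^sub>F A in at_top. \<forall>x. cmod (a \<beta> x $ i $ j) \<le> A"
      using eventually_ge_at_top[of A] by eventually_elim (use A order_trans in blast)
  qed
  then have "\<forall>\<^sub>F A in at_top. 0 \<le> A \<and> (\<forall>\<beta>\<in>{\<beta>. mi_order \<beta> \<le> 2 * b}. \<forall>i\<in>UNIV. \<forall>j\<in>UNIV. \<forall>x. cmod (a \<beta> x $ i $ j) \<le> A)"
    using eventually_ge_at_top[of "0 :: real"] by eventually_elim blast
  then have "\<exists>A. 0 \<le> A \<and> (\<forall>\<beta>\<in>{\<beta>. mi_order \<beta> \<le> 2 * b}. \<forall>i\<in>UNIV. \<forall>j\<in>UNIV. \<forall>x. cmod (a \<beta> x $ i $ j) \<le> A)"
    by (rule eventually_happens'[OF trivial_limit_at_top_linorder])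
  then obtain A where A: "0 \<le> A" "\<And>\<beta> x i j. mi_order \<beta> \<le> 2 * b \<Longrightarrow> cmod (a \<beta> x $ i $ j) \<le> A" by blast
  obtain C \<gamma> where C: "0 < \<gamma>" "\<And>\<beta> i j x y. mi_order \<beta> \<le> 2 * b \<Longrightarrow> cmod (a \<beta> x $ i $ j - a \<beta> y $ i $ j) \<le> C * norm (x - y) powr \<gamma>"
    using assms(6) unfolding globally_Hoelder_coeffs_def by blast
  have modulus: "\<exists>d>0. \<forall>\<beta> i j x x'. mi_order \<beta> \<le> 2 * b \<longrightarrow> norm (x - x') \<le> d \<longrightarrow> cmod (a \<beta> x $ i $ j - a \<beta> x' $ i $ j) \<le> e"
    if e: "0 < e" for e
  proof -
    obtain d where d: "0 < d" "\<bar>C\<bar> * d powr \<gamma> \<le> e" using at_right_0_witness[OF hoelder_modulus[OF C(1) e, of "\<bar>C\<bar>"]] by blast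
    have "cmod (a \<beta> x $ i $ j - a \<beta> x' $ i $ j) \<le> e" if "mi_order \<beta> \<le> 2 * b" "norm (x - x') \<le> d" for \<beta> i j x x'
    proof -
      have "C * norm (x - x') powr \<gamma> \<le> \<bar>C\<bar> * d powr \<gamma>" using that(2) C(1) by (intro mult_mono powr_mono2) auto
      then show ?thesis using C(2)[OF that(1), of x i j x'] d(2) by linarith
    qed
    then show ?thesis using d(1) by blast
  qed
  interpret parabolic_operator b a \<delta> A
    by unfold_locales (use assms(4) \<delta> A modulus in auto)
  have sol: "classical_solution \<alpha> T b a (\<lambda>t x. 0) (\<lambda>x. 0) u"
    and unif: "\<And>t. t \<in> {0..T} \<Longrightarrow> uniform_limit UNIV u (u t) (at t within {0..T})"
    using assms(8) unfolding uniform_classical_solution_def by auto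
  have u0: "u 0 x = 0" for x using sol unfolding classical_solution_def by blast
  have diff: "cont_diff (2 * b) (u t)" if "t \<in> {0..T}" for t
  proof (cases "t = 0")
    case True
    have "u 0 = (\<lambda>x. 0)" using u0 by auto
    then show ?thesis using True cont_diff_zero by metis
  next
    case False
    then show ?thesis using that sol unfolding classical_solution_def by auto
  qed
  define U where "U = (\<lambda>t l. iter_pderiv l (u t))"
  have U_Dx: "Dx_mi (count_list l) (u t) x = (1 / \<i>) ^ length l *s U t l x" if "l \<in> idx b" "t \<in> {0..T}" for l t x
  proof -
    have l: "index_list (count_list l) = l" using that(1) by (intro index_list_count) (simp add: idx_def)
    then have "mi_order (count_list l) = length l" by (metis length_index_list)
    then show ?thesis using Dx_mi_eq[OF diff[OF that(2)], of "count_list l" x] l that(1) by (simp add: U_def idx_def)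
  qed
  have order: "mi_order (count_list l) \<le> 2 * b" if "l \<in> idx b" for l :: "'n list"
    using that index_list_count[of l] length_index_list[of "count_list l"] by (auto simp: idx_def)
  have U_dir_deriv: "dir_deriv j (U t l) (U t (j # l))" if "t \<in> {0..T}" "j # l \<in> idx b" for t j l
    unfolding U_def using that by (intro dir_deriv_iter_pderiv[OF diff]) (auto simp: idx_def)
  have "\<forall>\<^sub>F B in at_top. \<forall>l\<in>idx b. \<forall>t\<in>{0..T}. \<forall>x. norm (U t l x) \<le> B"
  proof (rule eventually_ball_finite[OF finite_idx], rule ballI)
    fix l :: "'n list" assume l: "l \<in> idx b"
    have "bounded {Dx_mi (count_list l) (u t) x | t x. t \<in> {0..T}}"
      using assms(9)[OF order[OF l]] unfolding bounded_in_space_time_def .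
    then obtain B where B: "\<And>t x. t \<in> {0..T} \<Longrightarrow> norm (Dx_mi (count_list l) (u t) x) \<le> B"
      unfolding bounded_iff by blast
    have UB: "norm (U t l x) \<le> B" if "t \<in> {0..T}" for t x
      using B[OF that, of x] unfolding U_Dx[OF l that] norm_imag_power .
    show "\<forall>\<^sub>F B in at_top. \<forall>t\<in>{0..T}. \<forall>x. norm (U t l x) \<le> B"
      using eventually_ge_at_top[of B] by eventually_elim (use UB order_trans in blast)
  qed
  then have "\<forall>\<^sub>F B in at_top. 0 \<le> B \<and> (\<forall>l\<in>idx b. \<forall>t\<in>{0..T}. \<forall>x. norm (U t l x) \<le> B)"
    using eventually_ge_at_top[of "0 :: real"] by eventually_elim blast
  then have "\<exists>B. 0 \<le> B \<and> (\<forall>l\<in>idx b. \<forall>t\<in>{0..T}. \<forall>x. norm (U t l x) \<le> B)"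
    by (rule eventually_happens'[OF trivial_limit_at_top_linorder])
  then obtain B where B: "0 \<le> B" "\<And>t l x. t \<in> {0..T} \<Longrightarrow> l \<in> idx b \<Longrightarrow> norm (U t l x) \<le> B" by blast
  have U_hoelder: "\<exists>C \<gamma>. 0 < \<gamma> \<and> 0 \<le> C \<and> (\<forall>t\<in>{0..T}. \<forall>x y. norm (U t l x - U t l y) \<le> C * norm (x - y) powr \<gamma>)"
    if l: "l \<in> idx b" for l
  proof -
    obtain C \<gamma> where C: "0 < \<gamma>" "\<And>t x y. t \<in> {0..T} \<Longrightarrow> norm (Dx_mi (count_list l) (u t) x - Dx_mi (count_list l) (u t) y) \<le> C * norm (x - y) powr \<gamma>"
      using assms(10)[OF order[OF l]] unfolding globally_Hoelder_in_space_def by blast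
    have "norm (U t l x - U t l y) \<le> \<bar>C\<bar> * norm (x - y) powr \<gamma>" if t: "t \<in> {0..T}" for t x y
    proof -
      have "norm (U t l x - U t l y) \<le> C * norm (x - y) powr \<gamma>"
        using C(2)[OF t, of x y] unfolding U_Dx[OF l t] vec.scale_right_diff_distrib[symmetric] norm_imag_power .
      also have "\<dots> \<le> \<bar>C\<bar> * norm (x - y) powr \<gamma>" by (intro mult_right_mono) auto
      finally show ?thesis .
    qed
    then show ?thesis using C(1) by (intro exI[of _ "\<bar>C\<bar>"] exI[of _ \<gamma>]) auto
  qed
  have U_modulus: "\<forall>\<^sub>F d in at_right 0. \<forall>l\<in>idx b. \<forall>t\<in>{0..T}. \<forall>x x'. norm (x - x') \<le> d \<longrightarrow> norm (U t l x - U t l x') \<le> e"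
    if e: "0 < e" for e
  proof (rule eventually_ball_finite[OF finite_idx], rule ballI)
    fix l :: "'n list" assume l: "l \<in> idx b"
    obtain C \<gamma> where C: "0 < \<gamma>" "0 \<le> C" "\<And>t x y. t \<in> {0..T} \<Longrightarrow> norm (U t l x - U t l y) \<le> C * norm (x - y) powr \<gamma>"
      using U_hoelder[OF l] by blast
    show "\<forall>\<^sub>F d in at_right 0. \<forall>t\<in>{0..T}. \<forall>x x'. norm (x - x') \<le> d \<longrightarrow> norm (U t l x - U t l x') \<le> e"
      using hoelder_modulus[OF C(1) e, of C]
    proof eventually_elim
      case (elim d)
      show ?case
      proof (intro ballI allI impI)
        fix t and x x' :: "real ^ 'n::{finite,linorder}" assume t: "t \<in> {0..T}" and "norm (x - x') \<le> d"
        then have "C * norm (x - x') powr \<gamma> \<le> C * d powr \<gamma>" using C(1,2) by (intro mult_left_mono powr_mono2) auto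
        then show "norm (U t l x - U t l x') \<le> e" using C(3)[OF t, of x x'] elim by linarith
      qed
    qed
  qed
  have U_unif: "uniform_limit UNIV (\<lambda>s. U s l) (U t l) (at t within {0..T})" if "l \<in> idx b" "t \<in> {0..T}" for l t
    using that(1)
  proof (induction l)
    case Nil
    then show ?case using unif[OF that(2)] by (simp add: U_def)
  next
    case (Cons j l)
    have l: "l \<in> idx b" using Cons.prems idx_tail[of "[j]" l b] by simp
    show ?case
    proof (rule derivative_uniform_limit[OF Cons.IH[OF l] that(2)])
      show "dir_deriv j (U s l) (U s (j # l))" if "s \<in> {0..T}" for s using that Cons.prems by (rule U_dir_deriv)
      fix e :: real assume "0 < e"
      from U_modulus[OF this]
      show "\<forall>\<^sub>F d in at_right 0. \<forall>s\<in>{0..T}. \<forall>x x'. norm (x - x') \<le> d \<longrightarrow> norm (U s (j # l) x - U s (j # l) x') \<le> e"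
        by eventually_elim (use Cons.prems in blast)
    qed
  qed
  have U_cont: "continuous_on {0..T} (\<lambda>t. U t l x)" if "l \<in> idx b" for l x
    unfolding continuous_on_def using tendsto_uniform_limitI[OF U_unif[OF that]] by blast
  obtain H \<gamma>' where H: "0 < \<gamma>'" "0 \<le> H" "\<And>t x y. t \<in> {0..T} \<Longrightarrow> norm (U t [] x - U t [] y) \<le> H * norm (x - y) powr \<gamma>'"
    using U_hoelder[OF Nil_idx] by blast
  have eqn: "\<exists>w. continuous_on {0..T} w \<and>
      (\<forall>t\<in>{0..T}. (frac_integral (1 - \<alpha>) (\<lambda>\<tau>. U \<tau> [] x) has_vector_derivative w t) (at t within {0..T})) \<and>
      (\<forall>t\<in>{0<..T}. w t = full_op b a x (\<lambda>l. U t l x))" for x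
  proof -
    obtain w where w: "continuous_on {0..T} w"
      "\<And>t. t \<in> {0..T} \<Longrightarrow> (frac_integral (1 - \<alpha>) (\<lambda>\<tau>. u \<tau> x) has_vector_derivative w t) (at t within {0..T})"
      using sol unfolding classical_solution_def by blast
    have "w t = full_op b a x (\<lambda>l. U t l x)" if t: "t \<in> {0<..T}" for t
    proof -
      have t': "t \<in> {0..T}" using t by simp
      have "caputo T \<alpha> (\<lambda>\<tau>. u \<tau> x) t - op_A b a (u t) x = 0"
        using sol t unfolding classical_solution_def by blast
      moreover have "caputo T \<alpha> (\<lambda>\<tau>. u \<tau> x) t = w t"
        by (rule caputo_eq_derivative[OF assms(3,2) t' _ w(2)[OF t']]) (rule u0)
      ultimately show ?thesis using op_A_eq_full_op[OF diff[OF t'], of a x] by (simp add: U_def)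
    qed
    then show ?thesis using w unfolding U_def by auto
  qed
  interpret null_solution b a \<delta> A \<alpha> T B H \<gamma>' U
    by unfold_locales (fact assms(1) assms(2) assms(3) B H U_dir_deriv U_modulus U_cont eqn)+
  have "U t [] x = 0" if "t \<in> {0..T}" for t x
    by (rule vanishing[OF _ that]) (simp add: U_def u0)
  then show ?thesis by (simp add: U_def)
qed

end
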